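(* Let $R$ be a unique factorization domain with $\operatorname{char} R>0$, and let $R[x_1,x_2]$ be the polynomial ring in two variables over $R$. Let $0\ne a\in R$, let $0\ne \theta(x_2)\in x_2R[x_2]$, and let $0\ne F\in R[ax_1+\theta(x_2)]$. Let $\psi\in \operatorname{Aut}_R R[x_1,x_2]$ be the $R$-algebra automorphism with $\psi(x_1)=x_1+a^{-1}(\theta(x_2)-\theta(x_2+aF))$ and $\psi(x_2)=x_2+aF$. Then: (i) The invariant ring $R[x_1,x_2]^{\psi}$ is generated by at most three elements as an $R$-algebra. (ii) The following are equivalent: (a) The ideal $I:=(a,\,d\theta(x_2)/dx_2)$ of $R[x_1,x_2]$ is principal. (b) The plinth ideal $\operatorname{pl}(\psi)$ is a principal ideal of $R[x_1,x_2]^{\psi}$. (c) $R[x_1,x_2]^{\psi}$ is isomorphic to $R[x_1,x_2]$ as an $R$-algebra. (iii) If $R=k[x_3,\ldots,x_n]$ is a polynomial ring over a field $k$ (of positive characteristic), then (a), (b), (c) of (ii) are also equivalent to: (d) $R[x_1,x_2]^{\psi}$ is isomorphic to $R[x_1,x_2]$ as a $k$-algebra.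
   Context: For a ring $B$ and $\phi\in\operatorname{Aut}B$, write $B^{\phi}:=\{b\in B\mid \phi(b)=b\}$. The plinth ideal of $\phi$ is $\operatorname{pl}(\phi):=\{\phi(b)-b\mid b\in B\}\cap B^{\phi}$; it is an ideal of $B^{\phi}$. (The formula for $\psi(x_1)$ is a polynomial, since $a$ divides $\theta(x_2+aF)-\theta(x_2)$ in $R[x_1,x_2]$.) *)

theory Defs
  imports "HOL-Computational_Algebra.Computational_Algebra" "HOL-Library.Poly_Mapping"
begin

text \<open>The bivariate polynomial ring R[x1,x2] is modelled as the type 'a poly poly:
  an element is a polynomial in the (outer) variable x1 whose coefficients are
  polynomials over R in the (inner) variable x2.\<close>

definition cst2 :: "'a::comm_ring_1 \<Rightarrow> 'a poly poly" where
  "cst2 r = [:[:r:]:]"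

definition X1 :: "'a::comm_ring_1 poly poly" where
  "X1 = [:0, 1:]"

definition X2 :: "'a::comm_ring_1 poly poly" where
  "X2 = [:[:0, 1:]:]"

definition lift2 :: "'a::comm_ring_1 poly \<Rightarrow> 'a poly poly" where
  "lift2 g = [:g:]"

definition eval_at :: "'a::comm_ring_1 poly \<Rightarrow> 'a poly poly \<Rightarrow> 'a poly poly" where
  "eval_at g P = poly (map_poly cst2 g) P"

definition subst2 :: "'a::comm_ring_1 poly poly \<Rightarrow> 'a poly poly \<Rightarrow> 'a poly poly \<Rightarrow> 'a poly poly" where
  "subst2 P1 P2 p = poly (map_poly (\<lambda>c. eval_at c P2) p) P1"

definition inv_ring :: "('b \<Rightarrow> 'b) \<Rightarrow> 'b set" where
  "inv_ring \<phi> = {b. \<phi> b = b}"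

definition plinth :: "('b::ab_group_add \<Rightarrow> 'b) \<Rightarrow> 'b set" where
  "plinth \<phi> = {\<phi> b - b | b. True} \<inter> inv_ring \<phi>"

inductive_set alg_gen :: "'a::comm_ring_1 poly poly set \<Rightarrow> 'a poly poly set" for S where
  const: "cst2 r \<in> alg_gen S"
| gen: "s \<in> S \<Longrightarrow> s \<in> alg_gen S"
| add: "x \<in> alg_gen S \<Longrightarrow> y \<in> alg_gen S \<Longrightarrow> x + y \<in> alg_gen S"
| mult: "x \<in> alg_gen S \<Longrightarrow> y \<in> alg_gen S \<Longrightarrow> x * y \<in> alg_gen S"

definition principal_in :: "'b::comm_ring_1 set \<Rightarrow> 'b set \<Rightarrow> bool" where
  "principal_in A I \<longleftrightarrow> (\<exists>g\<in>A. I = {g * w | w. w \<in> A})"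

text \<open>phi is a ring isomorphism from R[x1,x2] onto the subring A which is linear over the
  scalar ring embedded via the map e (e = cst2 gives R-algebra isomorphisms).\<close>
definition alg_iso_onto :: "('c \<Rightarrow> 'b::comm_ring_1) \<Rightarrow> ('b \<Rightarrow> 'b) \<Rightarrow> 'b set \<Rightarrow> bool" where
  "alg_iso_onto e \<phi> A \<longleftrightarrow> bij_betw \<phi> UNIV A \<and>
     (\<forall>x y. \<phi> (x + y) = \<phi> x + \<phi> y) \<and> (\<forall>x y. \<phi> (x * y) = \<phi> x * \<phi> y) \<and>
     \<phi> 1 = 1 \<and> (\<forall>c. \<phi> (e c) = e c)"

text \<open>The polynomial ring k[x_0,...,x_{m-1}] inside the polynomial ring in countably many
  variables (monomials are finitely supported exponent vectors).\<close>
definition kpolys :: "nat \<Rightarrow> ((nat \<Rightarrow>\<^sub>0 nat) \<Rightarrow>\<^sub>0 'k::field) set" where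
  "kpolys m = {p. \<forall>\<mu>\<in>Poly_Mapping.keys p. Poly_Mapping.keys \<mu> \<subseteq> {..<m}}"

definition poly_ring_iso :: "nat \<Rightarrow> (((nat \<Rightarrow>\<^sub>0 nat) \<Rightarrow>\<^sub>0 'k::field) \<Rightarrow> 'a::comm_ring_1) \<Rightarrow> bool" where
  "poly_ring_iso m \<Phi> \<longleftrightarrow> bij_betw \<Phi> (kpolys m) UNIV \<and>
     (\<forall>p\<in>kpolys m. \<forall>q\<in>kpolys m. \<Phi> (p + q) = \<Phi> p + \<Phi> q \<and> \<Phi> (p * q) = \<Phi> p * \<Phi> q) \<and>
     \<Phi> 1 = 1"

end

theory Submission
  imports Defs "HOL-Number_Theory.Cong" "Jordan_Normal_Form.Determinant"
begin

text \<open>Put q = a x1 + \<theta>(x2), which is fixed by \<psi>, and N = x2^p - (aF)^(p-1) x2, the norm of x2. After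
  inverting a the invariants are R[q,N]. Write a = d a1 and \<theta>' = d \<tau> with no prime dividing both a1
  and \<tau>; then (q - g(N))/d is a polynomial q1, where \<theta> = g(x2^p) modulo d. The norm r of x1 satisfies
  a1^p r = P1(q1,N) with P1 congruent to q1^p - th1^(p)(N) modulo a1, where \<tau> = th1', and a
  comparison modulo the primes dividing a shows that the invariant ring A is
  R[q1,N,r] = R[Q,N,Z]/(a1^p Z - P1(Q,N)).

  The ideal in (a) is principal iff (a1,\<tau>) is the unit ideal of R[x2]. In that case P1(Q,N) = 0 can be
  solved for N modulo a1^p by Hensel lifting, so A is a polynomial ring, and the ideal generated by
  the elements a1 and v = (p-1)! (-\<tau>)^(p-1) + ... of pl(\<psi>)/(dF) is A, so pl(\<psi>) = dF A. Conversely, if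
  pl(\<psi>) is principal then it contains dF, whence x2 + e is divisible by a1 for some e in A, and
  differentiating at x1 = 0 puts 1 into (a1,\<tau>). Finally, let A be a polynomial ring in n variables over
  R or over k. All partial derivatives of a1^p Z - P1(Q,N) vanish at x1 = 0 modulo (a1,\<tau>), so
  n + 1 elements of A have dual derivations into R[x2]/(a1,\<tau>), while such derivations are
  determined by their values on n generators. Hence the identity matrix of size n + 1 factors
  through rank n, and taking determinants gives 1 = 0 modulo (a1,\<tau>).\<close>

hide_const (open) Module.smult

section \<open>Ring homomorphisms and subrings\<close>

definition rhom :: "('b::comm_ring_1 \<Rightarrow> 'c::comm_ring_1) \<Rightarrow> bool" where
  "rhom h \<longleftrightarrow> h 1 = 1 \<and> (\<forall>x y. h (x + y) = h x + h y) \<and> (\<forall>x y. h (x * y) = h x * h y)"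

lemma rhomI:
  assumes "h 1 = 1" "\<And>x y. h (x + y) = h x + h y" "\<And>x y. h (x * y) = h x * h y"
  shows "rhom h"
  using assms by (simp add: rhom_def)

lemma rhom_1: "rhom h \<Longrightarrow> h 1 = 1"
  and rhom_add: "rhom h \<Longrightarrow> h (x + y) = h x + h y"
  and rhom_mult: "rhom h \<Longrightarrow> h (x * y) = h x * h y"
  by (simp_all add: rhom_def)

lemma rhom_0: assumes "rhom h" shows "h 0 = 0"
  using rhom_add[OF assms, of 0 0] by simp

lemma rhom_uminus: assumes "rhom h" shows "h (- x) = - h x"
  using rhom_add[OF assms, of x "-x"] rhom_0[OF assms]
  by (metis add.right_inverse minus_unique)

lemma rhom_diff: assumes "rhom h" shows "h (x - y) = h x - h y"
  using rhom_add[OF assms, of x "-y"] rhom_uminus[OF assms] by simp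

lemma rhom_power: assumes "rhom h" shows "h (x ^ n) = h x ^ n"
  by (induction n) (simp_all add: rhom_1[OF assms] rhom_mult[OF assms])

lemma rhom_of_nat: assumes "rhom h" shows "h (of_nat n) = of_nat n"
  by (induction n) (simp_all add: rhom_1[OF assms] rhom_0[OF assms] rhom_add[OF assms])

lemma rhom_prod: assumes "rhom h" shows "h (prod f I) = (\<Prod>i\<in>I. h (f i))"
  by (induction I rule: infinite_finite_induct) (simp_all add: rhom_1[OF assms] rhom_mult[OF assms])

lemma rhom_sum: assumes "rhom h" shows "h (sum f I) = (\<Sum>i\<in>I. h (f i))"
  by (induction I rule: infinite_finite_induct) (simp_all add: rhom_0[OF assms] rhom_add[OF assms])

lemma rhom_dvd: assumes "rhom h" "x dvd y" shows "h x dvd h y"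
  using assms by (auto simp: dvd_def rhom_mult)

lemmas rhom_simps = rhom_0 rhom_1 rhom_add rhom_mult rhom_uminus rhom_diff rhom_power
  rhom_of_nat rhom_prod rhom_sum

lemma rhom_comp: "rhom g \<Longrightarrow> rhom h \<Longrightarrow> rhom (\<lambda>x. g (h x))"
  by (simp add: rhom_def)

lemma rhom_id: "rhom (\<lambda>x. x)"
  by (simp add: rhom_def)

lemma rhom_funpow:
  fixes h :: "'b::comm_ring_1 \<Rightarrow> 'b"
  shows "rhom h \<Longrightarrow> rhom (h ^^ n)"
  by (induction n) (simp_all add: rhom_def id_def)

lemma rhom_const_poly: "rhom (\<lambda>c. [:c:])"
  by (simp add: rhom_def one_pCons)

definition ev :: "('b::comm_ring_1 \<Rightarrow> 'c::comm_ring_1) \<Rightarrow> 'c \<Rightarrow> 'b poly \<Rightarrow> 'c" where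
  "ev h x p = poly (map_poly h p) x"

lemma ev_0 [simp]: "ev h x 0 = 0"
  by (simp add: ev_def)

lemma ev_pCons: assumes "rhom h" shows "ev h x (pCons c p) = h c + x * ev h x p"
  using rhom_0[OF assms] by (simp add: ev_def map_poly_pCons)

lemma rhom_ev: assumes "rhom h" shows "rhom (ev h x)"
proof (rule rhomI)
  show "ev h x 1 = 1"
    using rhom_1[OF assms] by (simp add: one_pCons ev_pCons[OF assms])
  show add: "ev h x (p + q) = ev h x p + ev h x q" for p q
    by (induction p q rule: poly_induct2) (simp_all add: ev_pCons[OF assms] rhom_simps[OF assms] algebra_simps)
  have sm: "ev h x (smult c q) = h c * ev h x q" for c q
    by (induction q) (simp_all add: ev_pCons[OF assms] rhom_simps[OF assms] algebra_simps)
  show "ev h x (p * q) = ev h x p * ev h x q" for p q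
    by (induction p)
      (simp_all add: ev_pCons[OF assms] rhom_simps[OF assms] algebra_simps add sm)
qed

lemma ev_const: "rhom h \<Longrightarrow> ev h x [:c:] = h c"
  by (simp add: ev_pCons)

lemma ev_X: "rhom h \<Longrightarrow> ev h x [:0, 1:] = x"
  by (simp add: ev_pCons rhom_simps)

lemma ev_monom: "rhom h \<Longrightarrow> ev h x (monom c n) = h c * x ^ n"
  by (simp add: ev_def map_poly_monom rhom_0 poly_monom)

lemma ev_smult: "rhom h \<Longrightarrow> ev h x (smult c p) = h c * ev h x p"
  using rhom_mult[OF rhom_ev, of h x "[:c:]" p] by (simp add: ev_const)

lemma ev_comp:
  assumes "rhom h" "rhom k"
  shows "k (ev h x p) = ev (\<lambda>c. k (h c)) (k x) p"
  by (induction p)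
    (simp_all add: ev_pCons[OF assms(1)] ev_pCons[OF rhom_comp[OF assms(2,1)]] rhom_simps[OF assms(2)])

lemma ev_map_poly:
  assumes "rhom h" "k 0 = 0"  "rhom (\<lambda>c. h (k c))"
  shows "ev h x (map_poly k p) = ev (\<lambda>c. h (k c)) x p"
  by (induction p) (simp_all add: ev_pCons[OF assms(1)] ev_pCons[OF assms(3)] map_poly_pCons assms(2))

lemma pcompose_ev: "pcompose p q = ev (\<lambda>c. [:c:]) q p"
  by (simp add: pcompose_altdef ev_def)

lemma rhom_pcompose: "rhom (\<lambda>p. pcompose p q)"
  unfolding pcompose_ev by (rule rhom_ev[OF rhom_const_poly])

lemma rhom_map_poly: assumes "rhom h" shows "rhom (map_poly h)"
proof -
  have "map_poly h p = ev (\<lambda>c. [:h c:]) [:0, 1:] p" for p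
    by (induction p)
      (simp_all add: ev_pCons[OF rhom_comp[OF rhom_const_poly assms]] map_poly_pCons rhom_0[OF assms])
  moreover have "rhom (ev (\<lambda>c. [:h c:]) [:0, 1:])"
    by (rule rhom_ev[OF rhom_comp[OF rhom_const_poly assms]])
  ultimately show ?thesis by (simp add: rhom_def)
qed

lemma rhom_coeff_0: "rhom (\<lambda>p. coeff p 0)"
  by (simp add: rhom_def coeff_mult_0)

definition subrng :: "'b::comm_ring_1 set \<Rightarrow> bool" where
  "subrng S \<longleftrightarrow> 1 \<in> S \<and> (\<forall>x\<in>S. - x \<in> S) \<and> (\<forall>x\<in>S. \<forall>y\<in>S. x + y \<in> S) \<and> (\<forall>x\<in>S. \<forall>y\<in>S. x * y \<in> S)"

lemma subrng_1: "subrng S \<Longrightarrow> 1 \<in> S"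
  and subrng_uminus: "subrng S \<Longrightarrow> x \<in> S \<Longrightarrow> - x \<in> S"
  and subrng_add: "subrng S \<Longrightarrow> x \<in> S \<Longrightarrow> y \<in> S \<Longrightarrow> x + y \<in> S"
  and subrng_mult: "subrng S \<Longrightarrow> x \<in> S \<Longrightarrow> y \<in> S \<Longrightarrow> x * y \<in> S"
  by (simp_all add: subrng_def)

lemma subrng_diff: "subrng S \<Longrightarrow> x \<in> S \<Longrightarrow> y \<in> S \<Longrightarrow> x - y \<in> S"
  using subrng_add[of S x "-y"] subrng_uminus by auto

lemma subrng_0: "subrng S \<Longrightarrow> 0 \<in> S"
  using subrng_diff[of S 1 1] subrng_1 by auto

lemma subrng_power: "subrng S \<Longrightarrow> x \<in> S \<Longrightarrow> x ^ n \<in> S"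
  by (induction n) (auto intro: subrng_1 subrng_mult)

lemma subrng_sum: "subrng S \<Longrightarrow> (\<And>i. i \<in> I \<Longrightarrow> f i \<in> S) \<Longrightarrow> sum f I \<in> S"
  by (induction I rule: infinite_finite_induct) (auto intro: subrng_0 subrng_add)

lemma subrng_prod: "subrng S \<Longrightarrow> (\<And>i. i \<in> I \<Longrightarrow> f i \<in> S) \<Longrightarrow> prod f I \<in> S"
  by (induction I rule: infinite_finite_induct) (auto intro: subrng_1 subrng_mult)

lemma subrng_of_nat: "subrng S \<Longrightarrow> of_nat n \<in> S"
  by (induction n) (auto intro: subrng_0 subrng_1 subrng_add)

lemmas subrng_intros = subrng_0 subrng_1 subrng_add subrng_mult subrng_uminus subrng_diff
  subrng_power subrng_of_nat

lemma subrng_UNIV: "subrng UNIV"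
  by (simp add: subrng_def)

lemma subrng_range: assumes "rhom h" shows "subrng (range h)"
  unfolding subrng_def
  by (auto simp: rhom_uminus[OF assms, symmetric] rhom_add[OF assms, symmetric]
      rhom_mult[OF assms, symmetric] intro: range_eqI[of _ _ 1] simp: rhom_1[OF assms])

lemma subrng_fixed: assumes "rhom h" shows "subrng {x. h x = x}"
  by (simp add: subrng_def rhom_simps[OF assms])

lemma ev_mem:
  assumes "rhom h" "subrng S" "\<And>c. h c \<in> S" "x \<in> S"
  shows "ev h x p \<in> S"
proof (induction p)
  case 0
  show ?case using subrng_0[OF assms(2)] by simp
next
  case (pCons c p)
  then show ?case
    unfolding ev_pCons[OF assms(1)] by (intro subrng_add subrng_mult assms) auto
qed

lemma ev_shift:
  assumes "rhom h" "subrng S" "\<And>c. h c \<in> S" "x \<in> S" "u \<in> S"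
  shows "\<exists>w\<in>S. ev h (x + u) p = ev h x p + u * w"
proof (induction p)
  case 0
  show ?case using subrng_0[OF assms(2)] by (intro bexI[of _ 0]) auto
next
  case (pCons c p)
  then obtain w where w: "w \<in> S" "ev h (x + u) p = ev h x p + u * w" by blast
  have "ev h (x + u) (pCons c p) = ev h x (pCons c p) + u * (ev h x p + (x + u) * w)"
    by (simp only: ev_pCons[OF assms(1)] w) (simp add: algebra_simps)
  moreover have "ev h x p + (x + u) * w \<in> S"
    using w assms by (intro subrng_intros[OF assms(2)] ev_mem) auto
  ultimately show ?case by blast
qed

lemma ev_taylor:
  assumes "rhom h" "subrng S" "\<And>c. h c \<in> S" "x \<in> S" "u \<in> S"
  shows "\<exists>w\<in>S. ev h (x + u) p = ev h x p + u * ev h x (pderiv p) + u\<^sup>2 * w"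
proof (induction p)
  case 0
  show ?case using subrng_0[OF assms(2)] by (intro bexI[of _ 0]) auto
next
  case (pCons c p)
  note r = rhom_simps[OF rhom_ev[OF assms(1)]]
  from pCons obtain w where w: "w \<in> S"
    "ev h (x + u) p = ev h x p + u * ev h x (pderiv p) + u\<^sup>2 * w" by blast
  have "ev h (x + u) (pCons c p) = ev h x (pCons c p) + u * ev h x (pderiv (pCons c p))
      + u\<^sup>2 * (ev h x (pderiv p) + (x + u) * w)"
    by (simp only: ev_pCons[OF assms(1)] w pderiv_pCons r rhom_0[OF assms(1)])
      (simp add: algebra_simps power2_eq_square)
  moreover have "ev h x (pderiv p) + (x + u) * w \<in> S"
    using w assms by (intro subrng_intros[OF assms(2)] ev_mem) auto
  ultimately show ?case by blast
qed

lemma ev_diff_dvd: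
  assumes "rhom h"
  shows "x - y dvd ev h x p - ev h y p"
  using ev_shift[OF assms subrng_UNIV, of y "x - y" p] by auto

lemma ev_dvd_diff: "rhom h \<Longrightarrow> c dvd x - y \<Longrightarrow> c dvd ev h x p - ev h y p"
  by (meson dvd_trans ev_diff_dvd)

lemma dvd_diff_mult:
  fixes c :: "'b::comm_ring_1"
  assumes "c dvd x - x'" "c dvd y - y'" shows "c dvd x * y - x' * y'"
proof -
  have "x * y - x' * y' = (x - x') * y + x' * (y - y')" by (simp add: algebra_simps)
  then show ?thesis using assms by simp
qed

lemma dvd_diff_power:
  fixes c :: "'b::comm_ring_1"
  assumes "c dvd x - x'" shows "c dvd x ^ n - x' ^ n"
  using assms by (induction n) (auto intro: dvd_diff_mult)

lemma dvd_diff_prod: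
  fixes c :: "'b::comm_ring_1"
  assumes "\<And>i. i \<in> I \<Longrightarrow> c dvd f i - g i" shows "c dvd prod f I - prod g I"
  using assms by (induction I rule: infinite_finite_induct) (auto intro: dvd_diff_mult)

lemma dvd_diff_add:
  fixes c :: "'b::comm_ring_1"
  assumes "c dvd x - x'" "c dvd y - y'" shows "c dvd (x + y) - (x' + y')"
  using dvd_add[OF assms] by (simp add: algebra_simps)

lemma dvd_diff_trans:
  fixes c :: "'b::comm_ring_1"
  assumes "c dvd x - y" "c dvd y - z" shows "c dvd x - z"
  using dvd_add[OF assms] by simp

lemma dvd_diff_sym:
  fixes c :: "'b::comm_ring_1"
  assumes "c dvd x - y" shows "c dvd y - x"
  using assms by (metis dvd_minus_iff minus_diff_eq)

lemma dvd_diff_cancel: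
  fixes c :: "'b::comm_ring_1"
  assumes "c dvd x - y" shows "c dvd x \<longleftrightarrow> c dvd y"
  using assms by (metis dvd_add_left_iff dvd_diff_sym diff_add_cancel)

section \<open>Prime characteristic\<close>

lemma add_power_char:
  fixes x y :: "'b::comm_ring_1"
  assumes "prime CHAR('b)"
  shows "(x + y) ^ CHAR('b) = x ^ CHAR('b) + y ^ CHAR('b)"
proof -
  let ?p = "CHAR('b)"
  have p: "?p > 0" using assms by (simp add: prime_gt_0_nat)
  have "(x + y) ^ ?p = (\<Sum>k\<le>?p. of_nat (?p choose k) * x ^ k * y ^ (?p - k))"
    by (rule binomial_ring)
  also have "\<dots> = (\<Sum>k\<in>{0, ?p}. of_nat (?p choose k) * x ^ k * y ^ (?p - k))"
  proof (rule sum.mono_neutral_right)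
    show "\<forall>i\<in>{..?p} - {0, ?p}. of_nat (?p choose i) * x ^ i * y ^ (?p - i) = 0"
    proof
      fix i assume "i \<in> {..?p} - {0, ?p}"
      then have "?p dvd (?p choose i)" using p assms by (intro dvd_choose_prime) auto
      then have "(of_nat (?p choose i) :: 'b) = 0" by (simp add: of_nat_eq_0_iff_char_dvd)
      then show "of_nat (?p choose i) * x ^ i * y ^ (?p - i) = 0" by simp
    qed
  qed auto
  finally show ?thesis using p by simp
qed

lemma uminus_power_char:
  fixes x :: "'b::comm_ring_1"
  assumes "prime CHAR('b)"
  shows "(- x) ^ CHAR('b) = - (x ^ CHAR('b))"
  using minus_power_prime_CHAR[OF refl assms] .

lemma diff_power_char:
  fixes x y :: "'b::comm_ring_1"
  assumes "prime CHAR('b)"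
  shows "(x - y) ^ CHAR('b) = x ^ CHAR('b) - y ^ CHAR('b)"
  using add_power_char[OF assms, of x "-y"] uminus_power_char[OF assms, of y] by simp

lemma ev_power_char:
  fixes h :: "'b::comm_ring_1 \<Rightarrow> 'c::comm_ring_1"
  assumes "rhom h" "prime p" "CHAR('c) = p"
  shows "ev h x g ^ p = ev h (x ^ p) (map_poly (\<lambda>c. c ^ p) g)"
proof (induction g)
  case 0
  then show ?case using prime_gt_0_nat[OF assms(2)] by (simp add: zero_power)
next
  case (pCons c g)
  have p: "prime CHAR('c)" using assms by simp
  have "ev h x (pCons c g) ^ p = h c ^ p + x ^ p * ev h x g ^ p"
    using add_power_char[OF p, of "h c" "x * ev h x g"] assms
    by (simp add: ev_pCons power_mult_distrib)
  with pCons show ?case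
    using prime_gt_0_nat[OF assms(2)]
    by (simp add: zero_power map_poly_pCons ev_pCons[OF assms(1)] rhom_power[OF assms(1)])
qed

lemma of_nat_unit_char:
  assumes "prime CHAR('b::comm_ring_1)" "\<not> CHAR('b) dvd i"
  shows "\<exists>u::'b. of_nat i * u = 1"
proof -
  have "coprime i CHAR('b)" using assms prime_imp_coprime coprime_commute by blast
  then obtain j where j: "[i * j = 1] (mod CHAR('b))"
    by (metis cong_solve_coprime_nat coprime_commute One_nat_def)
  have "CHAR('b) > 1" using assms(1) prime_gt_1_nat by blast
  have "(of_nat (i * j) :: 'b) = of_nat 1"
  proof -
    have "i * j = CHAR('b) * (i * j div CHAR('b)) + 1"
      using j \<open>CHAR('b) > 1\<close> by (metis cong_def mult_div_mod_eq mod_less One_nat_def)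
    then have "(of_nat (i * j) :: 'b) = of_nat (CHAR('b) * (i * j div CHAR('b)) + 1)" by simp
    then show ?thesis by simp
  qed
  then show ?thesis by auto
qed

lemma monic_division:
  fixes g :: "'b::idom poly"
  assumes "lead_coeff g = 1"
  obtains q r where "f = g * q + r" "r = 0 \<or> degree r < degree g"
proof -
  have "g \<noteq> 0" using assms by auto
  obtain q r where "pseudo_divmod f g = (q, r)" by (cases "pseudo_divmod f g")
  from pseudo_divmod[OF \<open>g \<noteq> 0\<close> this] that[of q r] assms show ?thesis by simp
qed

lemma shift_invariant_const:
  fixes h :: "'b::idom poly"
  assumes p: "prime CHAR('b)" and u: "u \<noteq> 0" and inv: "pcompose h [:u, 1:] = h"
    and deg: "degree h < CHAR('b)"
  shows "h = [:poly h 0:]"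
proof (rule ccontr)
  assume "h \<noteq> [:poly h 0:]"
  then have nz: "h - [:poly h 0:] \<noteq> 0" by simp
  have step: "poly h (u + z) = poly h z" for z
    using arg_cong[OF inv, of "\<lambda>q. poly q z"] by (simp add: poly_pcompose)
  have val: "poly h (of_nat j * u) = poly h 0" for j
  proof (induction j)
    case (Suc j)
    then show ?case using step[of "of_nat j * u"] by (simp add: algebra_simps)
  qed simp
  let ?J = "(\<lambda>j. of_nat j * u) ` {..<CHAR('b)}"
  have "inj_on (\<lambda>j. of_nat j * u) {..<CHAR('b)}"
  proof (rule inj_onI)
    fix i j assume ij: "i \<in> {..<CHAR('b)}" "j \<in> {..<CHAR('b)}" "of_nat i * u = of_nat j * u"
    then have "(of_nat i :: 'b) = of_nat j" using u by simp
    then have "[i = j] (mod CHAR('b))" by (simp add: of_nat_eq_iff_cong_CHAR)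
    then show "i = j" using ij by (simp add: cong_def)
  qed
  then have "card ?J = CHAR('b)" by (simp add: card_image)
  moreover have "?J \<subseteq> {x. poly (h - [:poly h 0:]) x = 0}" using val by auto
  moreover have "finite {x. poly (h - [:poly h 0:]) x = 0}" using nz by (rule poly_roots_finite)
  ultimately have "CHAR('b) \<le> card {x. poly (h - [:poly h 0:]) x = 0}"
    by (metis card_mono)
  also have "\<dots> \<le> degree (h - [:poly h 0:])" using nz by (rule card_poly_roots_bound)
  also have "\<dots> \<le> degree h" by (rule degree_diff_le) auto
  finally show False using deg by simp
qed

definition artin_schreier :: "'b::comm_ring_1 \<Rightarrow> 'b poly" where
  "artin_schreier u = monom 1 CHAR('b) - monom (u ^ (CHAR('b) - 1)) 1"

lemma artin_schreier_shift:
  fixes u :: "'b::comm_ring_1"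
  assumes p: "prime CHAR('b)"
  shows "pcompose (artin_schreier u) [:u, 1:] = artin_schreier u"
proof -
  let ?p = "CHAR('b)"
  have p0: "?p > 0" using p by (simp add: prime_gt_0_nat)
  have m: "pcompose (monom c n) q = [:c:] * q ^ n" for c :: 'b and n q
    by (simp add: pcompose_ev ev_monom rhom_const_poly)
  have split: "[:u, 1:] = monom 1 1 + [:u:]" by (simp add: monom_altdef)
  have "[:u, 1:] ^ ?p = monom 1 ?p + [:u ^ ?p:]"
    using add_power_char[where 'b = "'b poly", of "monom 1 1" "[:u:]"] p
    by (simp add: split monom_power poly_const_pow)
  moreover have "[:u ^ (?p - 1):] * [:u, 1:] = [:u ^ ?p:] + monom (u ^ (?p - 1)) 1"
    using p0 by (simp add: monom_altdef power_eq_if mult.commute)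
  ultimately show ?thesis
    unfolding artin_schreier_def rhom_diff[OF rhom_pcompose] m by (simp add: one_pCons[symmetric])
qed

lemma artin_schreier_degree:
  fixes u :: "'b::comm_ring_1"
  assumes p: "prime CHAR('b)"
  shows "degree (artin_schreier u) = CHAR('b)" "lead_coeff (artin_schreier u) = 1"
proof -
  have p1: "CHAR('b) > 1" by (rule prime_gt_1_nat[OF p])
  show d: "degree (artin_schreier u) = CHAR('b)"
  proof (rule antisym)
    show "degree (artin_schreier u) \<le> CHAR('b)"
      unfolding artin_schreier_def using p1 by (intro degree_diff_le) (auto intro: order_trans[OF degree_monom_le])
    show "CHAR('b) \<le> degree (artin_schreier u)"
      using p1 by (intro le_degree) (simp add: artin_schreier_def)
  qed
  show "lead_coeff (artin_schreier u) = 1"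
    unfolding d using p1 by (simp add: artin_schreier_def)
qed

lemma shift_invariant:
  fixes h :: "'b::idom poly"
  assumes p: "prime CHAR('b)" and u: "u \<noteq> 0" and inv: "pcompose h [:u, 1:] = h"
  shows "\<exists>k. h = pcompose k (artin_schreier u)"
  using inv
proof (induction "degree h" arbitrary: h rule: less_induct)
  case less
  let ?N = "artin_schreier u"
  note N = artin_schreier_degree[OF p, of u] 
  have p0: "CHAR('b) > 0" using p by (simp add: prime_gt_0_nat)
  show ?case
  proof (cases "degree h < CHAR('b)")
    case True
    have "pcompose [:poly h 0:] ?N = [:poly h 0:]" by (rule pcompose_const)
    with shift_invariant_const[OF p u less.prems True] have "h = pcompose [:poly h 0:] ?N"
      by (rule trans[OF _ sym])
    then show ?thesis by blast
  next
    case False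
    obtain q r where qr: "h = ?N * q + r" "r = 0 \<or> degree r < degree ?N"
      using monic_division[OF N(2)] by blast
    let ?s = "\<lambda>g. pcompose g [:u, 1:]"
    have "?N * ?s q + ?s r = ?N * q + r"
      using less.prems unfolding qr(1) by (simp add: rhom_simps[OF rhom_pcompose] artin_schreier_shift[OF p])
    then have eq: "?N * (?s q - q) = r - ?s r" by (simp add: algebra_simps)
    have dr: "degree r < CHAR('b)" using qr(2) N p0 by auto
    have "?s q - q = 0"
    proof (rule ccontr)
      assume nz: "?s q - q \<noteq> 0"
      have "degree (?N * (?s q - q)) = CHAR('b) + degree (?s q - q)"
        using nz N p0 by (subst degree_mult_eq) auto
      moreover have "degree (r - ?s r) < CHAR('b)"
        using dr by (intro degree_diff_less) (simp_all add: degree_pcompose)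
      ultimately show False using eq by simp
    qed
    then have sq: "?s q = q" and sr: "?s r = r" using eq by simp_all
    have r: "r = [:poly r 0:]" using shift_invariant_const[OF p u sr dr] .
    have "q \<noteq> 0" using qr dr False by auto
    then have "degree h = CHAR('b) + degree q"
    proof -
      have "degree (?N * q) = CHAR('b) + degree q"
        using \<open>q \<noteq> 0\<close> N p0 by (subst degree_mult_eq) auto
      then show ?thesis using qr(1) dr by (metis degree_add_eq_left trans_less_add1)
    qed
    then obtain k where k: "q = pcompose k ?N" using less.hyps[OF _ sq] p0 by auto
    have "h = pcompose (pCons (poly r 0) k) ?N"
      unfolding pcompose_pCons k[symmetric] r[symmetric] using qr(1) by (simp only: add.commute)
    then show ?thesis by blast
  qed
qed

section \<open>Divisibility by constants\<close>

lemma cancel_const: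
  fixes e :: "'a::{factorial_semiring,idom} \<Rightarrow> 'b::idom"
  assumes e: "rhom e" and pr: "\<And>l. prime l \<Longrightarrow> prime_elem (e l)"
    and "c \<noteq> 0" "\<And>l. prime l \<Longrightarrow> l dvd c \<Longrightarrow> \<not> e l dvd v" "e c dvd w * v"
  shows "e c dvd w"
  using assms(3-)
proof (induction c arbitrary: w rule: prime_divisors_induct)
  case (unit x)
  then have "e x dvd 1" using rhom_dvd[OF e, of x 1] by (simp add: rhom_1[OF e])
  then show ?case by (rule dvd_trans) simp
next
  case (factor l c)
  have "e l dvd w * v"
    using factor.prems(3) unfolding rhom_mult[OF e] by (rule dvd_mult_left)
  moreover have "\<not> e l dvd v" by (rule factor.prems(2)[OF factor.hyps(1) dvd_triv_left])
  ultimately have "e l dvd w" using pr[OF factor.hyps(1)] by (simp add: prime_elem_dvd_mult_iff)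
  then obtain w1 where w1: "w = e l * w1" by (elim dvdE)
  have "e l \<noteq> 0" using pr[OF factor.hyps(1)] by (simp add: prime_elem_def)
  then have "e c dvd w1 * v" using factor.prems(3) by (simp add: w1 rhom_mult[OF e] mult.assoc)
  moreover have "c \<noteq> 0" using factor.prems(1) by auto
  moreover have "\<And>k. prime k \<Longrightarrow> k dvd c \<Longrightarrow> \<not> e k dvd v"
    using factor.prems(2) dvd_mult by blast
  ultimately have "e c dvd w1" using factor.IH by blast
  then show ?case by (simp add: w1 rhom_mult[OF e])
qed simp

lemma dvd_power_of_prime_dvd:
  fixes e :: "'a::{factorial_semiring,idom} \<Rightarrow> 'b::idom"
  assumes e: "rhom e"
    and "c \<noteq> 0" "\<And>l. prime l \<Longrightarrow> l dvd c \<Longrightarrow> e l dvd v"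
  shows "\<exists>n. e c dvd v ^ n"
  using assms(2-)
proof (induction c rule: prime_divisors_induct)
  case (unit x)
  then have "e x dvd e 1" using rhom_dvd[OF e] by blast
  then show ?case by (intro exI[of _ 0]) (simp add: rhom_1[OF e])
next
  case (factor l c)
  then obtain n where n: "e c dvd v ^ n" by auto
  have "e l dvd v" by (rule factor.prems(2)[OF factor.hyps(1) dvd_triv_left])
  then have "e (l * c) dvd v ^ Suc n" using n by (simp add: rhom_mult[OF e] mult_dvd_mono)
  then show ?case by blast
qed simp

lemma reduce_mod_const:
  fixes V :: "'b::idom poly"
  shows "\<exists>V'. [:l:] dvd V - V' \<and> (V' = 0 \<or> \<not> l dvd lead_coeff V')"
proof (induction "degree V" arbitrary: V rule: less_induct)
  case less
  show ?case
  proof (cases "V = 0 \<or> \<not> l dvd lead_coeff V")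
    case True
    then show ?thesis by (intro exI[of _ V]) auto
  next
    case False
    then obtain c where c: "lead_coeff V = l * c" by auto
    let ?W = "V - monom (lead_coeff V) (degree V)"
    have m: "[:l:] dvd monom (lead_coeff V) (degree V)"
      unfolding c by (simp add: const_poly_dvd_iff)
    show ?thesis
    proof (cases "degree V = 0")
      case True
      then have "V = monom (lead_coeff V) (degree V)" by (auto elim!: degree_eq_zeroE simp: monom_0)
      then show ?thesis using m by (intro exI[of _ 0]) auto
    next
      case False
      have "degree ?W < degree V"
      proof (rule degree_lessI)
        show "?W \<noteq> 0 \<or> degree V > 0" using False by simp
        show "\<forall>k\<ge>degree V. coeff ?W k = 0"
          using coeff_eq_0[of V] by (auto simp: le_less)
      qed
      then obtain V' where V': "[:l:] dvd ?W - V'" "V' = 0 \<or> \<not> l dvd lead_coeff V'"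
        using less.hyps by blast
      have "[:l:] dvd V - V'" using dvd_add[OF V'(1) m] by (simp add: algebra_simps)
      then show ?thesis using V'(2) by blast
    qed
  qed
qed

lemma dvd_pcompose_cancel:
  fixes V :: "'b::idom poly"
  assumes l: "prime_elem l" and d: "degree r > 0" "\<not> l dvd lead_coeff r"
    and dvd: "[:l:] dvd pcompose V r"
  shows "[:l:] dvd V"
proof -
  obtain V' where V': "[:l:] dvd V - V'" "V' = 0 \<or> \<not> l dvd lead_coeff V'"
    using reduce_mod_const by blast
  have "[:l:] dvd pcompose (V - V') r"
    using rhom_dvd[OF rhom_pcompose V'(1), of r] by (simp only: pcompose_const)
  then have "[:l:] dvd pcompose V r - pcompose V' r" by (simp add: pcompose_diff)
  then have "[:l:] dvd pcompose V' r" using dvd dvd_diff_cancel by blast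
  then have "l dvd lead_coeff (pcompose V' r)" by (simp add: const_poly_dvd_iff)
  then have "l dvd lead_coeff V' * lead_coeff r ^ degree V'" using d by (simp add: lead_coeff_comp)
  then have "l dvd lead_coeff V' \<or> l dvd lead_coeff r ^ degree V'"
    using l by (simp only: prime_elem_dvd_mult_iff)
  then have "l dvd lead_coeff V'" using l d prime_elem_dvd_power by blast
  then have "V' = 0" using V' by blast
  then show ?thesis using V' by simp
qed

lemma unit_mod_prime_const:
  fixes g h :: "'b::idom poly"
  assumes l: "prime_elem l" and dvd: "[:l:] dvd g * h - 1"
  shows "[:l:] dvd g - [:coeff g 0:]"
proof -
  obtain g' where g': "[:l:] dvd g - g'" "g' = 0 \<or> \<not> l dvd lead_coeff g'"
    using reduce_mod_const by blast
  obtain h' where h': "[:l:] dvd h - h'" "h' = 0 \<or> \<not> l dvd lead_coeff h'"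
    using reduce_mod_const by blast
  have "[:l:] dvd g * h - g' * h'" using g' h' by (intro dvd_diff_mult)
  then have 1: "[:l:] dvd g' * h' - 1" using dvd by (meson dvd_diff_trans dvd_diff_sym)
  have nl: "\<not> l dvd 1" using l by (simp add: prime_elem_def)
  have "g' * h' \<noteq> 0"
  proof
    assume "g' * h' = 0"
    then have "[:l:] dvd - 1" using 1 by (simp only: diff_0)
    then have "[:l:] dvd [:1:]" by (simp only: one_pCons dvd_minus_iff)
    then show False using nl by simp
  qed
  then have nz: "g' \<noteq> 0" "h' \<noteq> 0" by auto
  have "degree (g' * h') = 0"
  proof (rule ccontr)
    assume d: "degree (g' * h') \<noteq> 0"
    have "l dvd coeff (g' * h' - 1) (degree (g' * h'))" using 1 by (simp only: const_poly_dvd_iff)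
    then have "l dvd lead_coeff (g' * h')" using d by simp
    then have "l dvd lead_coeff g' * lead_coeff h'" by (simp add: lead_coeff_mult)
    then show False using g' h' nz l by (simp add: prime_elem_dvd_mult_iff)
  qed
  then have "degree g' = 0" using nz by (simp add: degree_mult_eq)
  then obtain c where c: "g' = [:c:]" by (auto elim: degree_eq_zeroE)
  have "l dvd coeff (g - g') n" for n using g' by (simp only: const_poly_dvd_iff)
  then have "l dvd coeff (g - g') n" for n by blast
  then have "l dvd coeff (g - [:coeff g 0:]) n" for n
  proof (cases n)
    case (Suc k)
    then show ?thesis using \<open>l dvd coeff (g - g') n\<close> by (simp add: c)
  qed simp
  then show ?thesis by (simp add: const_poly_dvd_iff)
qed

lemma split_common_divisor:
  fixes a :: "'a::{factorial_semiring,idom}" and t :: "'a poly"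
  assumes "a \<noteq> 0"
  shows "\<exists>d a1 tau. a = d * a1 \<and> t = smult d tau \<and>
    (\<forall>l. prime l \<longrightarrow> l dvd a1 \<longrightarrow> \<not> [:l:] dvd tau)"
  using assms
proof (induction "size (prime_factorization a)" arbitrary: a t rule: less_induct)
  case less
  show ?case
  proof (cases "\<exists>l. prime l \<and> l dvd a \<and> [:l:] dvd t")
    case False
    then show ?thesis by (intro exI[of _ 1] exI[of _ a] exI[of _ t]) auto
  next
    case True
    then obtain l b s where l: "prime l" "a = l * b" "t = [:l:] * s" unfolding dvd_def by blast
    then have "b \<noteq> 0" using less.prems by auto
    have "size (prime_factorization b) < size (prime_factorization a)"
      using l \<open>b \<noteq> 0\<close> by (simp add: prime_factorization_mult prime_factorization_prime)
    from less.hyps[OF this \<open>b \<noteq> 0\<close>, of s] obtain d a1 tau where *: "b = d * a1" "s = smult d tau"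
      "\<forall>l. prime l \<longrightarrow> l dvd a1 \<longrightarrow> \<not> [:l:] dvd tau" by blast
    show ?thesis
      using * l by (intro exI[of _ "l * d"] exI[of _ a1] exI[of _ tau]) (simp add: mult_ac)
  qed
qed

lemma coeff_pcompose_monom:
  fixes g :: "'b::comm_ring_1 poly"
  assumes "n > 0"
  shows "coeff (pcompose g (monom 1 n)) i = (if n dvd i then coeff g (i div n) else 0)"
proof (induction g arbitrary: i)
  case (pCons c g)
  have "coeff (pcompose (pCons c g) (monom 1 n)) i =
     (if i = 0 then c else 0) + (if i < n then 0 else coeff (pcompose g (monom 1 n)) (i - n))"
    unfolding pcompose_pCons coeff_add coeff_monom_mult
    using assms by (cases i) simp_all
  also have "\<dots> = (if n dvd i then coeff (pCons c g) (i div n) else 0)"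
  proof (cases "i < n")
    case True
    then show ?thesis using assms by (auto dest: nat_dvd_not_less simp: coeff_pCons)
  next
    case False
    then have "i div n = Suc ((i - n) div n)" using assms by (simp add: le_div_geq)
    moreover have "n dvd i \<longleftrightarrow> n dvd (i - n)" using False by (simp add: dvd_minus_self)
    ultimately show ?thesis using False assms pCons.IH by (simp add: coeff_pCons)
  qed
  finally show ?case .
qed simp

lemma separate_char_powers:
  fixes t :: "'a::idom poly"
  assumes p: "prime CHAR('a)" and d: "pderiv t = smult d s"
  shows "\<exists>g t1. t = pcompose g (monom 1 CHAR('a)) + smult d t1 \<and>
    (\<forall>i. CHAR('a) dvd i \<longrightarrow> coeff t1 i = 0)"
proof -
  let ?p = "CHAR('a)"
  have p0: "?p > 0" using p by (simp add: prime_gt_0_nat)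
  define g where "g = Abs_poly (\<lambda>j. coeff t (?p * j))"
  have cg: "coeff g j = coeff t (?p * j)" for j
    unfolding g_def
  proof (rule coeff_Abs_poly[THEN fun_cong, of "degree t"])
    fix i assume "i > degree t"
    moreover have "i \<le> ?p * i" using p0 by (cases ?p) simp_all
    ultimately show "coeff t (?p * i) = 0" by (intro coeff_eq_0) (rule less_le_trans)
  qed
  let ?r = "t - pcompose g (monom 1 ?p)"
  have cr: "coeff ?r i = (if ?p dvd i then 0 else coeff t i)" for i
    using p0 by (simp add: coeff_pcompose_monom cg)
  have "d dvd coeff ?r i" for i
  proof (cases "?p dvd i")
    case False
    then obtain u :: 'a where u: "of_nat i * u = 1" using of_nat_unit_char[OF p] by blast
    obtain j where j: "i = Suc j" using False by (cases i) auto
    have "of_nat i * coeff t i = d * coeff s j"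
      using arg_cong[OF d, of "\<lambda>q. coeff q j"] by (simp add: coeff_pderiv j)
    then have "u * (of_nat i * coeff t i) = d * (u * coeff s j)" by (simp add: mult_ac)
    then have "coeff t i = d * (u * coeff s j)" using u by (metis mult.assoc mult.commute mult_1)
    then show ?thesis unfolding cr using False by simp
  qed (simp only: cr, simp)
  then have "[:d:] dvd ?r" by (simp add: const_poly_dvd_iff)
  show ?thesis
  proof (cases "d = 0")
    case True
    then have "?r = 0" using \<open>[:d:] dvd ?r\<close> by simp
    then show ?thesis using True by (intro exI[of _ g] exI[of _ 0]) simp
  next
    case False
    obtain t1 where "?r = [:d:] * t1" using \<open>[:d:] dvd ?r\<close> unfolding dvd_def by blast
    then have t1: "?r = smult d t1" by simp
    have "coeff t1 i = 0" if "?p dvd i" for i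
      using arg_cong[OF t1, of "\<lambda>q. coeff q i"] that False unfolding cr by simp
    moreover have "t = pcompose g (monom 1 ?p) + smult d t1" using t1 by (simp add: algebra_simps)
    ultimately show ?thesis by blast
  qed
qed

lemma pderiv_pcompose_char:
  assumes "CHAR('a::idom) > 0"
  shows "pderiv (pcompose g (monom (1::'a) CHAR('a))) = 0"
  by (simp add: pderiv_pcompose pderiv_monom)

section \<open>The ring R[x1,x2]\<close>

lemma rhom_cst2: "rhom (cst2 :: 'a::comm_ring_1 \<Rightarrow> _)"
  by (simp add: rhom_def cst2_def one_pCons)

lemma rhom_lift2: "rhom (lift2 :: 'a::comm_ring_1 poly \<Rightarrow> _)"
  unfolding lift2_def by (rule rhom_const_poly)

lemmas cst2_simps = rhom_simps[OF rhom_cst2]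
lemmas lift2_simps = rhom_simps[OF rhom_lift2]

lemma eval_at_ev: "eval_at g P = ev cst2 P g"
  by (simp add: eval_at_def ev_def)

lemma rhom_eval_at: "rhom (ev (cst2 :: 'a::comm_ring_1 \<Rightarrow> _) P)"
  by (rule rhom_ev[OF rhom_cst2])

lemma subst2_ev: "subst2 P1 P2 p = ev (ev cst2 P2) P1 p"
  by (simp add: subst2_def eval_at_ev[abs_def] ev_def[of "ev cst2 P2"])

lemma rhom_subst2: "rhom (subst2 P1 P2 :: 'a::comm_ring_1 poly poly \<Rightarrow> _)"
  using rhom_ev[OF rhom_eval_at, of P2 P1] by (simp add: subst2_ev rhom_def)

lemmas subst2_simps = rhom_simps[OF rhom_subst2]

lemma bi_induct [case_names cst X1 X2 add mult]:
  fixes b :: "'a::comm_ring_1 poly poly"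
  assumes "\<And>c. P (cst2 c)" "P X1" "P X2" "\<And>x y. P x \<Longrightarrow> P y \<Longrightarrow> P (x + y)"
    "\<And>x y. P x \<Longrightarrow> P y \<Longrightarrow> P (x * y)"
  shows "P b"
proof -
  have lift: "P (lift2 g)" for g
  proof (induction g)
    case 0
    then show ?case using assms(1)[of 0] by (simp add: cst2_def lift2_def)
  next
    case (pCons c g)
    have "lift2 (pCons c g) = cst2 c + X2 * lift2 g" by (simp add: lift2_def cst2_def X2_def)
    then show ?case using assms pCons by simp
  qed
  show ?thesis
  proof (induction b)
    case 0
    then show ?case using assms(1)[of 0] by (simp add: cst2_def)
  next
    case (pCons g b)
    have "pCons g b = lift2 g + X1 * b" by (simp add: lift2_def X1_def)
    then show ?case using assms pCons lift by simp
  qed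
qed

lemma rhom_eqI:
  fixes h k :: "'a::comm_ring_1 poly poly \<Rightarrow> 'b::comm_ring_1"
  assumes "rhom h" "rhom k" "\<And>c. h (cst2 c) = k (cst2 c)" "h X1 = k X1" "h X2 = k X2"
  shows "h b = k b"
  by (induction b rule: bi_induct) (simp_all add: assms rhom_simps[OF assms(1)] rhom_simps[OF assms(2)])

lemma lift2_ev: "lift2 g = ev cst2 X2 g"
proof (induction g)
  case (pCons c g)
  have "lift2 (pCons c g) = cst2 c + X2 * lift2 g" by (simp add: lift2_def cst2_def X2_def)
  then show ?case using pCons by (simp add: ev_pCons[OF rhom_cst2])
qed (simp add: lift2_def)

lemma subst2_cst2 [simp]: "subst2 u v (cst2 c) = cst2 c"
  unfolding subst2_ev by (simp add: cst2_def[of c] ev_const[OF rhom_eval_at])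
    (simp add: ev_const[OF rhom_cst2] cst2_def)

lemma subst2_lift2: "subst2 u v (lift2 g) = ev cst2 v g"
  by (simp add: subst2_ev lift2_def ev_const[OF rhom_eval_at])

lemma subst2_X2 [simp]: "subst2 u v X2 = v"
  using subst2_lift2[of u v "[:0, 1:]"] by (simp add: lift2_def X2_def ev_X[OF rhom_cst2])

lemma subst2_X1 [simp]: "subst2 u v X1 = u"
  by (simp add: subst2_ev X1_def ev_X[OF rhom_eval_at])

lemma rhom_eq_subst2:
  fixes h :: "'a::comm_ring_1 poly poly \<Rightarrow> 'a poly poly"
  assumes "rhom h" "\<And>c. h (cst2 c) = cst2 c"
  shows "h b = subst2 (h X1) (h X2) b"
  by (rule rhom_eqI[OF assms(1) rhom_subst2]) (simp_all add: assms)

lemma subst2_subst2: "subst2 u v (subst2 s t b) = subst2 (subst2 u v s) (subst2 u v t) b"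
  using rhom_eq_subst2[OF rhom_comp[OF rhom_subst2 rhom_subst2], of u v s t b] by simp

lemma subst2_id [simp]: "subst2 X1 X2 b = b"
  using rhom_eq_subst2[OF rhom_id, of b] by simp

lemma subst2_swap: "subst2 u v (subst2 X2 X1 b) = subst2 v u b"
  by (simp add: subst2_subst2)

lemma swap_swap: "subst2 X2 X1 (subst2 X2 X1 b) = b"
  by (simp add: subst2_swap)

lemma subst2_X2_right: "subst2 u X2 b = pcompose b u"
proof -
  have "ev cst2 X2 = (\<lambda>c :: 'a poly. [:c:])"
    by (rule ext) (simp add: lift2_ev[symmetric] lift2_def)
  then show ?thesis by (simp add: subst2_ev pcompose_ev)
qed

lemma ev_cst2_subst2: "subst2 u v (ev cst2 P g) = ev cst2 (subst2 u v P) g"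
  using ev_comp[OF rhom_cst2 rhom_subst2, of u v P g] by simp

lemma subst2_mem:
  assumes "subrng S" "\<And>c. cst2 c \<in> S" "u \<in> S" "v \<in> S"
  shows "subst2 u v b \<in> S"
  unfolding subst2_ev
  by (rule ev_mem[OF rhom_eval_at assms(1) ev_mem[OF rhom_cst2 assms(1)]]) (use assms in auto)

lemma range_subst2_mem:
  shows "cst2 c \<in> range (subst2 u v)" "u \<in> range (subst2 u v)" "v \<in> range (subst2 u v)"
  using subst2_cst2 subst2_X1 subst2_X2 by (metis rangeI)+

lemma prime_elem_cst2: "prime l \<Longrightarrow> prime_elem (cst2 (l :: 'a::{factorial_semiring,idom}))"
  unfolding cst2_def by (intro lift_prime_elem_poly) simp

lemma cst2_eq_0 [simp]: "cst2 c = 0 \<longleftrightarrow> c = 0"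
  by (simp add: cst2_def)

lemma cst2_dvd_lift2: "cst2 c dvd lift2 (g :: 'a::idom poly) \<longleftrightarrow> [:c:] dvd g"
  by (simp add: cst2_def lift2_def)

lemma cst2_dvd_cst2: "cst2 c dvd cst2 (e :: 'a::idom) \<longleftrightarrow> c dvd e"
  by (simp add: cst2_def)

lemma localize:
  assumes S: "subrng S" "\<And>c. cst2 c \<in> S" "cst2 a * X1 \<in> S" "X2 \<in> S"
  shows "\<exists>n. cst2 (a ^ n) * b \<in> S"
proof (induction b rule: bi_induct)
  case (cst c)
  show ?case by (intro exI[of _ 0] subrng_mult[OF S(1)] S)
next
  case X1
  show ?case using S(3) by (intro exI[of _ 1]) simp
next
  case X2
  show ?case by (intro exI[of _ 0] subrng_mult[OF S(1)] S)
next
  case (add x y)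
  then obtain m n where mn: "cst2 (a ^ m) * x \<in> S" "cst2 (a ^ n) * y \<in> S" by blast
  have "cst2 (a ^ (m + n)) * (x + y) = cst2 (a ^ n) * (cst2 (a ^ m) * x) + cst2 (a ^ m) * (cst2 (a ^ n) * y)"
    by (simp add: cst2_simps power_add algebra_simps)
  also have "\<dots> \<in> S" by (intro subrng_add[OF S(1)] subrng_mult[OF S(1) S(2)] mn)
  finally show ?case by blast
next
  case (mult x y)
  then obtain m n where mn: "cst2 (a ^ m) * x \<in> S" "cst2 (a ^ n) * y \<in> S" by blast
  have "cst2 (a ^ (m + n)) * (x * y) = (cst2 (a ^ m) * x) * (cst2 (a ^ n) * y)"
    by (simp add: cst2_simps power_add algebra_simps)
  also have "\<dots> \<in> S" by (intro subrng_mult[OF S(1)] mn)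
  finally show ?case by blast
qed

section \<open>The automorphism\<close>

locale plane =
  fixes a :: "'a::{factorial_semiring,idom}" and \<theta> f :: "'a poly" and G :: "'a poly poly"
    and p :: nat
  assumes char_p [simp]: "CHAR('a) = p" and prime_p: "prime p" and a_nz: "a \<noteq> 0"
    and F_nz: "eval_at f (cst2 a * X1 + lift2 \<theta>) \<noteq> 0"
    and G_eq: "cst2 a * G = lift2 \<theta> - eval_at \<theta> (X2 + cst2 a * eval_at f (cst2 a * X1 + lift2 \<theta>))"
begin

definition q where "q = cst2 a * X1 + lift2 \<theta>"
definition F where "F = eval_at f (cst2 a * X1 + lift2 \<theta>)"
definition u where "u = cst2 a * F"
definition \<psi> where "\<psi> = subst2 (X1 + G) (X2 + cst2 a * F)"
definition N where "N = X2 ^ p - u ^ (p - 1) * X2"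
definition A where "A = inv_ring \<psi>"
definition E where "E = range (subst2 q X2)"

lemma p2: "p \<ge> 2"
  by (rule prime_ge_2_nat[OF prime_p])

lemma primeB: "prime CHAR('a poly poly)" and primeBp: "prime CHAR('a poly poly poly)"
  and primeR1: "prime CHAR('a poly)"
  using prime_p by simp_all

lemma F_ev: "F = ev cst2 q f"
  by (simp add: F_def q_def eval_at_ev)

lemma F_ne_0: "F \<noteq> 0" and u_ne_0: "u \<noteq> 0"
  using F_nz a_nz by (simp_all add: F_def u_def)

lemma G_ev: "cst2 a * G = lift2 \<theta> - ev cst2 (X2 + u) \<theta>"
  using G_eq by (simp add: u_def F_def eval_at_ev)

lemma rhom_psi: "rhom \<psi>"
  unfolding \<psi>_def by (rule rhom_subst2)

lemmas psi_simps = rhom_simps[OF rhom_psi]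

lemma psi_cst2 [simp]: "\<psi> (cst2 c) = cst2 c"
  and psi_X1: "\<psi> X1 = X1 + G" and psi_X2: "\<psi> X2 = X2 + u"
  by (simp_all add: \<psi>_def u_def)

lemma psi_ev: "\<psi> (ev cst2 P g) = ev cst2 (\<psi> P) g"
  unfolding \<psi>_def by (rule ev_cst2_subst2)

lemma psi_q [simp]: "\<psi> q = q"
proof -
  have "\<psi> q = cst2 a * X1 + cst2 a * G + ev cst2 (X2 + u) \<theta>"
    by (simp add: q_def psi_simps psi_X1 lift2_ev psi_ev psi_X2 algebra_simps)
  then show ?thesis by (simp add: G_ev q_def)
qed

lemma psi_F [simp]: "\<psi> F = F"
  by (simp add: F_ev psi_ev)

lemma psi_u [simp]: "\<psi> u = u"
  by (simp add: u_def psi_simps)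

lemma rhom_psin: "rhom (\<psi> ^^ i)"
  by (rule rhom_funpow[OF rhom_psi])

lemmas psin_simps = rhom_simps[OF rhom_psin]

lemma psin_fixed: "\<psi> b = b \<Longrightarrow> (\<psi> ^^ i) b = b"
  by (induction i) simp_all

lemma psin_cst2 [simp]: "(\<psi> ^^ i) (cst2 c) = cst2 c"
  by (rule psin_fixed) simp

lemma psin_X2: "(\<psi> ^^ i) X2 = X2 + of_nat i * u"
  by (induction i) (simp_all add: psi_simps psi_X2 algebra_simps)

lemma psin_ev: "(\<psi> ^^ i) (ev cst2 P g) = ev cst2 ((\<psi> ^^ i) P) g"
  by (induction i) (simp_all add: psi_ev)

lemma psi_order: "(\<psi> ^^ p) b = b"
proof (rule rhom_eqI[OF rhom_psin rhom_id])
  have "of_nat p = (0 :: 'a poly poly)" by (simp add: of_nat_eq_0_iff_char_dvd)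
  then show X2: "(\<psi> ^^ p) X2 = X2" by (simp add: psin_X2)
  have "cst2 a * (\<psi> ^^ p) X1 + lift2 \<theta> = cst2 a * X1 + lift2 \<theta>"
    using psin_fixed[OF psi_q, of p] by (simp add: q_def psin_simps lift2_ev psin_ev X2)
  then show "(\<psi> ^^ p) X1 = X1" using a_nz by simp
qed simp

lemma A_iff: "b \<in> A \<longleftrightarrow> \<psi> b = b"
  by (simp add: A_def inv_ring_def)

lemma subrng_A: "subrng A"
  unfolding A_def inv_ring_def by (rule subrng_fixed[OF rhom_psi])

lemma cst2_A [simp]: "cst2 c \<in> A"
  by (simp add: A_iff)

lemma A_cancel: "cst2 c * b \<in> A \<Longrightarrow> c \<noteq> 0 \<Longrightarrow> b \<in> A"
  by (simp add: A_iff psi_simps)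

lemma N_A: "N \<in> A"
proof -
  have "(X2 + u) ^ p = X2 ^ p + u ^ p"
    using add_power_char[OF primeB, of X2 u] by simp
  moreover have "u ^ (p - 1) * (X2 + u) = u ^ (p - 1) * X2 + u ^ p"
    using p2 by (simp add: distrib_left power_eq_if)
  ultimately show ?thesis by (simp add: A_iff N_def psi_simps psi_X2)
qed

lemma subrng_E: "subrng E"
  unfolding E_def by (rule subrng_range[OF rhom_subst2])

lemma cst2_E [simp]: "cst2 c \<in> E" and q_E: "q \<in> E" and X2_E: "X2 \<in> E"
  unfolding E_def by (rule range_subst2_mem)+

lemma F_E: "F \<in> E"
  unfolding F_ev by (rule ev_mem[OF rhom_cst2 subrng_E cst2_E q_E])

lemma u_E: "u \<in> E"
  unfolding u_def by (intro subrng_mult[OF subrng_E] F_E cst2_E)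

lemma lift2_E: "lift2 g \<in> E"
  unfolding lift2_ev by (rule ev_mem[OF rhom_cst2 subrng_E cst2_E X2_E])

lemma N_E: "N \<in> E"
  unfolding N_def
  by (intro subrng_diff[OF subrng_E] subrng_mult[OF subrng_E] subrng_power[OF subrng_E] X2_E u_E)

lemma psi_E: "b \<in> E \<Longrightarrow> \<psi> b \<in> E"
proof -
  assume "b \<in> E"
  then obtain h where h: "b = subst2 q X2 h" by (auto simp: E_def)
  have "\<psi> b = subst2 (\<psi> q) (\<psi> X2) h" unfolding h \<psi>_def by (rule subst2_subst2)
  then have "\<psi> b = subst2 q (X2 + u) h" by (simp add: psi_X2)
  then show ?thesis
    by (simp only:) (intro subst2_mem subrng_E cst2_E q_E subrng_add[OF subrng_E] X2_E u_E)
qed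

lemma psin_E: "b \<in> E \<Longrightarrow> (\<psi> ^^ i) b \<in> E"
  by (induction i) (simp_all add: psi_E)

definition af :: "'a poly" where "af = Polynomial.smult a f"

lemma af_ev: "ev cst2 q af = u"
  by (simp add: af_def ev_smult[OF rhom_cst2] u_def F_ev)

lemma af_nz: "af \<noteq> 0"
  using af_ev u_ne_0 by auto

lemma deg_q: "degree q = 1"
  using a_nz by (simp add: q_def cst2_def X1_def lift2_def)

lemma subst2_X2_q_inj: "subst2 X2 q h = 0 \<Longrightarrow> h = 0"
proof -
  assume "subst2 X2 q h = 0"
  then have "subst2 q X2 (subst2 X2 X1 h) = 0" by (simp add: subst2_swap)
  then have "pcompose (subst2 X2 X1 h) q = 0" by (simp only: subst2_X2_right)
  then have "subst2 X2 X1 h = 0" by (rule pcompose_eq_0) (simp add: deg_q)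
  then show "h = 0" by (metis swap_swap subst2_simps(1))
qed

lemma subst2_X2_q_pcompose:
  "subst2 X2 q (pcompose h s) = subst2 (subst2 X2 q s) q h"
proof (rule rhom_eqI[OF rhom_comp[OF rhom_subst2 rhom_pcompose] rhom_subst2])
  have [simp]: "pcompose X1 s = s" by (simp add: X1_def pcompose_pCons)
  show "subst2 X2 q (pcompose X1 s) = subst2 (subst2 X2 q s) q X1" by simp
  have *: "pcompose (lift2 g) s = lift2 g" for g by (simp add: lift2_def)
  show "subst2 X2 q (pcompose (cst2 c) s) = subst2 (subst2 X2 q s) q (cst2 c)" for c
    using *[of "[:c:]"] by (simp add: lift2_def flip: cst2_def)
  show "subst2 X2 q (pcompose X2 s) = subst2 (subst2 X2 q s) q X2"
    using *[of "[:0, 1:]"] by (simp add: lift2_def flip: X2_def)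
qed

lemma subst2_artin_schreier: "subst2 X2 q (artin_schreier af) = N"
proof -
  have 1: "subst2 X2 q (monom c n) = ev cst2 q c * X2 ^ n" for c n
    by (simp add: subst2_ev ev_monom[OF rhom_eval_at])
  show ?thesis
    by (simp add: artin_schreier_def subst2_simps 1 N_def rhom_simps[OF rhom_eval_at] af_ev)
qed

lemma E_A: "E \<inter> A = range (subst2 q N)"
proof (intro equalityI subsetI)
  fix b assume b: "b \<in> E \<inter> A"
  then obtain h0 where "b = subst2 q X2 h0" by (auto simp: E_def)
  then obtain h where h: "b = subst2 X2 q h" by (metis subst2_swap)
  have "\<psi> b = subst2 (X2 + u) q h"
    unfolding h \<psi>_def subst2_subst2 unfolding \<psi>_def[symmetric] by (simp add: psi_X2)
  also have "\<dots> = subst2 X2 q (pcompose h [:af, 1:])"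
  proof -
    have "[:af, 1:] = lift2 af + X1" by (simp add: lift2_def X1_def)
    then have "subst2 X2 q [:af, 1:] = X2 + u" by (simp add: subst2_simps subst2_lift2 af_ev)
    then show ?thesis by (simp add: subst2_X2_q_pcompose)
  qed
  finally have "subst2 X2 q (pcompose h [:af, 1:] - h) = 0"
    using b h by (simp add: A_iff subst2_simps)
  then have "pcompose h [:af, 1:] = h" using subst2_X2_q_inj by fastforce
  then obtain k where "h = pcompose k (artin_schreier af)"
    using shift_invariant[OF primeR1 af_nz] by blast
  then have "b = subst2 N q k" by (simp add: h subst2_X2_q_pcompose subst2_artin_schreier)
  then show "b \<in> range (subst2 q N)" by (metis subst2_swap rangeI)
next
  fix b assume "b \<in> range (subst2 q N)"
  then obtain h where b: "b = subst2 q N h" by auto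
  have "b \<in> E" unfolding b by (intro subst2_mem subrng_E cst2_E q_E N_E)
  moreover have "b \<in> A" unfolding b
    by (rule subst2_mem[OF subrng_A cst2_A _ N_A]) (simp add: A_iff)
  ultimately show "b \<in> E \<inter> A" by simp
qed

lemma subst2_q_N_inj: "subst2 q N h = 0 \<Longrightarrow> h = 0"
proof -
  assume "subst2 q N h = 0"
  then have "subst2 X2 q (pcompose (subst2 X2 X1 h) (artin_schreier af)) = 0"
    by (simp add: subst2_X2_q_pcompose subst2_artin_schreier subst2_swap)
  then have "pcompose (subst2 X2 X1 h) (artin_schreier af) = 0" by (rule subst2_X2_q_inj)
  then have "subst2 X2 X1 h = 0"
    by (rule pcompose_eq_0)
      (use prime_gt_0_nat[OF prime_p] artin_schreier_degree(1)[OF primeR1, of af] in simp)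
  then show "h = 0" by (metis swap_swap subst2_simps(1))
qed

lemma localize_E: "\<exists>n. cst2 (a ^ n) * b \<in> E"
proof (rule localize[OF subrng_E cst2_E _ X2_E])
  have "cst2 a * X1 = q - lift2 \<theta>" by (simp add: q_def)
  then show "cst2 a * X1 \<in> E" using subrng_diff[OF subrng_E q_E lift2_E] by simp
qed

lemma localize_A: "b \<in> A \<Longrightarrow> \<exists>n. cst2 (a ^ n) * b \<in> range (subst2 q N)"
proof -
  assume "b \<in> A"
  moreover obtain n where "cst2 (a ^ n) * b \<in> E" using localize_E by blast
  ultimately have "cst2 (a ^ n) * b \<in> E \<inter> A" by (simp add: subrng_mult[OF subrng_A])
  then show ?thesis unfolding E_A by blast
qed

lemma E_reduce:
  assumes "b \<in> E"
  shows "\<exists>g. cst2 a dvd b - lift2 g"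
proof -
  obtain h where h: "b = subst2 q X2 h" using assms by (auto simp: E_def)
  have "cst2 a dvd q - lift2 \<theta>" by (simp add: q_def)
  then have "cst2 a dvd ev (ev cst2 X2) q h - ev (ev cst2 X2) (lift2 \<theta>) h"
    by (rule ev_dvd_diff[OF rhom_eval_at])
  moreover have "ev (ev cst2 X2) (lift2 \<theta>) h \<in> range lift2"
    by (rule ev_mem[OF rhom_eval_at subrng_range[OF rhom_lift2]]) (auto simp: lift2_ev[symmetric])
  ultimately show ?thesis unfolding h subst2_ev by auto
qed

end

lemma lift2_X: "lift2 [:0, 1:] = X2"
  by (simp add: lift2_def X2_def)

lemma lift2_monom: "lift2 (monom 1 n) = (X2 :: 'a::comm_ring_1 poly poly) ^ n"
  by (simp add: monom_altdef lift2_simps lift2_X)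

lemma lift2_pcompose: "lift2 (pcompose g h) = ev cst2 (lift2 h) g"
proof (induction g)
  case (pCons c g)
  have "lift2 [:c:] = cst2 c" by (simp add: lift2_def cst2_def)
  with pCons show ?case by (simp add: pcompose_pCons lift2_simps ev_pCons[OF rhom_cst2])
qed (simp add: lift2_simps)

lemma lift2_pcompose_monom: "lift2 (pcompose g (monom 1 n)) = ev cst2 (X2 ^ n) g"
  by (simp add: lift2_pcompose lift2_monom)

lemma ev_dvd_diff2:
  assumes "rhom h" "rhom k" "\<And>z. c dvd h z - k z" "c dvd x - y"
  shows "c dvd ev h x p - ev k y p"
  by (induction p)
    (simp_all add: ev_pCons[OF assms(1)] ev_pCons[OF assms(2)] dvd_diff_add dvd_diff_mult assms)

lemma subst2_dvd_diff:
  assumes "c dvd s - s'" "c dvd t - t'"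
  shows "c dvd subst2 s t b - subst2 s' t' b"
  unfolding subst2_ev by (intro ev_dvd_diff2 rhom_eval_at ev_dvd_diff rhom_cst2 assms)

lemma subrng_coeffs:
  fixes S :: "'b::comm_ring_1 set"
  assumes "subrng S" shows "subrng {W. \<forall>n. coeff W n \<in> S}"
  unfolding subrng_def
proof (intro conjI ballI)
  show "1 \<in> {W. \<forall>n. coeff W n \<in> S}"
    using subrng_0[OF assms] subrng_1[OF assms] by (simp add: of_bool_def)
qed (use assms in \<open>auto simp: coeff_mult intro!: subrng_intros[OF assms] subrng_sum[OF assms]\<close>)

lemma poly_mem:
  fixes S :: "'b::comm_ring_1 set"
  assumes "subrng S" "\<And>n. coeff W n \<in> S" "x \<in> S" shows "poly W x \<in> S"
  unfolding poly_altdef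
  by (intro subrng_sum[OF assms(1)] subrng_mult[OF assms(1)] subrng_power[OF assms(1)] assms)

lemma prod_diff_ideal:
  fixes c :: "'b::comm_ring_1"
  assumes S: "subrng S" and "\<And>i. i \<in> I \<Longrightarrow> f i \<in> S" "\<And>i. i \<in> I \<Longrightarrow> h i \<in> S"
    "\<And>i. i \<in> I \<Longrightarrow> \<exists>V\<in>S. f i - h i = c * V"
  shows "\<exists>V\<in>S. prod f I - prod h I = c * V"
  using assms(2-)
proof (induction I rule: infinite_finite_induct)
  case (insert i I)
  obtain V where V: "V \<in> S" "prod f I - prod h I = c * V" using insert by auto
  obtain V' where V': "V' \<in> S" "f i - h i = c * V'" using insert.prems(3)[of i] by blast
  have "prod f (insert i I) - prod h (insert i I)
      = (f i - h i) * prod f I + h i * (prod f I - prod h I)"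
    using insert.hyps by (simp add: algebra_simps)
  also have "\<dots> = c * (V' * prod f I + h i * V)" by (simp only: V V') (simp add: algebra_simps)
  finally have eq: "prod f (insert i I) - prod h (insert i I) = c * (V' * prod f I + h i * V)" .
  have "V' * prod f I + h i * V \<in> S"
    using insert.prems by (intro subrng_add[OF S] subrng_mult[OF S] subrng_prod[OF S] V V') auto
  with eq show ?case by blast
qed (use subrng_0[OF S] in \<open>auto intro!: bexI[of _ 0]\<close>)

lemma prod_cyclic_shift:
  fixes h :: "nat \<Rightarrow> 'b::comm_monoid_mult"
  assumes "h n = h 0" shows "(\<Prod>i<n. h (Suc i)) = (\<Prod>i<n. h i)"
proof (cases n)
  case (Suc m)
  have "(\<Prod>i<Suc m. h (Suc i)) = (\<Prod>i<m. h (Suc i)) * h 0"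
    using assms by (simp add: Suc)
  also have "\<dots> = (\<Prod>i<Suc m. h i)" by (simp add: prod.lessThan_Suc_shift mult.commute del: prod.lessThan_Suc)
  finally show ?thesis by (simp add: Suc)
qed simp

lemma pderiv_ev:
  fixes t :: "'a::idom poly"
  assumes "rhom h" "\<And>c. pderiv (h c) = 0"
  shows "pderiv (ev h t W) = pderiv t * ev h t (pderiv W)"
  by (induction W)
    (simp_all add: ev_pCons[OF assms(1)] pderiv_add pderiv_mult assms(2) pderiv_pCons
      rhom_simps[OF rhom_ev[OF assms(1)]] rhom_simps[OF assms(1)] algebra_simps)

text \<open>Differentiating a relation of minimal degree yields a relation of smaller degree.\<close>

lemma powers_independent_mod:
  fixes t :: "'a::idom poly" and W :: "'a poly poly"
  assumes char: "prime CHAR('a)" and l: "prime_elem l" and t: "\<not> [:l:] dvd pderiv t"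
    and "degree W < CHAR('a)" "[:l:] dvd ev (\<lambda>g. pcompose g (monom 1 CHAR('a))) t W"
  shows "[:[:l:]:] dvd W"
  using assms(4,5)
proof (induction "degree W" arbitrary: W rule: less_induct)
  case less
  let ?h = "\<lambda>g. pcompose g (monom (1::'a) CHAR('a))"
  have p0: "CHAR('a) > 0" using char by (simp add: prime_gt_0_nat)
  have h: "rhom ?h" by (rule rhom_pcompose)
  have base: "[:l:] dvd w" if "[:l:] dvd ?h w" for w
    by (rule dvd_pcompose_cancel[OF l _ _ that])
      (use p0 l in \<open>auto simp: degree_monom_eq prime_elem_def\<close>)
  have higher: "[:[:l:]:] dvd W - [:coeff W 0:]"
  proof (cases "degree W = 0")
    case True
    then show ?thesis by (auto elim!: degree_eq_zeroE)
  next
    case False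
    have "[:l:] dvd pderiv (ev ?h t W)"
      using less.prems(2) by (auto simp: const_poly_dvd_iff coeff_pderiv)
    then have "[:l:] dvd pderiv t * ev ?h t (pderiv W)"
      using pderiv_ev[OF h, of t W] p0 by (simp add: pderiv_pcompose_char)
    then have "[:l:] dvd ev ?h t (pderiv W)"
      using lift_prime_elem_poly[OF l] t by (simp add: prime_elem_dvd_mult_iff)
    moreover have "degree (pderiv W) < degree W"
    proof (rule degree_lessI)
      show "\<forall>k\<ge>degree W. coeff (pderiv W) k = 0" by (auto simp: coeff_pderiv coeff_eq_0)
    qed (use False in simp)
    ultimately have dW: "[:[:l:]:] dvd pderiv W" using less by simp
    have "[:l:] dvd coeff (W - [:coeff W 0:]) n" for n
    proof (cases n)
      case (Suc k)
      show ?thesis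
      proof (cases "n < CHAR('a)")
        case True
        then have "\<not> CHAR('a poly) dvd n" using Suc by (auto dest: dvd_imp_le)
        then obtain v :: "'a poly" where v: "of_nat n * v = 1"
          using of_nat_unit_char[where 'b = "'a poly"] char by auto
        have "[:l:] dvd coeff (pderiv W) k" using dW by (simp only: const_poly_dvd_iff[of "[:l:]"])
        then have "[:l:] dvd v * (of_nat n * coeff W n)"
          using Suc by (simp only: coeff_pderiv) (rule dvd_mult)
        also have "v * (of_nat n * coeff W n) = coeff W n"
          using v by (metis mult.assoc mult.commute mult_1)
        finally show ?thesis using Suc by simp
      next
        case False
        then have "coeff W n = 0" using less.prems(1) by (intro coeff_eq_0) simp
        then show ?thesis using Suc by simp
      qed
    qed simp
    then show ?thesis by (intro iffD2[OF const_poly_dvd_iff[of "[:l:]"]] allI)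
  qed
  have "ev ?h t [:[:l:]:] dvd ev ?h t (W - [:coeff W 0:])"
    using rhom_dvd[OF rhom_ev[OF h] higher] .
  then have "[:l:] dvd ev ?h t W - ?h (coeff W 0)"
    by (simp add: rhom_simps[OF rhom_ev[OF h]] ev_const[OF h])
  then have "[:l:] dvd ?h (coeff W 0)" using less.prems(2) dvd_diff_cancel by blast
  then have "[:[:l:]:] dvd [:coeff W 0:]" using base by simp
  then show ?case using higher dvd_diff_cancel by blast
qed

locale plane_split = plane a \<theta> f G p
  for a :: "'a::{factorial_semiring,idom}" and \<theta> f :: "'a poly" and G :: "'a poly poly" and p :: nat +
  fixes d a1 :: 'a and th1 g :: "'a poly"
  assumes a_split: "a = d * a1"
    and th_split: "\<theta> = pcompose g (monom 1 p) + Polynomial.smult d th1"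
    and th1_p: "\<And>i. p dvd i \<Longrightarrow> coeff th1 i = 0"
    and coprime_tau: "\<And>l. prime l \<Longrightarrow> l dvd a1 \<Longrightarrow> \<not> [:l:] dvd pderiv th1"
begin

lemma d_nz: "d \<noteq> 0" and a1_nz: "a1 \<noteq> 0"
  using a_nz a_split by auto

lemma cst2_a: "cst2 a = cst2 d * cst2 a1"
  by (simp add: a_split cst2_simps)

lemma p_pos: "p > 0" by (rule prime_gt_0_nat[OF prime_p])

lemma u_power: "u ^ (p - 1) = cst2 a * (cst2 a ^ (p - 2) * F ^ (p - 1))"
proof -
  have "p - 1 = Suc (p - 2)" using p2 by simp
  then have "u ^ (p - 1) = cst2 a ^ Suc (p - 2) * F ^ (p - 1)"
    by (simp only: u_def power_mult_distrib)
  then show ?thesis by (simp add: mult_ac)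
qed

lemma X2_power: "X2 ^ p = N + u ^ (p - 1) * X2"
  by (simp add: N_def)

lemma power_shift: "\<exists>w\<in>E. ev cst2 (X2 ^ p) h = ev cst2 N h + u ^ (p - 1) * X2 * w"
  unfolding X2_power
  by (rule ev_shift[OF rhom_cst2 subrng_E cst2_E N_E])
    (intro subrng_mult[OF subrng_E] subrng_power[OF subrng_E] u_E X2_E)

definition w where "w = (SOME w. w \<in> E \<and> ev cst2 (X2 ^ p) g = ev cst2 N g + u ^ (p - 1) * X2 * w)"

lemma w_E: "w \<in> E" and w_eq: "ev cst2 (X2 ^ p) g = ev cst2 N g + u ^ (p - 1) * X2 * w"
proof -
  have "\<exists>w. w \<in> E \<and> ev cst2 (X2 ^ p) g = ev cst2 N g + u ^ (p - 1) * X2 * w"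
    using power_shift[of g] by blast
  from someI_ex[OF this] show "w \<in> E" "ev cst2 (X2 ^ p) g = ev cst2 N g + u ^ (p - 1) * X2 * w"
    unfolding w_def by blast+
qed

text \<open>Modulo d the polynomial \<theta> is g(x2^p), so subtracting g(N) from the invariant q makes it
  divisible by d; the quotient is q1. The norm r of X1 becomes x1^p plus lower terms modulo a1,
  which makes it transcendental over the residues of q1 and N.\<close>

definition m0 where "m0 = cst2 a ^ (p - 2) * F ^ (p - 1) * X2 * w"
definition T where "T = lift2 th1 + cst2 a1 * m0"
definition q1 where "q1 = cst2 a1 * X1 + T"
definition r where "r = (\<Prod>i<p. (\<psi> ^^ i) X1)"
definition th1p where "th1p = map_poly (\<lambda>c. c ^ p) th1"

lemma m0_E: "m0 \<in> E"
  unfolding m0_def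
  by (intro subrng_mult[OF subrng_E] subrng_power[OF subrng_E] cst2_E F_E X2_E w_E)

lemma T_E: "T \<in> E"
  unfolding T_def by (intro subrng_add[OF subrng_E] subrng_mult[OF subrng_E] cst2_E lift2_E m0_E)

lemma d_q1: "cst2 d * q1 = q - ev cst2 N g"
proof -
  have "lift2 \<theta> = ev cst2 (X2 ^ p) g + cst2 d * lift2 th1"
  proof -
    have "Polynomial.smult d th1 = [:d:] * th1" by simp
    then have "lift2 \<theta> = ev cst2 (X2 ^ p) g + lift2 ([:d:] * th1)"
      unfolding th_split by (simp only: lift2_simps lift2_pcompose_monom)
    also have "lift2 ([:d:] * th1) = cst2 d * lift2 th1"
      by (simp only: lift2_simps) (simp add: lift2_def cst2_def)
    finally show ?thesis .
  qed
  moreover have "cst2 d * (cst2 a1 * m0) = u ^ (p - 1) * X2 * w"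
    unfolding u_power m0_def cst2_a by (simp only: mult_ac)
  moreover have "q = cst2 d * (cst2 a1 * X1) + lift2 \<theta>"
    by (simp add: q_def cst2_a mult.assoc)
  ultimately show ?thesis by (simp only: q1_def T_def w_eq distrib_left) simp
qed

lemma psi_q1 [simp]: "\<psi> q1 = q1"
proof -
  have "\<psi> (cst2 d * q1) = cst2 d * q1"
    using N_A by (simp add: d_q1 psi_simps psi_ev A_iff)
  then show ?thesis using d_nz by (simp add: psi_simps)
qed

lemma q1_A: "q1 \<in> A" by (simp add: A_iff)

lemma r_A: "r \<in> A"
proof -
  have "\<psi> r = (\<Prod>i<p. (\<psi> ^^ Suc i) X1)" by (simp add: r_def psi_simps)
  also have "\<dots> = r" unfolding r_def by (rule prod_cyclic_shift) (simp add: psi_order)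
  finally show ?thesis by (simp add: A_iff)
qed

definition C1 where "C1 = range (subst2 q1 N)"

lemma subrng_C1: "subrng C1"
  unfolding C1_def by (rule subrng_range[OF rhom_subst2])

lemma C1_gens: "cst2 c \<in> C1" "q1 \<in> C1" "N \<in> C1"
  unfolding C1_def by (rule range_subst2_mem)+

lemma q_C1: "q \<in> C1"
proof -
  have "q = cst2 d * q1 + ev cst2 N g" by (simp add: d_q1)
  also have "\<dots> \<in> C1"
    by (intro subrng_add[OF subrng_C1] subrng_mult[OF subrng_C1] C1_gens
        ev_mem[OF rhom_cst2 subrng_C1])
  finally show ?thesis .
qed

lemma E_A_C1: "b \<in> E \<Longrightarrow> b \<in> A \<Longrightarrow> b \<in> C1"
proof -
  assume "b \<in> E" "b \<in> A"
  then have "b \<in> range (subst2 q N)" using E_A by blast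
  then obtain h where "b = subst2 q N h" by auto
  then show ?thesis using subst2_mem[OF subrng_C1 C1_gens(1) q_C1 C1_gens(3)] by simp
qed

lemma psin_T: "\<exists>e\<in>E. (\<psi> ^^ i) T - lift2 th1 = cst2 a1 * e"
proof -
  obtain w' where w': "w' \<in> E" "ev cst2 (X2 + of_nat i * u) th1 = ev cst2 X2 th1 + of_nat i * u * w'"
    using ev_shift[OF rhom_cst2 subrng_E cst2_E X2_E, of "of_nat i * u" th1]
    by (auto intro: subrng_mult[OF subrng_E] subrng_of_nat[OF subrng_E] u_E)
  have "(\<psi> ^^ i) T - lift2 th1 = cst2 a1 * (of_nat i * (cst2 d * F) * w' + (\<psi> ^^ i) m0)"
    by (simp only: T_def psin_simps lift2_ev psin_ev psin_X2 w' psin_cst2)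
      (simp add: u_def cst2_a algebra_simps)
  moreover have "of_nat i * (cst2 d * F) * w' + (\<psi> ^^ i) m0 \<in> E"
    by (intro subrng_add[OF subrng_E] subrng_mult[OF subrng_E] subrng_of_nat[OF subrng_E]
        cst2_E F_E w' psin_E m0_E)
  ultimately show ?thesis by blast
qed

text \<open>The left-hand side is the value at q1 of the product of the factors Z - \<psi>^i(T). The coefficients
  of that product are invariants in R[q,x2], hence lie in R[q,N]; modulo a1 the product is
  (Z - th1(y))^p.\<close>

lemma relation: "\<exists>E0. cst2 a1 ^ p * r = q1 ^ p - ev cst2 N th1p + cst2 a1 * subst2 q1 N E0"
proof -
  define S where "S = {W. \<forall>n. coeff W n \<in> E}"
  have S: "subrng S" unfolding S_def by (rule subrng_coeffs[OF subrng_E])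
  have linS: "[:x, 1:] \<in> S" if "x \<in> E" for x
    using that subrng_0[OF subrng_E] subrng_1[OF subrng_E]
    by (auto simp: S_def coeff_pCons split: nat.splits)
  have constS: "[:x:] \<in> S" if "x \<in> E" for x
    using that subrng_0[OF subrng_E] by (auto simp: S_def coeff_pCons split: nat.splits)
  define PP where "PP = (\<Prod>i<p. [:- (\<psi> ^^ i) T, 1:])"
  have "\<exists>V\<in>S. PP - (\<Prod>i<p. [:- lift2 th1, 1:]) = [:cst2 a1:] * V"
    unfolding PP_def
  proof (rule prod_diff_ideal[OF S])
    fix i
    show "[:- (\<psi> ^^ i) T, 1:] \<in> S" "[:- lift2 th1, 1:] \<in> S"
      by (intro linS subrng_uminus[OF subrng_E] psin_E T_E lift2_E)+
    obtain e where e: "e \<in> E" "(\<psi> ^^ i) T - lift2 th1 = cst2 a1 * e" using psin_T by blast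
    have "- (\<psi> ^^ i) T + lift2 th1 = cst2 a1 * (- e)" using e(2) by (simp add: algebra_simps)
    then have "[:- (\<psi> ^^ i) T, 1:] - [:- lift2 th1, 1:] = [:cst2 a1:] * [:- e:]" by simp
    then show "\<exists>V\<in>S. [:- (\<psi> ^^ i) T, 1:] - [:- lift2 th1, 1:] = [:cst2 a1:] * V"
      using constS[OF subrng_uminus[OF subrng_E e(1)]] by blast
  qed
  then obtain V1 where V1: "V1 \<in> S" "PP - [:- lift2 th1, 1:] ^ p = [:cst2 a1:] * V1" by auto
  have pw: "[:- lift2 th1, 1:] ^ p = [:0, 1:] ^ p - [:lift2 th1 ^ p:]"
    using diff_power_char[OF primeBp, of "[:0, 1:]" "[:lift2 th1:]"] by (simp add: poly_const_pow)
  have "lift2 th1 ^ p = ev cst2 (X2 ^ p) th1p"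
    unfolding lift2_ev th1p_def by (rule ev_power_char[OF rhom_cst2 prime_p]) simp
  moreover obtain w' where w': "w' \<in> E" "ev cst2 (X2 ^ p) th1p = ev cst2 N th1p + u ^ (p - 1) * X2 * w'"
    using power_shift by blast
  ultimately have lp: "lift2 th1 ^ p = ev cst2 N th1p + u ^ (p - 1) * X2 * w'" by simp
  define e2 where "e2 = cst2 d * (cst2 a ^ (p - 2) * F ^ (p - 1)) * X2 * w'"
  have e2: "u ^ (p - 1) * X2 * w' = cst2 a1 * e2"
    unfolding u_power e2_def cst2_a by (simp only: mult_ac)
  have e2E: "e2 \<in> E" unfolding e2_def
    by (intro subrng_mult[OF subrng_E] subrng_power[OF subrng_E] cst2_E F_E X2_E w')
  define V where "V = V1 - [:e2:]"
  have VS: "V \<in> S" unfolding V_def by (intro subrng_diff[OF S] V1 constS e2E)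
  have main: "PP - ([:0, 1:] ^ p - [:ev cst2 N th1p:]) = [:cst2 a1:] * V"
  proof -
    have "[:lift2 th1 ^ p:] = [:ev cst2 N th1p:] + [:cst2 a1:] * [:e2:]"
      unfolding lp e2 by simp
    moreover have "PP = [:cst2 a1:] * V1 + [:- lift2 th1, 1:] ^ p"
      using V1(2) by (metis diff_eq_eq)
    ultimately show ?thesis
      unfolding V_def pw by (simp only: right_diff_distrib) (simp only: algebra_simps)
  qed
  note mp = rhom_simps[OF rhom_map_poly[OF rhom_psi]]
  have mpc: "map_poly \<psi> (pCons c h) = pCons (\<psi> c) (map_poly \<psi> h)" for c h
    by (simp add: map_poly_pCons psi_simps)
  have "map_poly \<psi> PP = (\<Prod>i<p. [:- (\<psi> ^^ Suc i) T, 1:])"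
    unfolding PP_def mp by (intro prod.cong refl) (simp add: mpc psi_simps)
  also have "\<dots> = PP" unfolding PP_def by (rule prod_cyclic_shift) (simp add: psi_order)
  finally have "map_poly \<psi> ([:cst2 a1:] * V) = [:cst2 a1:] * V"
    using N_A unfolding main[symmetric] mp
    by (simp add: mpc psi_simps psi_ev A_iff mp)
  then have "[:cst2 a1:] * map_poly \<psi> V = [:cst2 a1:] * V" by (simp only: mp mpc psi_cst2)
  moreover have "[:cst2 a1:] \<noteq> 0" using a1_nz by simp
  ultimately have invV: "map_poly \<psi> V = V" using mult_left_cancel by blast
  have "coeff V n \<in> C1" for n
  proof (rule E_A_C1)
    show "coeff V n \<in> E" using VS by (simp add: S_def)
    show "coeff V n \<in> A"
      using arg_cong[OF invV, of "\<lambda>z. coeff z n"] by (simp add: coeff_map_poly psi_simps A_iff)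
  qed
  then have "poly V q1 \<in> C1" by (intro poly_mem subrng_C1 C1_gens)
  then obtain E0 where E0: "poly V q1 = subst2 q1 N E0" by (auto simp: C1_def)
  have "poly PP q1 = (\<Prod>i<p. cst2 a1 * (\<psi> ^^ i) X1)"
    unfolding PP_def poly_prod
  proof (rule prod.cong[OF refl])
    fix i
    have "q1 - (\<psi> ^^ i) T = (\<psi> ^^ i) (q1 - T)" by (simp add: psin_simps psin_fixed)
    then show "poly [:- (\<psi> ^^ i) T, 1:] q1 = cst2 a1 * (\<psi> ^^ i) X1"
      by (simp add: q1_def psin_simps)
  qed
  then have "poly PP q1 = cst2 a1 ^ p * r" by (simp add: r_def prod.distrib)
  then have "cst2 a1 ^ p * r - (q1 ^ p - ev cst2 N th1p) = cst2 a1 * subst2 q1 N E0"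
    using arg_cong[OF main, of "\<lambda>z. poly z q1"] by (simp add: E0)
  then have "cst2 a1 ^ p * r = q1 ^ p - ev cst2 N th1p + cst2 a1 * subst2 q1 N E0"
    by (simp add: algebra_simps)
  then show ?thesis by blast
qed

definition E0 where
  "E0 = (SOME e. cst2 a1 ^ p * r = q1 ^ p - ev cst2 N th1p + cst2 a1 * subst2 q1 N e)"

lemma r_eq: "cst2 a1 ^ p * r = q1 ^ p - ev cst2 N th1p + cst2 a1 * subst2 q1 N E0"
  unfolding E0_def by (rule someI_ex[OF relation])

section \<open>Generators of the invariant ring\<close>

lemma a1_dvd_a: "a1 dvd a" by (simp add: a_split)

lemma cst2_dvd_trans: "c dvd e \<Longrightarrow> cst2 e dvd b \<Longrightarrow> cst2 c dvd b"
  using rhom_dvd[OF rhom_cst2] dvd_trans by blast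

lemma q1_mod: "cst2 a1 dvd q1 - lift2 th1"
  by (simp add: q1_def T_def)

lemma N_mod: "cst2 a dvd N - X2 ^ p"
  unfolding X2_power u_power by (simp add: mult.assoc)

lemma psin_X1_mod: "\<exists>s. cst2 a dvd (\<psi> ^^ i) X1 - (X1 + lift2 s)"
proof -
  obtain e where e: "e \<in> E" "ev cst2 (X2 + of_nat i * u) \<theta> = ev cst2 X2 \<theta> + of_nat i * u * e"
    using ev_shift[OF rhom_cst2 subrng_E cst2_E X2_E, of "of_nat i * u" \<theta>]
    by (auto intro: subrng_mult[OF subrng_E] subrng_of_nat[OF subrng_E] u_E)
  have "(\<psi> ^^ i) q = q" by (rule psin_fixed) simp
  then have "cst2 a * (\<psi> ^^ i) X1 + ev cst2 (X2 + of_nat i * u) \<theta> = cst2 a * X1 + ev cst2 X2 \<theta>"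
    by (simp add: q_def psin_simps lift2_ev psin_ev psin_X2)
  then have "cst2 a * (\<psi> ^^ i) X1 = cst2 a * X1 - of_nat i * u * e"
    by (simp only: e(2)) (simp add: algebra_simps)
  then have "cst2 a * (\<psi> ^^ i) X1 = cst2 a * (X1 - of_nat i * F * e)"
    by (simp only: u_def) (simp add: algebra_simps)
  then have 1: "(\<psi> ^^ i) X1 - X1 = - (of_nat i * F * e)" using a_nz by simp
  have "- (of_nat i * F * e) \<in> E"
    by (intro subrng_mult[OF subrng_E] subrng_uminus[OF subrng_E] subrng_of_nat[OF subrng_E] F_E e)
  from E_reduce[OF this] obtain s where "cst2 a dvd (\<psi> ^^ i) X1 - X1 - lift2 s"
    unfolding 1 by blast
  then show ?thesis by (auto simp: algebra_simps)
qed

lemma r_mod: "\<exists>r0. cst2 a dvd r - r0 \<and> degree r0 = p \<and> lead_coeff r0 = 1"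
proof -
  obtain s where s: "\<And>i. cst2 a dvd (\<psi> ^^ i) X1 - (X1 + lift2 (s i))"
    using psin_X1_mod by metis
  let ?r = "\<Prod>i<p. [:s i, 1:]"
  have "X1 + lift2 (s i) = [:s i, 1:]" for i by (simp add: X1_def lift2_def)
  then have "cst2 a dvd r - ?r" unfolding r_def using s by (intro dvd_diff_prod) metis
  moreover have "degree ?r = p" by (subst degree_prod_eq_sum_degree) auto
  moreover have "lead_coeff ?r = 1" by (subst lead_coeff_prod) simp
  ultimately show ?thesis by blast
qed

definition \<kappa> where "\<kappa> = ev (\<lambda>h. pcompose h (monom (1::'a) p)) th1"

lemma rhom_kappa: "rhom \<kappa>"
  unfolding \<kappa>_def by (rule rhom_ev[OF rhom_pcompose])

lemma kappa_mod: "cst2 a1 dvd subst2 q1 N b - lift2 (\<kappa> b)"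
proof -
  have "lift2 (\<kappa> b) = subst2 (lift2 th1) (X2 ^ p) b"
    unfolding \<kappa>_def subst2_ev ev_comp[OF rhom_pcompose rhom_lift2] lift2_pcompose_monom ..
  then show ?thesis
    using subst2_dvd_diff[OF q1_mod cst2_dvd_trans[OF a1_dvd_a N_mod]] by simp
qed

text \<open>Polynomials in R[N][Q][Z] are evaluated with the outermost variable Z at r, the middle one Q
  at q1 and the innermost one N at N.\<close>

definition val where "val = ev (subst2 q1 N) r"
definition C where "C = range val"

lemma rhom_val: "rhom val"
  unfolding val_def by (rule rhom_ev[OF rhom_subst2])

lemmas val_simps = rhom_simps[OF rhom_val]

lemma val_const: "val [:c:] = subst2 q1 N c" and val_X: "val [:0, 1:] = r"
  by (simp_all add: val_def ev_const[OF rhom_subst2] ev_X[OF rhom_subst2])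

lemma val_pCons: "val (pCons c W) = subst2 q1 N c + r * val W"
  by (simp add: val_def ev_pCons[OF rhom_subst2])

lemma subrng_C: "subrng C"
  unfolding C_def by (rule subrng_range[OF rhom_val])

lemma C1_C: "b \<in> C1 \<Longrightarrow> b \<in> C"
  by (auto simp: C1_def C_def val_const[symmetric])

lemma r_C: "r \<in> C"
  unfolding C_def val_X[symmetric] by (rule rangeI)

lemma cst2_C: "cst2 c \<in> C" by (intro C1_C C1_gens)

definition D0 :: "'a poly poly" where "D0 = monom 1 p - [:th1p:]"

lemma subst2_D0: "subst2 v t D0 = v ^ p - ev cst2 t th1p"
  unfolding D0_def subst2_simps
  by (simp add: subst2_ev ev_monom[OF rhom_eval_at] ev_const[OF rhom_eval_at] rhom_simps[OF rhom_eval_at])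

lemma degree_D0: "degree D0 = p" "lead_coeff D0 = 1"
proof -
  show "degree D0 = p"
  proof (rule antisym)
    show "degree D0 \<le> p" unfolding D0_def
      by (intro degree_diff_le) (auto intro: order_trans[OF degree_monom_le])
    show "p \<le> degree D0" by (rule le_degree) (use p_pos in \<open>simp add: D0_def coeff_pCons split: nat.splits\<close>)
  qed
  then show "lead_coeff D0 = 1" using p_pos by (simp add: D0_def coeff_pCons split: nat.splits)
qed

lemma kappa_D0: "\<kappa> D0 = 0"
proof -
  have "th1 ^ p = pcompose th1p (monom 1 p)"
    using ev_power_char[OF rhom_const_poly prime_p, of "[:0, 1:]" th1]
    by (simp add: pcompose_ev[symmetric] th1p_def monom_altdef)
  then show ?thesis
    unfolding D0_def rhom_diff[OF rhom_kappa]
    by (simp add: \<kappa>_def ev_monom[OF rhom_pcompose] ev_const[OF rhom_pcompose] pcompose_1)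
qed

lemma D0_in_a1C: "\<exists>c\<in>C. subst2 q1 N D0 = cst2 a1 * c"
proof -
  have "subst2 q1 N D0 = cst2 a1 * (cst2 a1 ^ (p - 1) * r - subst2 q1 N E0)"
    using r_eq p_pos unfolding subst2_D0 by (cases p) (simp_all add: algebra_simps)
  moreover have "cst2 a1 ^ (p - 1) * r - subst2 q1 N E0 \<in> C"
    by (intro subrng_diff[OF subrng_C] subrng_mult[OF subrng_C] subrng_power[OF subrng_C] cst2_C r_C C1_C)
      (simp add: C1_def)
  ultimately show ?thesis by blast
qed

lemma cancel_coeff:
  assumes l: "prime l" "l dvd a1" and dvd: "[:l:] dvd \<kappa> b"
  shows "\<exists>c\<in>C. subst2 q1 N b = cst2 l * c"
proof -
  obtain b1 b0 where b: "b = D0 * b1 + b0" "b0 = 0 \<or> degree b0 < p"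
    using monic_division[OF degree_D0(2), of b] degree_D0(1) by metis
  have "\<kappa> b = \<kappa> b0" unfolding b rhom_add[OF rhom_kappa] rhom_mult[OF rhom_kappa] kappa_D0 by simp
  then have "[:l:] dvd ev (\<lambda>g. pcompose g (monom 1 CHAR('a))) th1 b0"
    using dvd by (simp add: \<kappa>_def)
  moreover have "degree b0 < CHAR('a)" using b(2) p_pos by auto
  moreover have "prime_elem l" "prime CHAR('a)" using l prime_p by simp_all
  ultimately have "[:[:l:]:] dvd b0"
    by (intro powers_independent_mod) (simp_all add: coprime_tau l)
  then have "cst2 l dvd b0" by (simp only: cst2_def)
  then obtain b2 where b2: "b0 = cst2 l * b2" by (rule dvdE)
  obtain c where c: "c \<in> C" "subst2 q1 N D0 = cst2 a1 * c" using D0_in_a1C by blast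
  obtain k where k: "a1 = l * k" using l(2) by (rule dvdE)
  have "subst2 q1 N b = cst2 l * (cst2 k * c * subst2 q1 N b1 + subst2 q1 N b2)"
  proof -
    have "cst2 a1 = cst2 l * cst2 k" by (simp only: k cst2_simps)
    then show ?thesis unfolding b(1) b2 subst2_simps c(2) by (simp add: algebra_simps)
  qed
  moreover have "cst2 k * c * subst2 q1 N b1 + subst2 q1 N b2 \<in> C"
    by (intro subrng_add[OF subrng_C] subrng_mult[OF subrng_C] cst2_C c C1_C) (simp_all add: C1_def)
  ultimately show ?thesis by blast
qed

lemma cancel_C:
  assumes l: "prime l" "l dvd a1" and "c \<in> C" and dvd: "cst2 l dvd c"
  shows "\<exists>c'\<in>C. c = cst2 l * c'"
proof -
  obtain W where W: "c = val W" using assms by (auto simp: C_def)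
  obtain r0 where r0: "cst2 a dvd r - r0" "degree r0 = p" "lead_coeff r0 = 1" using r_mod by blast
  have la: "l dvd a" using l by (simp add: a_split)
  have D: "cst2 l dvd ev (subst2 q1 N) r W - ev (\<lambda>b. lift2 (\<kappa> b)) r0 W"
    by (intro ev_dvd_diff2 rhom_subst2 rhom_comp[OF rhom_lift2 rhom_kappa]
        cst2_dvd_trans[OF l(2)] kappa_mod cst2_dvd_trans[OF la] r0)
  have eq: "ev (\<lambda>b. lift2 (\<kappa> b)) r0 W = pcompose (map_poly \<kappa> W) r0"
    unfolding pcompose_ev lift2_def
    by (rule ev_map_poly[symmetric]) (simp_all add: rhom_const_poly rhom_comp[OF rhom_const_poly rhom_kappa] rhom_0[OF rhom_kappa])
  have "cst2 l dvd pcompose (map_poly \<kappa> W) r0"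
    using dvd_diff_cancel[OF D] dvd by (simp add: W val_def eq)
  then have D': "[:[:l:]:] dvd pcompose (map_poly \<kappa> W) r0" by (simp only: cst2_def)
  have pl: "prime_elem [:l:]" using l by (intro lift_prime_elem_poly) simp
  then have "\<not> [:l:] dvd lead_coeff r0" unfolding r0(3) by (rule prime_elem_not_unit)
  then have "[:[:l:]:] dvd map_poly \<kappa> W"
    by (rule dvd_pcompose_cancel[OF pl _ _ D', rotated]) (simp add: r0 p_pos)
  then have "[:l:] dvd \<kappa> (coeff W i)" for i
    by (simp add: const_poly_dvd_iff[of "[:l:]"] coeff_map_poly rhom_0[OF rhom_kappa])
  then have "\<exists>c\<in>C. val W = cst2 l * c"
  proof (induction W)
    case 0
    show ?case using subrng_0[OF subrng_C] by (auto simp: val_simps)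
  next
    case (pCons b W)
    obtain c0 where c0: "c0 \<in> C" "subst2 q1 N b = cst2 l * c0"
      using cancel_coeff[OF l] pCons.prems[of 0] by auto
    obtain c1 where c1: "c1 \<in> C" "val W = cst2 l * c1"
      using pCons.IH pCons.prems[of "Suc _"] by auto
    have "val (pCons b W) = cst2 l * (c0 + r * c1)"
      unfolding val_pCons c0 c1 by (simp add: algebra_simps)
    moreover have "c0 + r * c1 \<in> C"
      by (intro subrng_add[OF subrng_C] subrng_mult[OF subrng_C] r_C c0 c1)
    ultimately show ?case by blast
  qed
  then show ?thesis by (simp add: W)
qed

lemma cancel_C1:
  assumes l: "prime l" "l dvd a" "\<not> l dvd a1" and "c \<in> C1" and dvd: "cst2 l dvd c"
  shows "\<exists>c'\<in>C1. c = cst2 l * c'"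
proof -
  obtain b where b: "c = subst2 q1 N b" using assms by (auto simp: C1_def)
  obtain t where t: "cst2 a dvd T - lift2 t" using E_reduce[OF T_E] by blast
  let ?s = "[:t, [:a1:]:]"
  have s: "?s = cst2 a1 * X1 + lift2 t" by (simp add: cst2_def X1_def lift2_def)
  have "cst2 l dvd q1 - ?s" unfolding s q1_def using cst2_dvd_trans[OF l(2) t] by simp
  moreover have "cst2 l dvd N - X2 ^ p" by (rule cst2_dvd_trans[OF l(2) N_mod])
  ultimately have D: "cst2 l dvd subst2 q1 N b - subst2 ?s (X2 ^ p) b" by (rule subst2_dvd_diff)
  have eq: "subst2 ?s (X2 ^ p) b = pcompose (map_poly (\<lambda>h. pcompose h (monom 1 p)) b) ?s"
  proof -
    have "subst2 ?s (X2 ^ p) b = ev (\<lambda>h. [:pcompose h (monom 1 p):]) ?s b"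
    proof -
      have "ev cst2 (X2 ^ p) = (\<lambda>h :: 'a poly. [:pcompose h (monom 1 p):])"
        by (rule ext) (simp add: lift2_pcompose_monom[symmetric] lift2_def)
      then show ?thesis by (simp only: subst2_ev)
    qed
    then show ?thesis unfolding pcompose_ev[of _ ?s]
      by (subst ev_map_poly) (simp_all add: rhom_const_poly rhom_comp[OF rhom_const_poly rhom_pcompose])
  qed
  have D': "[:[:l:]:] dvd pcompose (map_poly (\<lambda>h. pcompose h (monom 1 p)) b) ?s"
    using dvd_diff_cancel[OF D] dvd unfolding b eq by (simp only: cst2_def)
  have pl: "prime_elem [:l:]" using l by (intro lift_prime_elem_poly) simp
  have "[:[:l:]:] dvd map_poly (\<lambda>h. pcompose h (monom 1 p)) b"
    by (rule dvd_pcompose_cancel[OF pl _ _ D']) (use l a1_nz in simp_all)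
  then have *: "[:l:] dvd pcompose (coeff b i) (monom 1 p)" for i
    by (simp add: const_poly_dvd_iff[of "[:l:]"] coeff_map_poly)
  have "\<not> l dvd 1" using l not_prime_unit by blast
  then have "[:l:] dvd coeff b i" for i
    by (intro dvd_pcompose_cancel[OF _ _ _ *[of i]]) (use l p_pos in \<open>simp_all add: degree_monom_eq\<close>)
  then have "cst2 l dvd b" by (simp add: cst2_def const_poly_dvd_iff[of "[:l:]"])
  then obtain b' where "b = cst2 l * b'" by (elim dvdE)
  then have "c = cst2 l * subst2 q1 N b'" by (simp add: b subst2_simps)
  then show ?thesis by (auto simp: C1_def)
qed

lemma unit_cancel:
  assumes S: "subrng S" "\<And>c. cst2 c \<in> S" and "is_unit x" "cst2 x * b \<in> S"
  shows "b \<in> S"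
proof -
  obtain y where "y * x = 1" using assms(3) by (metis dvdE mult.commute)
  then have "cst2 y * cst2 x = 1" using cst2_simps(4)[of y x] cst2_simps(2) by metis
  then have "b = cst2 y * (cst2 x * b)" by (simp add: mult.assoc[symmetric])
  also have "\<dots> \<in> S" by (intro subrng_mult S assms)
  finally show ?thesis .
qed

lemma descend_C1:
  assumes "c \<noteq> 0" "\<And>l. prime l \<Longrightarrow> l dvd c \<Longrightarrow> l dvd a" "cst2 c * b \<in> C1"
  shows "\<exists>c'. c' \<noteq> 0 \<and> (\<forall>l. prime l \<longrightarrow> l dvd c' \<longrightarrow> l dvd a1) \<and> cst2 c' * b \<in> C1"
  using assms
proof (induction c arbitrary: b rule: prime_divisors_induct)
  case (unit x)
  then have "b \<in> C1" using unit_cancel[OF subrng_C1 C1_gens(1)] by blast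
  then show ?case by (intro exI[of _ 1]) (auto simp: cst2_simps)
next
  case (factor l c)
  have la: "l dvd a" by (rule factor.prems(2)[OF factor.hyps dvd_triv_left])
  have c: "c \<noteq> 0" using factor.prems(1) by auto
  have pc: "\<And>k. prime k \<Longrightarrow> k dvd c \<Longrightarrow> k dvd a" using factor.prems(2) dvd_mult by blast
  have m: "cst2 l * (cst2 c * b) \<in> C1" using factor.prems(3) by (simp add: cst2_simps mult.assoc)
  show ?case
  proof (cases "l dvd a1")
    case True
    have "cst2 c * (cst2 l * b) \<in> C1" using m by (simp add: mult_ac)
    from factor.IH[OF c pc this] obtain c' where c': "c' \<noteq> 0"
      "\<forall>l. prime l \<longrightarrow> l dvd c' \<longrightarrow> l dvd a1" "cst2 c' * (cst2 l * b) \<in> C1" by blast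
    have "k dvd a1" if "prime k" "k dvd c' * l" for k
    proof -
      have "k dvd c' \<or> k dvd l" using that by (simp add: prime_dvd_mult_iff)
      then show ?thesis using c'(2) that(1) dvd_trans[OF _ True] by blast
    qed
    moreover have "c' * l \<noteq> 0" using c'(1) factor.hyps by auto
    ultimately show ?thesis
    proof (intro exI[of _ "c' * l"] conjI allI impI)
      show "cst2 (c' * l) * b \<in> C1" using c'(3) by (simp add: cst2_simps mult.assoc)
    qed
  next
    case False
    obtain e where e: "e \<in> C1" "cst2 l * (cst2 c * b) = cst2 l * e"
      using cancel_C1[OF factor.hyps la False m dvd_triv_left] by blast
    have "cst2 l \<noteq> 0" using factor.hyps by simp
    with e(2) have "cst2 c * b = e" using mult_left_cancel by blast
    with e(1) have "cst2 c * b \<in> C1" by simp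
    from factor.IH[OF c pc this] show ?thesis .
  qed
qed simp

lemma descend_C:
  assumes "c \<noteq> 0" "\<And>l. prime l \<Longrightarrow> l dvd c \<Longrightarrow> l dvd a1" "cst2 c * b \<in> C"
  shows "b \<in> C"
  using assms
proof (induction c arbitrary: b rule: prime_divisors_induct)
  case (unit x)
  then show ?case using unit_cancel[OF subrng_C cst2_C] by blast
next
  case (factor l c)
  have la: "l dvd a1" by (rule factor.prems(2)[OF factor.hyps dvd_triv_left])
  have c: "c \<noteq> 0" using factor.prems(1) by auto
  have pc: "\<And>k. prime k \<Longrightarrow> k dvd c \<Longrightarrow> k dvd a1" using factor.prems(2) dvd_mult by blast
  have m: "cst2 l * (cst2 c * b) \<in> C" using factor.prems(3) by (simp add: cst2_simps mult.assoc)
  obtain e where e: "e \<in> C" "cst2 l * (cst2 c * b) = cst2 l * e"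
    using cancel_C[OF factor.hyps la m dvd_triv_left] by blast
  have "cst2 l \<noteq> 0" using factor.hyps by simp
  with e(2) have "cst2 c * b = e" using mult_left_cancel by blast
  with e(1) have "cst2 c * b \<in> C" by simp
  from factor.IH[OF c pc this] show ?case .
qed simp

lemma A_eq: "A = range val"
proof (intro equalityI subsetI)
  fix b assume "b \<in> A"
  then obtain n where "cst2 (a ^ n) * b \<in> range (subst2 q N)" using localize_A by blast
  then have "cst2 (a ^ n) * b \<in> C1"
    using subst2_mem[OF subrng_C1 C1_gens(1) q_C1 C1_gens(3)] by auto
  moreover have "a ^ n \<noteq> 0" using a_nz by simp
  moreover have "\<And>l. prime l \<Longrightarrow> l dvd a ^ n \<Longrightarrow> l dvd a" by (rule prime_dvd_power)
  ultimately have "\<exists>c'. c' \<noteq> 0 \<and> (\<forall>l. prime l \<longrightarrow> l dvd c' \<longrightarrow> l dvd a1) \<and> cst2 c' * b \<in> C1"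
    by (intro descend_C1)
  then obtain c' where c': "c' \<noteq> 0" "\<And>l. prime l \<Longrightarrow> l dvd c' \<Longrightarrow> l dvd a1" "cst2 c' * b \<in> C1"
    by blast
  then have "b \<in> C" using descend_C C1_C by blast
  then show "b \<in> range val" by (simp add: C_def)
next
  fix b assume "b \<in> range val"
  then obtain W where "b = val W" by auto
  moreover have "val W \<in> A" unfolding val_def
    by (rule ev_mem[OF rhom_subst2 subrng_A subst2_mem[OF subrng_A cst2_A q1_A N_A] r_A])
  ultimately show "b \<in> A" by simp
qed

lemma alg_gen_A: "alg_gen {q1, N, r} = A"
proof (intro equalityI subsetI)
  fix b assume "b \<in> alg_gen {q1, N, r}"
  then show "b \<in> A"
    by (induction rule: alg_gen.induct)
      (auto intro: subrng_add[OF subrng_A] subrng_mult[OF subrng_A] q1_A N_A r_A)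
next
  have S: "subrng (alg_gen {q1, N, r})"
    unfolding subrng_def
  proof (intro conjI ballI)
    show "1 \<in> alg_gen {q1, N, r}" using alg_gen.const[of 1] by (simp add: cst2_simps)
    show "- x \<in> alg_gen {q1, N, r}" if "x \<in> alg_gen {q1, N, r}" for x
      using alg_gen.mult[OF alg_gen.const[of "-1"] that] by (simp add: cst2_simps)
  qed (auto intro: alg_gen.intros)
  fix b assume "b \<in> A"
  then obtain W where "b = ev (subst2 q1 N) r W" unfolding A_eq val_def by auto
  moreover have "\<dots> \<in> alg_gen {q1, N, r}"
    by (rule ev_mem[OF rhom_subst2 S subst2_mem[OF S]]) (auto intro: alg_gen.intros)
  ultimately show "b \<in> alg_gen {q1, N, r}" by simp
qed

end

lemma binomial_step:
  fixes f :: "nat \<Rightarrow> 'b::comm_ring_1"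
  shows "(\<Sum>k\<le>n. of_nat (n choose k) * f k) + (\<Sum>k\<le>n. of_nat (n choose k) * f (Suc k))
    = (\<Sum>k\<le>Suc n. of_nat (Suc n choose k) * f k)"
proof -
  have "(\<Sum>k\<le>n. of_nat (n choose k) * f k) = (\<Sum>k\<le>Suc n. of_nat (n choose k) * f k)"
    by (simp add: binomial_eq_0)
  also have "\<dots> = f 0 + (\<Sum>k\<le>n. of_nat (n choose Suc k) * f (Suc k))"
    by (subst sum.atMost_Suc_shift) simp
  finally show ?thesis
    by (subst sum.atMost_Suc_shift) (simp add: algebra_simps sum.distrib)
qed

lemma power_add_in_subrng:
  fixes x v :: "'b::comm_ring_1"
  assumes S: "subrng S" "x \<in> S" "v \<in> S"
  shows "\<exists>k\<in>S. (x + v) ^ n = x ^ n + v * k"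
proof (induction n)
  case 0
  show ?case using subrng_0[OF S(1)] by (intro bexI[of _ 0]) auto
next
  case (Suc n)
  then obtain k where k: "k \<in> S" "(x + v) ^ n = x ^ n + v * k" by blast
  have "(x + v) ^ Suc n = x ^ Suc n + v * (x ^ n + (x + v) * k)"
    by (simp add: k(2)) (simp add: algebra_simps)
  moreover have "x ^ n + (x + v) * k \<in> S"
    by (intro subrng_add[OF S(1)] subrng_mult[OF S(1)] subrng_power[OF S(1)] S k)
  ultimately show ?case by blast
qed

lemma dvd_cst2_imp_cst2:
  fixes h :: "'a::idom poly poly"
  assumes "h dvd cst2 c" "c \<noteq> 0"
  shows "\<exists>h0. h = cst2 h0"
proof -
  have nz: "cst2 c \<noteq> 0" using assms(2) by simp
  have "degree h = 0" using divides_degree[OF assms(1)] nz by (simp add: cst2_def)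
  then obtain h1 where h1: "h = [:h1:]" by (auto elim: degree_eq_zeroE)
  have "h1 dvd [:c:]" using assms(1) by (simp add: h1 cst2_def)
  then have "degree h1 = 0" using divides_degree[of h1 "[:c:]"] assms(2) by simp
  then show ?thesis by (auto simp: h1 cst2_def elim: degree_eq_zeroE)
qed

context plane_split
begin

definition \<tau> where "\<tau> = pderiv th1"

lemma pderiv_theta: "pderiv \<theta> = Polynomial.smult d \<tau>"
  using pderiv_pcompose_char[where 'a = 'a, of g] p_pos
  by (simp add: th_split pderiv_add pderiv_smult \<tau>_def)

lemma lift2_pderiv_theta: "lift2 (pderiv \<theta>) = cst2 d * lift2 \<tau>"
  by (simp add: pderiv_theta lift2_def cst2_def)

lemma not_dvd_tau: "prime l \<Longrightarrow> l dvd a1 \<Longrightarrow> \<not> [:l:] dvd \<tau>"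
  unfolding \<tau>_def by (rule coprime_tau)

definition I1 where "I1 = {[:a1:] * s + \<tau> * t | s t. True}"

lemma I1I: "x = [:a1:] * s + \<tau> * t \<Longrightarrow> x \<in> I1"
  by (auto simp: I1_def)

lemma I1_a1: "[:a1:] * s \<in> I1" and I1_tau: "\<tau> * t \<in> I1"
  by (rule I1I[of _ s 0], simp) (rule I1I[of _ 0 t], simp)

lemma I1_add: "x \<in> I1 \<Longrightarrow> y \<in> I1 \<Longrightarrow> x + y \<in> I1"
proof -
  assume "x \<in> I1" "y \<in> I1"
  then obtain s t s' t' where "x = [:a1:] * s + \<tau> * t" "y = [:a1:] * s' + \<tau> * t'"
    unfolding I1_def by blast
  then have "x + y = [:a1:] * (s + s') + \<tau> * (t + t')" by (simp only: distrib_left add_ac)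
  then show ?thesis by (rule I1I)
qed

lemma I1_mult: "x \<in> I1 \<Longrightarrow> y * x \<in> I1"
proof -
  assume "x \<in> I1"
  then obtain s t where "x = [:a1:] * s + \<tau> * t" unfolding I1_def by blast
  then have "y * x = [:a1:] * (y * s) + \<tau> * (y * t)" by (simp only: distrib_left mult_ac)
  then show ?thesis by (rule I1I)
qed

lemma I1_0: "0 \<in> I1" using I1_a1[of 0] by simp

lemma I1_uminus: "x \<in> I1 \<Longrightarrow> - x \<in> I1"
  using I1_mult[of x "-1"] by simp

lemma I1_diff: "x \<in> I1 \<Longrightarrow> y \<in> I1 \<Longrightarrow> x - y \<in> I1"
  using I1_add[of x "-y"] I1_uminus[of y] by simp

abbreviation at0 :: "'a poly poly \<Rightarrow> 'a poly" where "at0 b \<equiv> coeff b 0"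

lemmas at0_simps = rhom_simps[OF rhom_coeff_0]

lemma at0_cst2: "at0 (cst2 c) = [:c:]" and at0_lift2: "at0 (lift2 h) = h"
  and at0_X1: "at0 X1 = 0" and at0_X2: "at0 X2 = [:0, 1:]"
  by (simp_all add: cst2_def lift2_def X1_def X2_def)

lemma ideal_principal_iff:
  "(\<exists>h. {cst2 a * u + lift2 (pderiv \<theta>) * v | u v. True} = {h * w | w. True}) \<longleftrightarrow> 1 \<in> I1"
proof
  assume "1 \<in> I1"
  then obtain s t where "1 = [:a1:] * s + \<tau> * t" unfolding I1_def by blast
  then have "lift2 1 = lift2 ([:a1:] * s + \<tau> * t)" by (rule arg_cong)
  moreover have "lift2 [:a1:] = cst2 a1" by (simp add: lift2_def cst2_def)
  ultimately have one: "1 = cst2 a1 * lift2 s + lift2 \<tau> * lift2 t" by (simp only: lift2_simps)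
  have "{cst2 a * u + lift2 (pderiv \<theta>) * v | u v. True} = {cst2 d * w | w. True}"
  proof (intro equalityI subsetI)
    fix x assume "x \<in> {cst2 a * u + lift2 (pderiv \<theta>) * v | u v. True}"
    then obtain u v where "x = cst2 a * u + lift2 (pderiv \<theta>) * v" by blast
    then have "x = cst2 d * (cst2 a1 * u + lift2 \<tau> * v)"
      unfolding cst2_a lift2_pderiv_theta by (simp add: algebra_simps)
    then show "x \<in> {cst2 d * w | w. True}" by blast
  next
    fix x assume "x \<in> {cst2 d * w | w. True}"
    then obtain w where "x = cst2 d * w" by blast
    then have "x = cst2 d * (cst2 a1 * lift2 s + lift2 \<tau> * lift2 t) * w" using one by simp
    then have "x = cst2 a * (lift2 s * w) + lift2 (pderiv \<theta>) * (lift2 t * w)"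
      unfolding cst2_a lift2_pderiv_theta by (simp add: algebra_simps)
    then show "x \<in> {cst2 a * u + lift2 (pderiv \<theta>) * v | u v. True}" by blast
  qed
  then show "\<exists>h. {cst2 a * u + lift2 (pderiv \<theta>) * v | u v. True} = {h * w | w. True}" by blast
next
  assume "\<exists>h. {cst2 a * u + lift2 (pderiv \<theta>) * v | u v. True} = {h * w | w. True}"
  then obtain h where h: "{cst2 a * u + lift2 (pderiv \<theta>) * v | u v. True} = {h * w | w. True}" ..
  have "cst2 a \<in> {cst2 a * u + lift2 (pderiv \<theta>) * v | u v. True}"
    by (intro CollectI exI[of _ 1] exI[of _ 0]) simp
  then obtain af where af: "cst2 a = h * af" unfolding h by blast
  have "lift2 (pderiv \<theta>) \<in> {cst2 a * u + lift2 (pderiv \<theta>) * v | u v. True}"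
    by (intro CollectI exI[of _ 0] exI[of _ 1]) simp
  then obtain w1 where w1: "lift2 (pderiv \<theta>) = h * w1" unfolding h by blast
  have "h \<in> {h * w | w. True}" by (intro CollectI exI[of _ 1]) simp
  then obtain u v where uv: "h = cst2 a * u + lift2 (pderiv \<theta>) * v" unfolding h[symmetric] by blast
  define k where "k = cst2 a1 * u + lift2 \<tau> * v"
  have hk: "h = cst2 d * k"
    unfolding uv k_def cst2_a lift2_pderiv_theta by (simp add: algebra_simps)
  have dn: "cst2 d \<noteq> 0" using d_nz by simp
  have "cst2 d * cst2 a1 = cst2 d * (k * af)" using af unfolding cst2_a hk by (simp only: mult.assoc)
  then have k0: "cst2 a1 = k * af" using dn mult_left_cancel by blast
  have "cst2 d * lift2 \<tau> = cst2 d * (k * w1)"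
    using w1 unfolding lift2_pderiv_theta hk by (simp only: mult.assoc)
  then have k1: "lift2 \<tau> = k * w1" using dn mult_left_cancel by blast
  have "k dvd cst2 a1" unfolding k0 by simp
  then obtain c where c: "k = cst2 c" using dvd_cst2_imp_cst2 a1_nz by blast
  have "c dvd a1" using k0 cst2_dvd_cst2[of c a1] by (simp add: c)
  moreover have "[:c:] dvd \<tau>" using k1 cst2_dvd_lift2[of c \<tau>] by (simp add: c)
  moreover have "c \<noteq> 0" using \<open>c dvd a1\<close> a1_nz by auto
  ultimately have "is_unit c"
  proof -
    have False if nu: "\<not> is_unit c"
    proof -
      obtain l where l: "prime l" "l dvd c" using prime_divisor_exists[OF \<open>c \<noteq> 0\<close> nu] by blast
      have "[:l:] dvd [:c:]" using l(2) by simp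
      then have "[:l:] dvd \<tau>" using \<open>[:c:] dvd \<tau>\<close> dvd_trans by blast
      moreover have "l dvd a1" using l(2) \<open>c dvd a1\<close> dvd_trans by blast
      ultimately show False using not_dvd_tau l(1) by blast
    qed
    then show ?thesis by blast
  qed
  then obtain e where e: "1 = c * e" by (rule dvdE)
  have "at0 k = [:a1:] * at0 u + \<tau> * at0 v"
    unfolding k_def by (simp only: at0_simps at0_cst2 at0_lift2)
  then have "[:e:] * at0 k \<in> I1" by (intro I1_mult) (rule I1I)
  moreover have "[:e:] * at0 k = 1" by (simp add: c at0_cst2 e[symmetric] mult.commute one_pCons)
  ultimately show "1 \<in> I1" by simp
qed

lemma at0_N: "\<exists>z. at0 N = [:0, 1:] ^ p - [:a:] * z"
proof -
  have "N = X2 ^ p - cst2 a * (cst2 a ^ (p - 2) * F ^ (p - 1) * X2)"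
    unfolding N_def u_power by (simp only: mult.assoc)
  then have "at0 N = [:0, 1:] ^ p - [:a:] * at0 (cst2 a ^ (p - 2) * F ^ (p - 1) * X2)"
    by (simp only: at0_simps at0_cst2 at0_X2)
  then show ?thesis by blast
qed

lemma at0_q1: "at0 q1 = th1 + [:a1:] * at0 m0"
  unfolding q1_def T_def by (simp only: at0_simps at0_cst2 at0_lift2 at0_X1) simp

lemma at0_r: "at0 r = 0"
proof -
  have "at0 r = (\<Prod>i<p. at0 ((\<psi> ^^ i) X1))" unfolding r_def by (rule at0_simps)
  moreover have "\<exists>i\<in>{..<p}. at0 ((\<psi> ^^ i) X1) = 0"
    using p_pos by (intro bexI[of _ 0]) (simp_all add: at0_X1)
  ultimately show ?thesis by (simp add: prod_zero_iff)
qed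

lemma I1_a: "[:a:] * z \<in> I1"
  using I1_a1[of "[:d:] * z"] by (simp add: a_split mult_ac)

lemma pderiv_at0:
  assumes "b \<in> A" shows "pderiv (at0 b) \<in> I1"
proof -
  have "b \<in> alg_gen {q1, N, r}" using assms alg_gen_A by simp
  then show ?thesis
  proof (induction rule: alg_gen.induct)
    case (const c)
    show ?case by (simp add: at0_cst2 I1_0 pderiv_pCons)
  next
    case (gen s)
    consider "s = q1" | "s = N" | "s = r" using gen by blast
    then show ?case
    proof cases
      case 1
      have "pderiv (at0 q1) = [:a1:] * pderiv (at0 m0) + \<tau> * 1"
        by (simp add: at0_q1 pderiv_add pderiv_mult \<tau>_def pderiv_pCons pderiv_smult)
      then show ?thesis unfolding 1 by (rule I1I)
    next
      case 2
      obtain z where z: "at0 N = [:0, 1:] ^ p - [:a:] * z" using at0_N by blast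
      have "[:0, 1:] ^ p = monom (1::'a) p" by (simp add: monom_altdef)
      then have "pderiv ([:0, 1:] ^ p :: 'a poly) = 0"
        using pderiv_monom[of "1::'a" p] by (simp add: of_nat_eq_0_iff_char_dvd)
      then have "pderiv (at0 N) = [:a:] * (- pderiv z)"
        unfolding z by (simp add: pderiv_diff pderiv_smult)
      then show ?thesis unfolding 2 using I1_a by metis
    next
      case 3
      then show ?thesis by (simp add: at0_r I1_0)
    qed
  next
    case (add x y)
    then show ?case by (simp add: pderiv_add I1_add)
  next
    case (mult x y)
    then show ?case by (simp add: at0_simps pderiv_mult I1_add I1_mult)
  qed
qed

section \<open>The plinth ideal\<close>

definition \<epsilon> where "\<epsilon> = cst2 d * F"

lemma eps_nz: "\<epsilon> \<noteq> 0" using d_nz F_ne_0 by (simp add: \<epsilon>_def)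

lemma psi_eps [simp]: "\<psi> \<epsilon> = \<epsilon>" by (simp add: \<epsilon>_def psi_simps)

lemma eps_A: "\<epsilon> \<in> A" by (simp add: A_iff)

lemma u_eps: "u = \<epsilon> * cst2 a1"
  unfolding u_def \<epsilon>_def cst2_a by (simp only: mult_ac)

lemma G_eps: "\<exists>w'. G = \<epsilon> * (- (lift2 \<tau> + cst2 a1 * w'))"
proof -
  obtain w' where w': "ev cst2 (X2 + u) \<theta> = ev cst2 X2 \<theta> + u * ev cst2 X2 (pderiv \<theta>) + u\<^sup>2 * w'"
    using ev_taylor[OF rhom_cst2 subrng_UNIV, of X2 u \<theta>] by auto
  have "cst2 a * G = cst2 a * (\<epsilon> * (- (lift2 \<tau> + cst2 a1 * (F * w'))))"
    unfolding G_ev w' unfolding lift2_ev[symmetric] lift2_pderiv_theta power2_eq_square u_def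
    by (simp add: \<epsilon>_def cst2_a algebra_simps)
  then have "G = \<epsilon> * (- (lift2 \<tau> + cst2 a1 * (F * w')))" using a_nz by simp
  then show ?thesis by blast
qed

lemma eps_dvd: "\<epsilon> dvd \<psi> b - b"
proof (induction b rule: bi_induct)
  case (cst c)
  show ?case by simp
next
  case X1
  have "\<psi> X1 - X1 = G" by (simp add: psi_X1)
  then show ?case using G_eps by (metis dvd_triv_left)
next
  case X2
  show ?case by (simp add: psi_X2 u_eps)
next
  case (add x y)
  have "\<psi> (x + y) - (x + y) = (\<psi> x - x) + (\<psi> y - y)" by (simp add: psi_simps)
  then show ?case using add by (metis dvd_add)
next
  case (mult x y)
  then show ?case unfolding psi_simps by (rule dvd_diff_mult)
qed

text \<open>The image of \<psi> - id is divisible by \<epsilon>; the plinth ideal is principal precisely when \<epsilon>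
  belongs to it.\<close>

definition \<Delta> where "\<Delta> b = (SOME c. \<psi> b - b = \<epsilon> * c)"

lemma Delta_eq: "\<psi> b - b = \<epsilon> * \<Delta> b"
  unfolding \<Delta>_def by (rule someI_ex) (use eps_dvd[of b] in \<open>auto elim: dvdE\<close>)

lemma Delta_unique: "\<psi> b - b = \<epsilon> * c \<Longrightarrow> \<Delta> b = c"
  using Delta_eq[of b] eps_nz by simp

lemma psi_Delta: "\<psi> b = b + \<epsilon> * \<Delta> b"
  using Delta_eq[of b] by (simp add: algebra_simps)

lemma Delta_add: "\<Delta> (b + c) = \<Delta> b + \<Delta> c"
  by (rule Delta_unique, unfold psi_simps, unfold psi_Delta) (simp add: algebra_simps)

lemma Delta_mult: "\<Delta> (b * c) = \<Delta> b * c + \<psi> b * \<Delta> c"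
  by (rule Delta_unique, unfold psi_simps, unfold psi_Delta) (simp add: algebra_simps)

lemma Delta_fixed: "\<psi> b = b \<Longrightarrow> \<Delta> b = 0"
  by (rule Delta_unique) simp

lemma Delta_fixed_mult: "\<psi> b = b \<Longrightarrow> \<Delta> (b * c) = b * \<Delta> c"
  by (simp add: Delta_mult Delta_fixed)

lemma Delta_diff: "\<Delta> (b - c) = \<Delta> b - \<Delta> c"
  using Delta_add[of "b - c" c] by simp

lemma Delta_psi: "\<Delta> (\<psi> b) = \<psi> (\<Delta> b)"
proof (rule Delta_unique)
  have "\<psi> (\<psi> b - b) = \<psi> (\<epsilon> * \<Delta> b)" by (simp only: Delta_eq)
  then show "\<psi> (\<psi> b) - \<psi> b = \<epsilon> * \<psi> (\<Delta> b)" by (simp only: psi_simps psi_eps)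
qed

lemma Delta_mod: "cst2 a1 dvd b - b' \<Longrightarrow> cst2 a1 dvd \<Delta> b - \<Delta> b'"
  unfolding Delta_diff[symmetric] by (auto elim!: dvdE simp: Delta_fixed_mult)

lemma psi_mod: "cst2 a1 dvd b - b' \<Longrightarrow> cst2 a1 dvd \<psi> b - \<psi> b'"
  using rhom_dvd[OF rhom_psi, of "cst2 a1" "b - b'"] by (simp add: psi_simps)

lemma Delta_lift2: "cst2 a1 dvd \<Delta> (lift2 h)"
proof -
  obtain w' where w': "ev cst2 (X2 + u) h = ev cst2 X2 h + u * w'"
    using ev_shift[OF rhom_cst2 subrng_UNIV, of X2 u h] by auto
  have "\<Delta> (lift2 h) = cst2 a1 * w'"
    by (rule Delta_unique, unfold lift2_ev psi_ev psi_X2 w') (simp add: u_eps)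
  then show ?thesis by simp
qed

lemma psi_lift2_mod: "cst2 a1 dvd \<psi> (lift2 h) - lift2 h"
  unfolding Delta_eq using Delta_lift2 by (rule dvd_mult)

lemma psin_lift2_mod: "cst2 a1 dvd (\<psi> ^^ k) (lift2 h) - lift2 h"
proof (induction k)
  case (Suc k)
  show ?case using dvd_diff_trans[OF psi_mod[OF Suc] psi_lift2_mod] by simp
qed simp

lemma psin_mod: "cst2 a1 dvd b - b' \<Longrightarrow> cst2 a1 dvd (\<psi> ^^ k) b - (\<psi> ^^ k) b'"
  by (induction k) (simp_all add: psi_mod)

lemma Delta_X1: "cst2 a1 dvd \<Delta> X1 - lift2 (- \<tau>)"
proof -
  obtain w' where w': "G = \<epsilon> * (- (lift2 \<tau> + cst2 a1 * w'))" using G_eps by blast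
  have "\<psi> X1 - X1 = G" by (simp add: psi_X1)
  then have "\<Delta> X1 = - (lift2 \<tau> + cst2 a1 * w')" using w' by (intro Delta_unique) (rule trans)
  then show ?thesis by (simp add: lift2_simps)
qed

lemma Deltan_psi: "(\<Delta> ^^ k) (\<psi> b) = \<psi> ((\<Delta> ^^ k) b)"
  by (induction k) (simp_all add: Delta_psi)

lemma Deltan_add: "(\<Delta> ^^ k) (b + c) = (\<Delta> ^^ k) b + (\<Delta> ^^ k) c"
  by (induction k) (simp_all add: Delta_add)

lemma Deltan_eps: "(\<Delta> ^^ k) (\<epsilon> * b) = \<epsilon> * (\<Delta> ^^ k) b"
  by (induction k) (simp_all add: Delta_fixed_mult)

lemma Deltan_mod: "cst2 a1 dvd b - b' \<Longrightarrow> cst2 a1 dvd (\<Delta> ^^ k) b - (\<Delta> ^^ k) b'"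
  by (induction k) (simp_all add: Delta_mod)

lemma Deltan_lift2_mult: "cst2 a1 dvd (\<Delta> ^^ k) (lift2 h * b) - lift2 h * (\<Delta> ^^ k) b"
proof (induction k)
  case (Suc k)
  let ?D = "(\<Delta> ^^ k) b"
  have "cst2 a1 dvd \<Delta> (lift2 h) * ?D + (\<psi> (lift2 h) - lift2 h) * \<Delta> ?D"
    by (intro dvd_add dvd_mult2 Delta_lift2 psi_lift2_mod)
  also have "\<dots> = \<Delta> (lift2 h * ?D) - lift2 h * \<Delta> ?D"
    by (simp add: Delta_mult algebra_simps)
  finally show ?case using dvd_diff_trans[OF Delta_mod[OF Suc]] by simp
qed simp

lemma psin_X1_shift:
  "\<exists>s. (\<psi> ^^ k) X1 - X1 = \<epsilon> * s \<and> cst2 a1 dvd s - lift2 (- (of_nat k * \<tau>))"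
proof (induction k)
  case 0
  show ?case by (intro exI[of _ 0]) (simp add: lift2_simps)
next
  case (Suc k)
  then obtain s where s: "(\<psi> ^^ k) X1 - X1 = \<epsilon> * s" "cst2 a1 dvd s - lift2 (- (of_nat k * \<tau>))"
    by blast
  have "(\<psi> ^^ Suc k) X1 - X1 = (\<psi> ^^ k) (\<psi> X1 - X1) + ((\<psi> ^^ k) X1 - X1)"
    by (simp add: psin_simps funpow_swap1)
  also have "\<dots> = \<epsilon> * ((\<psi> ^^ k) (\<Delta> X1) + s)"
    unfolding s(1) Delta_eq by (simp add: psin_simps psin_fixed distrib_left)
  finally have "(\<psi> ^^ Suc k) X1 - X1 = \<epsilon> * ((\<psi> ^^ k) (\<Delta> X1) + s)" .
  moreover have "cst2 a1 dvd (\<psi> ^^ k) (\<Delta> X1) + s - (lift2 (- \<tau>) + lift2 (- (of_nat k * \<tau>)))"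
    by (intro dvd_diff_add s dvd_diff_trans[OF psin_mod[OF Delta_X1] psin_lift2_mod])
  moreover have "lift2 (- \<tau>) + lift2 (- (of_nat k * \<tau>)) = lift2 (- (of_nat (Suc k) * \<tau>))"
    by (simp add: lift2_simps algebra_simps)
  ultimately show ?case by metis
qed

definition shift_prod where "shift_prod k = (\<Prod>i<k. (\<psi> ^^ i) X1)"

definition shift_val :: "nat \<Rightarrow> 'a poly" where "shift_val k = of_nat (fact k) * (- \<tau>) ^ k"

lemma Delta_shift_prod: "\<exists>s. \<Delta> (shift_prod (Suc k)) = \<psi> (shift_prod k) * s \<and> cst2 a1 dvd s - lift2 (- (of_nat (Suc k) * \<tau>))"
proof -
  obtain s where s: "(\<psi> ^^ Suc k) X1 - X1 = \<epsilon> * s" "cst2 a1 dvd s - lift2 (- (of_nat (Suc k) * \<tau>))"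
    using psin_X1_shift by blast
  have 1: "shift_prod (Suc k) = X1 * \<psi> (shift_prod k)"
    unfolding shift_prod_def psi_simps by (simp add: prod.lessThan_Suc_shift del: prod.lessThan_Suc)
  have 2: "\<psi> (shift_prod (Suc k)) = \<psi> (shift_prod k) * (\<psi> ^^ Suc k) X1"
    by (simp add: shift_prod_def psi_simps)
  have "\<psi> (shift_prod (Suc k)) - shift_prod (Suc k) = \<psi> (shift_prod k) * ((\<psi> ^^ Suc k) X1 - X1)"
    unfolding 2 unfolding 1 by (simp add: algebra_simps del: funpow.simps)
  also have "\<dots> = \<epsilon> * (\<psi> (shift_prod k) * s)" unfolding s(1) by (simp only: mult_ac)
  finally have "\<Delta> (shift_prod (Suc k)) = \<psi> (shift_prod k) * s" by (rule Delta_unique)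
  then show ?thesis using s(2) by blast
qed

lemma Deltan_shift_prod: "cst2 a1 dvd (\<Delta> ^^ k) (shift_prod k) - lift2 (shift_val k)"
proof (induction k)
  case 0
  show ?case by (simp add: shift_prod_def shift_val_def lift2_simps)
next
  case (Suc k)
  let ?h = "- (of_nat (Suc k) * \<tau>)"
  obtain s where s: "\<Delta> (shift_prod (Suc k)) = \<psi> (shift_prod k) * s" "cst2 a1 dvd s - lift2 ?h"
    using Delta_shift_prod by blast
  have "cst2 a1 dvd \<psi> (shift_prod k) * s - lift2 ?h * \<psi> (shift_prod k)"
    using dvd_diff_mult[OF s(2), of "\<psi> (shift_prod k)" "\<psi> (shift_prod k)"] by (simp add: mult.commute)
  then have 1: "cst2 a1 dvd (\<Delta> ^^ k) (\<psi> (shift_prod k) * s) - (\<Delta> ^^ k) (lift2 ?h * \<psi> (shift_prod k))"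
    by (rule Deltan_mod)
  have 2: "cst2 a1 dvd (\<Delta> ^^ k) (lift2 ?h * \<psi> (shift_prod k)) - lift2 ?h * (\<Delta> ^^ k) (\<psi> (shift_prod k))"
    by (rule Deltan_lift2_mult)
  have "cst2 a1 dvd \<psi> ((\<Delta> ^^ k) (shift_prod k)) - lift2 (shift_val k)"
    by (rule dvd_diff_trans[OF psi_mod[OF Suc] psi_lift2_mod])
  then have 3: "cst2 a1 dvd lift2 ?h * (\<Delta> ^^ k) (\<psi> (shift_prod k)) - lift2 ?h * lift2 (shift_val k)"
    unfolding Deltan_psi by (intro dvd_diff_mult) simp_all
  have "?h * shift_val k = shift_val (Suc k)" by (simp add: shift_val_def algebra_simps)
  then have "lift2 ?h * lift2 (shift_val k) = lift2 (shift_val (Suc k))"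
    by (simp only: lift2_simps(4)[symmetric])
  moreover have "(\<Delta> ^^ Suc k) (shift_prod (Suc k)) = (\<Delta> ^^ k) (\<psi> (shift_prod k) * s)"
    by (simp add: funpow_swap1 s(1))
  ultimately show ?case using dvd_diff_trans[OF dvd_diff_trans[OF 1 2] 3] by simp
qed

lemma psin_binomial: "(\<psi> ^^ n) b = (\<Sum>k\<le>n. of_nat (n choose k) * (\<epsilon> ^ k * (\<Delta> ^^ k) b))"
proof (induction n arbitrary: b)
  case (Suc n)
  have "(\<psi> ^^ Suc n) b = (\<psi> ^^ n) (\<psi> b)" by (simp add: funpow_swap1)
  also have "\<dots> = (\<Sum>k\<le>n. of_nat (n choose k) * (\<epsilon> ^ k * (\<Delta> ^^ k) (b + \<epsilon> * \<Delta> b)))"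
    unfolding Suc.IH psi_Delta ..
  also have "\<dots> = (\<Sum>k\<le>n. of_nat (n choose k) * (\<epsilon> ^ k * (\<Delta> ^^ k) b))
      + (\<Sum>k\<le>n. of_nat (n choose k) * (\<epsilon> ^ Suc k * (\<Delta> ^^ Suc k) b))"
    by (simp add: Deltan_add Deltan_eps sum.distrib[symmetric] funpow_swap1 algebra_simps)
  also have "\<dots> = (\<Sum>k\<le>Suc n. of_nat (Suc n choose k) * (\<epsilon> ^ k * (\<Delta> ^^ k) b))"
    by (rule binomial_step)
  finally show ?case .
qed simp

lemma Delta_nilpotent: "(\<Delta> ^^ p) b = 0"
proof -
  let ?t = "\<lambda>k. of_nat (p choose k) * (\<epsilon> ^ k * (\<Delta> ^^ k) b)"
  have "b = (\<Sum>k\<le>p. ?t k)" using psi_order[of b] psin_binomial[of p b] by simp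
  also have "\<dots> = (\<Sum>k\<in>{0, p}. ?t k)"
  proof (rule sum.mono_neutral_right)
    show "\<forall>i\<in>{..p} - {0, p}. ?t i = 0"
    proof
      fix i assume "i \<in> {..p} - {0, p}"
      then have "p dvd (p choose i)" using p_pos prime_p by (intro dvd_choose_prime) auto
      then have "(of_nat (p choose i) :: 'a poly poly) = 0" by (simp add: of_nat_eq_0_iff_char_dvd)
      then show "?t i = 0" by simp
    qed
  qed auto
  also have "\<dots> = b + \<epsilon> ^ p * (\<Delta> ^^ p) b" using p_pos by simp
  finally show ?thesis using eps_nz by simp
qed

text \<open>A divided trace: since \<Delta> is linear over R[x2] modulo a1 and maps X1 to -\<tau>, this element
  is congruent to (p - 1)! (-\<tau>)^(p - 1).\<close>

definition v where "v = (\<Delta> ^^ (p - 1)) (shift_prod (p - 1))"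

lemma v_A: "v \<in> A"
proof -
  have "\<Delta> v = (\<Delta> ^^ p) (shift_prod (p - 1))" unfolding v_def using p_pos by (cases p) simp_all
  then show ?thesis using Delta_eq[of v] by (simp add: Delta_nilpotent A_iff)
qed

lemma v_mod: "cst2 a1 dvd v - lift2 (shift_val (p - 1))"
  unfolding v_def by (rule Deltan_shift_prod)

lemma fact_unit: "\<exists>e::'a. of_nat (fact (p - 1)) * e = 1"
proof (rule of_nat_unit_char)
  show "prime CHAR('a)" using prime_p by simp
  show "\<not> CHAR('a) dvd fact (p - 1)"
    using prime_dvd_fact_iff[OF prime_p, of "p - 1"] p_pos by simp
qed

lemma v_eps: "\<exists>b. \<psi> b - b = \<epsilon> * v"
proof -
  have "p - 1 = Suc (p - 2)" using p2 by simp
  then have "v = \<Delta> ((\<Delta> ^^ (p - 2)) (shift_prod (p - 1)))" unfolding v_def by simp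
  then show ?thesis using Delta_eq by metis
qed

lemma v_prime: "prime l \<Longrightarrow> l dvd a1 \<Longrightarrow> \<not> cst2 l dvd v"
proof
  assume l: "prime l" "l dvd a1" "cst2 l dvd v"
  have "cst2 l dvd lift2 (shift_val (p - 1))"
    using dvd_diff_cancel[OF cst2_dvd_trans[OF l(2) v_mod]] l(3) by simp
  then have "[:l:] dvd shift_val (p - 1)" by (simp only: cst2_dvd_lift2)
  moreover obtain e :: 'a where e: "of_nat (fact (p - 1)) * e = 1" using fact_unit by blast
  have "[:e:] * of_nat (fact (p - 1)) = (1 :: 'a poly)"
    using e by (simp only: of_nat_poly) (simp add: mult.commute one_pCons)
  then have "[:e:] * shift_val (p - 1) = (- \<tau>) ^ (p - 1)"
    unfolding shift_val_def mult.assoc[symmetric] by (simp only: mult_1)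
  moreover have "[:l:] dvd [:e:] * shift_val (p - 1)" if "[:l:] dvd shift_val (p - 1)"
    using that by (rule dvd_mult)
  ultimately have "[:l:] dvd (- \<tau>) ^ (p - 1)" by simp
  moreover have "prime_elem [:l:]" using l by (intro lift_prime_elem_poly) simp
  ultimately have "[:l:] dvd - \<tau>" using prime_elem_dvd_power by blast
  then show False using not_dvd_tau[OF l(1,2)] by simp
qed

lemma plinth_iff: "b \<in> plinth \<psi> \<longleftrightarrow> (\<exists>c. b = \<psi> c - c) \<and> b \<in> A"
  by (auto simp: plinth_def A_def)

lemma u_plinth: "u \<in> plinth \<psi>"
  unfolding plinth_iff by (intro conjI exI[of _ X2]) (simp_all add: psi_X2 A_iff)

lemma eps_v_plinth: "\<epsilon> * v \<in> plinth \<psi>"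
  unfolding plinth_iff using v_eps subrng_mult[OF subrng_A eps_A v_A] by metis

lemma A_divisor: "x * y \<in> A \<Longrightarrow> x \<in> A \<Longrightarrow> x \<noteq> 0 \<Longrightarrow> y \<in> A"
  by (simp add: A_iff psi_simps)

lemma plinth_principal_imp:
  assumes "principal_in A (plinth \<psi>)" shows "1 \<in> I1"
proof -
  obtain h where h: "h \<in> A" "plinth \<psi> = {h * w | w. w \<in> A}"
    using assms unfolding principal_in_def by blast
  obtain w1 where w1: "u = h * w1" using u_plinth unfolding h(2) by blast
  obtain w2 where w2: "\<epsilon> * v = h * w2" using eps_v_plinth unfolding h(2) by blast
  have hn: "h \<noteq> 0" using w1 u_ne_0 by auto
  have "h * (w1 * v) = h * (cst2 a1 * w2)"
  proof -
    have "h * (w1 * v) = cst2 a1 * (\<epsilon> * v)" using w1 by (simp add: u_eps mult_ac)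
    then show ?thesis unfolding w2 by (simp only: mult_ac)
  qed
  then have "w1 * v = cst2 a1 * w2" using hn mult_left_cancel by blast
  then have "cst2 a1 dvd w1 * v" by simp
  then have "cst2 a1 dvd w1"
    using cancel_const[where e = cst2 and c = a1 and v = v and w = w1]
      rhom_cst2 prime_elem_cst2 a1_nz v_prime by blast
  then obtain w3 where w3: "w1 = cst2 a1 * w3" by (rule dvdE)
  have "cst2 a1 * \<epsilon> = cst2 a1 * (h * w3)" using w1 unfolding u_eps w3 by (simp only: mult_ac)
  moreover have "cst2 a1 \<noteq> 0" using a1_nz by simp
  ultimately have e: "\<epsilon> = h * w3" using mult_left_cancel by blast
  then have "w3 \<in> A" using A_divisor[of h w3] eps_A h(1) hn by simp
  then have "\<epsilon> \<in> plinth \<psi>" unfolding h(2) using e by blast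
  then obtain b where b: "\<epsilon> = \<psi> b - b" unfolding plinth_iff by blast
  have "\<psi> b = b + \<epsilon>" using b by (simp add: algebra_simps)
  then have "cst2 a1 * b - X2 \<in> A"
    by (simp add: A_iff psi_simps psi_X2 u_eps algebra_simps)
  then have "pderiv (at0 (cst2 a1 * b - X2)) \<in> I1" by (rule pderiv_at0)
  moreover have "pderiv (at0 (cst2 a1 * b - X2)) = [:a1:] * pderiv (at0 b) - 1"
    by (simp add: at0_simps at0_cst2 at0_X2 pderiv_diff pderiv_smult pderiv_pCons one_pCons)
  ultimately show ?thesis using I1_diff[OF I1_a1[of "pderiv (at0 b)"]] by fastforce
qed

lemma tau_const_mod:
  assumes "1 \<in> I1" "prime l" "l dvd a1"
  shows "[:l:] dvd \<tau> - [:coeff \<tau> 0:]"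
proof -
  obtain s t where st: "1 = [:a1:] * s + \<tau> * t" using assms(1) unfolding I1_def by blast
  have "\<tau> * t - 1 = [:a1:] * (- s)" unfolding st by simp
  moreover have "[:l:] dvd [:a1:]" using assms(3) by simp
  ultimately have "[:l:] dvd \<tau> * t - 1" by (metis dvd_mult2)
  moreover have "prime_elem l" using assms(2) by simp
  ultimately show ?thesis by (intro unit_mod_prime_const)
qed

lemma tau0_unit_mod:
  assumes "1 \<in> I1" shows "\<exists>e. a1 dvd coeff \<tau> 0 * e - 1"
proof -
  obtain s t where st: "1 = [:a1:] * s + \<tau> * t" using assms unfolding I1_def by blast
  have "coeff \<tau> 0 * coeff t 0 - 1 = a1 * (- coeff s 0)"
    using arg_cong[OF st, of "\<lambda>z. coeff z 0"] by (simp add: coeff_mult_0 algebra_simps)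
  then show ?thesis by (metis dvd_triv_left)
qed

lemma v_comaximal:
  assumes "1 \<in> I1"
  shows "\<exists>\<alpha>\<in>A. \<exists>\<beta>\<in>A. 1 = cst2 a1 * \<alpha> + v * \<beta>"
proof -
  define c0 where "c0 = coeff \<tau> 0"
  define c where "c = of_nat (fact (p - 1)) * (- c0) ^ (p - 1)"
  have dl: "cst2 l dvd v - cst2 c" if l: "prime l" "l dvd a1" for l
  proof -
    have "[:l:] dvd - \<tau> - - [:c0:]"
    proof -
      have eq: "- \<tau> - - [:c0:] = - (\<tau> - [:c0:])" by simp
      show ?thesis unfolding eq dvd_minus_iff unfolding c0_def by (rule tau_const_mod[OF assms l])
    qed
    then have "[:l:] dvd shift_val (p - 1) - of_nat (fact (p - 1)) * (- [:c0:]) ^ (p - 1)"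
      unfolding shift_val_def by (intro dvd_diff_mult dvd_diff_power) simp_all
    moreover have "of_nat (fact (p - 1)) * (- [:c0:]) ^ (p - 1) = [:c:]"
    proof -
      have "[:c:] = [:of_nat (fact (p - 1)):] * [:- c0:] ^ (p - 1)"
        unfolding c_def by (simp only: rhom_mult[OF rhom_const_poly] rhom_power[OF rhom_const_poly])
      moreover have "- [:c0:] = [:- c0:]" by simp
      ultimately show ?thesis by (simp only: of_nat_poly)
    qed
    ultimately have "cst2 l dvd lift2 (shift_val (p - 1)) - lift2 [:c:]"
      unfolding lift2_simps(6)[symmetric] cst2_dvd_lift2 by simp
    moreover have "lift2 [:c:] = cst2 c" by (simp add: lift2_def cst2_def)
    ultimately show ?thesis using dvd_diff_trans[OF cst2_dvd_trans[OF l(2) v_mod]] by simp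
  qed
  have "\<exists>n. cst2 a1 dvd (v - cst2 c) ^ n"
    by (rule dvd_power_of_prime_dvd[OF rhom_cst2 a1_nz dl])
  then obtain n where "cst2 a1 dvd (v - cst2 c) ^ n" ..
  then obtain b' where b': "(v - cst2 c) ^ n = cst2 a1 * b'" by (rule dvdE)
  have "(v - cst2 c) ^ n \<in> A"
    by (intro subrng_power[OF subrng_A] subrng_diff[OF subrng_A] v_A cst2_A)
  then have b'A: "b' \<in> A" unfolding b' using A_cancel a1_nz by blast
  obtain k where k: "k \<in> A" "(- cst2 c + v) ^ n = (- cst2 c) ^ n + v * k"
    using power_add_in_subrng[OF subrng_A subrng_uminus[OF subrng_A cst2_A] v_A] by blast
  have eq1: "cst2 ((- c) ^ n) = cst2 a1 * b' - v * k"
  proof -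
    have "- cst2 c + v = v - cst2 c" by simp
    then have "cst2 a1 * b' = (- cst2 c) ^ n + v * k" using k(2) b' by metis
    moreover have "cst2 ((- c) ^ n) = (- cst2 c) ^ n" by (simp only: cst2_simps)
    ultimately show ?thesis by (simp only: add_diff_cancel_right')
  qed
  obtain e where e: "a1 dvd c0 * e - 1" using tau0_unit_mod[OF assms] by (auto simp: c0_def)
  obtain e2 :: 'a where e2: "of_nat (fact (p - 1)) * e2 = 1" using fact_unit by blast
  define e' where "e' = e2 * (- e) ^ (p - 1)"
  have "c * e' = (of_nat (fact (p - 1)) * e2) * ((- c0) * (- e)) ^ (p - 1)"
    unfolding c_def e'_def power_mult_distrib by (simp only: mult_ac)
  then have "c * e' = (c0 * e) ^ (p - 1)" by (simp only: e2 mult_1 minus_mult_minus)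
  then have "a1 dvd c * e' - 1 ^ (p - 1)" using dvd_diff_power[OF e] by simp
  then have "a1 dvd c * e' - 1" by simp
  then have "a1 dvd (c * e') ^ n - 1 ^ n" by (rule dvd_diff_power)
  moreover have "(c * e') ^ n = (- c) ^ n * (- e') ^ n"
    unfolding power_mult_distrib[symmetric] by simp
  ultimately have "a1 dvd (- c) ^ n * (- e') ^ n - 1" by simp
  then obtain k2 where "(- c) ^ n * (- e') ^ n - 1 = a1 * k2" by (rule dvdE)
  then have "(- c) ^ n * (- e') ^ n = 1 + a1 * k2" by (simp add: algebra_simps)
  then have "cst2 ((- c) ^ n * (- e') ^ n) = cst2 (1 + a1 * k2)" by (rule arg_cong)
  then have "cst2 ((- c) ^ n) * cst2 ((- e') ^ n) = 1 + cst2 a1 * cst2 k2"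
    by (simp only: cst2_simps(2-4))
  then have "1 = cst2 ((- c) ^ n) * cst2 ((- e') ^ n) - cst2 a1 * cst2 k2"
    by (rule eq_diff_eq[THEN iffD2, OF sym])
  also have "\<dots> = cst2 a1 * (b' * cst2 ((- e') ^ n) - cst2 k2) + v * (- (k * cst2 ((- e') ^ n)))"
    unfolding eq1 mult_minus_right by (simp only: algebra_simps) simp
  finally have "1 = cst2 a1 * (b' * cst2 ((- e') ^ n) - cst2 k2) + v * (- (k * cst2 ((- e') ^ n)))" .
  moreover have "b' * cst2 ((- e') ^ n) - cst2 k2 \<in> A" "- (k * cst2 ((- e') ^ n)) \<in> A"
    by (intro subrng_diff[OF subrng_A] subrng_mult[OF subrng_A] subrng_uminus[OF subrng_A] b'A k cst2_A)+
  ultimately show ?thesis by blast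
qed

lemma imp_plinth_principal:
  assumes "1 \<in> I1" shows "principal_in A (plinth \<psi>)"
proof -
  obtain \<alpha> \<beta> where ab: "\<alpha> \<in> A" "\<beta> \<in> A" "1 = cst2 a1 * \<alpha> + v * \<beta>"
    using v_comaximal[OF assms] by blast
  obtain b where b: "\<psi> b - b = \<epsilon> * v" using v_eps by blast
  define b1 where "b1 = X2 * \<alpha> + b * \<beta>"
  have "\<psi> b1 - b1 = u * \<alpha> + (\<psi> b - b) * \<beta>"
    using ab(1,2) by (simp add: b1_def psi_simps psi_X2 A_iff algebra_simps)
  also have "\<dots> = \<epsilon> * (cst2 a1 * \<alpha> + v * \<beta>)" unfolding b u_eps by (simp only: distrib_left mult_ac)
  also have "\<dots> = \<epsilon>" using ab(3) by simp
  finally have b1: "\<psi> b1 - b1 = \<epsilon>" .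
  have "plinth \<psi> = {\<epsilon> * w | w. w \<in> A}"
  proof (intro equalityI subsetI)
    fix x assume "x \<in> plinth \<psi>"
    then obtain c where c: "x = \<epsilon> * \<Delta> c" "x \<in> A" unfolding plinth_iff Delta_eq by blast
    then have "\<Delta> c \<in> A" using A_divisor eps_A eps_nz by blast
    with c(1) show "x \<in> {\<epsilon> * w | w. w \<in> A}" by blast
  next
    fix x assume "x \<in> {\<epsilon> * w | w. w \<in> A}"
    then obtain w where w: "x = \<epsilon> * w" "w \<in> A" by blast
    have "x = \<psi> (b1 * w) - b1 * w" unfolding w(1) b1[symmetric]
      using w(2) by (simp add: psi_simps A_iff algebra_simps)
    moreover have "x \<in> A" unfolding w(1) by (rule subrng_mult[OF subrng_A eps_A w(2)])
    ultimately show "x \<in> plinth \<psi>" unfolding plinth_iff by blast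
  qed
  then show ?thesis unfolding principal_in_def using eps_A by blast
qed

end

definition indep2 :: "'a::comm_ring_1 poly poly \<Rightarrow> 'a poly poly \<Rightarrow> bool" where
  "indep2 s t \<longleftrightarrow> (\<forall>h. subst2 s t h = 0 \<longrightarrow> h = 0)"

lemma indep2_swap: "indep2 s t \<Longrightarrow> indep2 t s"
  unfolding indep2_def by (metis subst2_swap swap_swap subst2_simps(1))

lemma indep2_scale:
  fixes s :: "'a::idom poly poly"
  assumes ind: "indep2 s t" and c: "c \<noteq> 0" and eq: "cst2 c * s' = s - ev cst2 t g"
  shows "indep2 s' t"
  unfolding indep2_def
proof (intro allI impI)
  fix h assume h: "subst2 s' t h = 0"
  let ?S = "range (subst2 (cst2 c * X1) X2)"
  have "\<exists>n. cst2 (c ^ n) * h \<in> ?S"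
    by (rule localize[OF subrng_range[OF rhom_subst2]]) (rule range_subst2_mem)+
  then obtain n k where k: "cst2 (c ^ n) * h = subst2 (cst2 c * X1) X2 k" by auto
  have "0 = subst2 s' t (cst2 (c ^ n) * h)" by (simp add: subst2_simps h)
  also have "\<dots> = subst2 (s - ev cst2 t g) t k"
    unfolding k subst2_subst2 by (simp add: subst2_simps eq)
  also have "\<dots> = subst2 s t (subst2 (X1 - lift2 g) X2 k)"
    unfolding subst2_subst2 by (simp add: subst2_simps subst2_lift2)
  finally have "subst2 (X1 - lift2 g) X2 k = 0" using ind unfolding indep2_def by metis
  then have "subst2 (X1 + lift2 g) X2 (subst2 (X1 - lift2 g) X2 k) = 0" by (simp add: subst2_simps)
  moreover have "subst2 (X1 + lift2 g) X2 (subst2 (X1 - lift2 g) X2 k) = k"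
    unfolding subst2_subst2 by (simp add: subst2_simps subst2_lift2 lift2_ev[symmetric])
  ultimately have "k = 0" by simp
  then show "h = 0" using k c by (simp add: subst2_simps)
qed

lemma subst2_diff_right:
  assumes S: "subrng S" "\<And>c. cst2 c \<in> S" "s \<in> S" "t \<in> S" "t' \<in> S"
  shows "\<exists>U\<in>S. subst2 s t W - subst2 s t' W = (t - t') * U"
proof (induction W rule: bi_induct)
  case (cst c)
  show ?case using subrng_0[OF S(1)] by (intro bexI[of _ 0]) auto
next
  case X1
  show ?case using subrng_0[OF S(1)] by (intro bexI[of _ 0]) auto
next
  case X2
  show ?case using subrng_1[OF S(1)] by (intro bexI[of _ 1]) auto
next
  case (add x y)
  then obtain U V where UV: "U \<in> S" "V \<in> S" "subst2 s t x - subst2 s t' x = (t - t') * U"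
    "subst2 s t y - subst2 s t' y = (t - t') * V" by blast
  have "subst2 s t (x + y) - subst2 s t' (x + y) = (subst2 s t x - subst2 s t' x) + (subst2 s t y - subst2 s t' y)"
    by (simp add: subst2_simps)
  also have "\<dots> = (t - t') * (U + V)" unfolding UV by (simp only: distrib_left)
  finally show ?case using subrng_add[OF S(1) UV(1,2)] by blast
next
  case (mult x y)
  then obtain U V where UV: "U \<in> S" "V \<in> S" "subst2 s t x - subst2 s t' x = (t - t') * U"
    "subst2 s t y - subst2 s t' y = (t - t') * V" by blast
  have "subst2 s t (x * y) - subst2 s t' (x * y)
      = (subst2 s t x - subst2 s t' x) * subst2 s t y + subst2 s t' x * (subst2 s t y - subst2 s t' y)"
    by (simp add: subst2_simps algebra_simps)
  also have "\<dots> = (t - t') * (U * subst2 s t y + subst2 s t' x * V)"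
    unfolding UV by (simp only: distrib_left mult_ac)
  finally show ?case
    by (rule bexI) (intro subrng_add[OF S(1)] subrng_mult[OF S(1)] UV subst2_mem S)
qed

context plane_split
begin

lemma indep_q1_N: "indep2 q1 N"
proof (rule indep2_scale[OF _ d_nz d_q1])
  show "indep2 q N" using subst2_q_N_inj unfolding indep2_def by blast
qed

definition P1 where "P1 = D0 + cst2 a1 * E0"

lemma subst2_P1: "subst2 q1 N P1 = cst2 (a1 ^ p) * r"
  unfolding P1_def subst2_simps subst2_D0 subst2_cst2 cst2_simps r_eq ..

definition lam :: "'a poly \<Rightarrow> 'a poly poly \<Rightarrow> 'a poly" where
  "lam h = ev (\<lambda>b. pcompose b h) [:0, 1:]"

lemma rhom_lam: "rhom (lam h)"
  unfolding lam_def by (rule rhom_ev[OF rhom_pcompose])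

lemmas lam_simps = rhom_simps[OF rhom_lam]

lemma lam_const: "lam h [:b:] = pcompose b h" and lam_X: "lam h [:0, 1:] = [:0, 1:]"
  by (simp_all add: lam_def ev_const[OF rhom_pcompose] ev_X[OF rhom_pcompose])

lemma subst2_lam: "subst2 s (ev cst2 s h) W = ev cst2 s (lam h W)"
proof (rule rhom_eqI[OF rhom_subst2 rhom_comp[OF rhom_eval_at rhom_lam]])
  have "lam h (cst2 c) = [:c:]" "lam h X1 = [:0, 1:]" "lam h X2 = h" for c
    by (simp_all add: cst2_def X1_def X2_def lam_const lam_X pcompose_pCons)
  then show "subst2 s (ev cst2 s h) (cst2 c) = ev cst2 s (lam h (cst2 c))"
    "subst2 s (ev cst2 s h) X1 = ev cst2 s (lam h X1)"
    "subst2 s (ev cst2 s h) X2 = ev cst2 s (lam h X2)" for c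
    by (simp_all add: ev_const[OF rhom_cst2] ev_X[OF rhom_cst2])
qed

definition c0 where "c0 = coeff \<tau> 0"

lemma c0_th1: "c0 = coeff th1 1"
  by (simp add: c0_def \<tau>_def coeff_pderiv)

lemma th1_coeff_mod:
  assumes one: "1 \<in> I1" and l: "prime l" "l dvd a1" and "i \<noteq> 1"
  shows "l dvd coeff th1 i"
proof (cases "p dvd i")
  case True
  then show ?thesis by (simp add: th1_p)
next
  case False
  then obtain j where j: "i = Suc j" "j \<noteq> 0" using assms(4) by (cases i) auto
  have "l dvd coeff (\<tau> - [:coeff \<tau> 0:]) j"
    using tau_const_mod[OF one l] by (simp only: const_poly_dvd_iff)
  then have "l dvd of_nat i * coeff th1 i"
    using j by (cases j) (simp_all add: \<tau>_def coeff_pderiv)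
  moreover obtain e :: 'a where "of_nat i * e = 1"
    using of_nat_unit_char[where 'b = 'a, of i] prime_p False by auto
  ultimately show ?thesis by (metis dvd_mult mult.assoc mult.commute mult_1)
qed

lemma P1_mod:
  assumes one: "1 \<in> I1" and l: "prime l" "l dvd a1"
  shows "cst2 l dvd P1 - (monom 1 p - lift2 [:0, c0 ^ p:])"
proof -
  have "l dvd coeff (th1p - [:0, c0 ^ p:]) i" for i
  proof (cases "i = 1")
    case True
    then show ?thesis using p_pos by (simp add: th1p_def coeff_map_poly c0_th1)
  next
    case False
    then have "coeff (th1p - [:0, c0 ^ p:]) i = coeff th1 i ^ p"
      using p_pos by (auto simp: th1p_def coeff_map_poly coeff_pCons split: nat.splits)
    moreover have "l dvd coeff th1 i ^ p"
      using th1_coeff_mod[OF one l False] p_pos by (metis dvd_power dvd_trans)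
    ultimately show ?thesis by simp
  qed
  then have "[:l:] dvd th1p - [:0, c0 ^ p:]" by (intro iffD2[OF const_poly_dvd_iff] allI)
  then have 1: "cst2 l dvd lift2 (th1p - [:0, c0 ^ p:])" by (simp only: cst2_dvd_lift2)
  have 2: "cst2 l dvd cst2 a1 * E0" using l(2) by (intro dvd_mult2) (simp add: cst2_dvd_cst2)
  have "P1 - (monom 1 p - lift2 [:0, c0 ^ p:]) = cst2 a1 * E0 - lift2 (th1p - [:0, c0 ^ p:])"
    unfolding lift2_simps P1_def D0_def by (simp add: lift2_def)
  then show ?thesis using dvd_diff[OF 2 1] by simp
qed

lemma c0_prime: "1 \<in> I1 \<Longrightarrow> prime l \<Longrightarrow> l dvd a1 \<Longrightarrow> \<not> l dvd c0"
proof
  assume one: "1 \<in> I1" and l: "prime l" "l dvd a1" "l dvd c0"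
  obtain e where "a1 dvd c0 * e - 1" using tau0_unit_mod[OF one] by (auto simp: c0_def)
  then have "l dvd c0 * e - 1" using l(2) dvd_trans by blast
  moreover have "l dvd c0 * e" using l(3) by simp
  ultimately have "l dvd 1" using dvd_diff_cancel by blast
  then show False using l(1) not_prime_unit by blast
qed

lemma lam_diff_dvd: "h - h' dvd lam h W - lam h' W"
  unfolding lam_def
  by (rule ev_dvd_diff2[OF rhom_pcompose rhom_pcompose])
    (simp_all add: pcompose_ev ev_diff_dvd[OF rhom_const_poly])

text \<open>Hensel lifting, one prime divisor of c at a time: modulo each of them P1 is linear in its
  second variable, so a solution h exists and can be corrected.\<close>

lemma solve_P1:
  assumes one: "1 \<in> I1"
    and "c \<noteq> 0" "\<And>l. prime l \<Longrightarrow> l dvd c \<Longrightarrow> l dvd a1"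
  shows "\<exists>h. [:c:] dvd lam h P1"
  using assms(2,3)
proof (induction c rule: prime_divisors_induct)
  case (unit x)
  then have "[:x:] dvd lam 0 P1" by (simp add: const_poly_dvd_iff unit_imp_dvd)
  then show ?case by blast
next
  case (factor l c)
  have la: "l dvd a1" by (rule factor.prems(2)[OF factor.hyps dvd_triv_left])
  have c: "c \<noteq> 0" using factor.prems(1) by auto
  have pc: "\<And>k. prime k \<Longrightarrow> k dvd c \<Longrightarrow> k dvd a1" using factor.prems(2) dvd_mult by blast
  obtain h where "[:c:] dvd lam h P1" using factor.IH[OF c pc] by blast
  then obtain s where s: "lam h P1 = [:c:] * s" by (rule dvdE)
  obtain e where "a1 dvd c0 * e - 1" using tau0_unit_mod[OF one] by (auto simp: c0_def)
  then have "l dvd c0 * e - 1" using la dvd_trans by blast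
  then have "l dvd (c0 * e) ^ p - 1 ^ p" by (rule dvd_diff_power)
  then obtain y where y: "(c0 * e) ^ p - 1 = l * y" by (auto elim: dvdE)
  obtain E where "P1 - (monom 1 p - lift2 [:0, c0 ^ p:]) = cst2 l * E"
    using P1_mod[OF one factor.hyps la] by (rule dvdE)
  then have P1: "P1 = monom 1 p - lift2 [:0, c0 ^ p:] + cst2 l * E" by (simp add: algebra_simps)
  have lamP: "lam k P1 = [:0, 1:] ^ p - [:c0 ^ p:] * k + [:l:] * lam k E" for k
  proof -
    have "lam k (monom 1 p) = [:0, 1:] ^ p"
      by (simp add: lam_def ev_monom[OF rhom_pcompose] pcompose_1)
    moreover have "lam k (lift2 [:0, c0 ^ p:]) = [:c0 ^ p:] * k"
      by (simp add: lift2_def lam_const pcompose_pCons mult.commute)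
    moreover have "lam k (cst2 l) = [:l:]" by (simp add: cst2_def lam_const)
    ultimately show ?thesis unfolding P1 lam_simps by (simp only:)
  qed
  define t where "t = [:e ^ p:] * s"
  define h' where "h' = h + [:c:] * t"
  have "[:c:] * t dvd lam h' E - lam h E" using lam_diff_dvd[of h' h E] by (simp add: h'_def)
  then obtain z where z: "lam h' E - lam h E = [:c:] * t * z" by (rule dvdE)
  have "lam h' P1 - lam h P1 = - ([:c0 ^ p:] * (h' - h)) + [:l:] * (lam h' E - lam h E)"
    unfolding lamP by (simp add: algebra_simps smult_diff_right)
  also have "\<dots> = [:c:] * ([:l:] * (t * z) - [:c0 ^ p:] * t)"
    unfolding z unfolding h'_def by (simp add: algebra_simps)
  finally have "lam h' P1 = [:c:] * (s + ([:l:] * (t * z) - [:c0 ^ p:] * t))"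
    unfolding s by (simp only: algebra_simps)
  moreover have "[:c0 ^ p:] * t = s + [:l:] * ([:y:] * s)"
  proof -
    have "c0 ^ p * e ^ p = 1 + l * y" using y by (simp add: power_mult_distrib algebra_simps)
    then have "[:c0 ^ p * e ^ p:] = [:1 + l * y:]" by (rule arg_cong)
    then have "[:c0 ^ p:] * [:e ^ p:] = 1 + [:l:] * [:y:]"
      by (simp only: rhom_add[OF rhom_const_poly] rhom_mult[OF rhom_const_poly] rhom_1[OF rhom_const_poly])
    then show ?thesis unfolding t_def by (metis (no_types, lifting) distrib_right mult.assoc mult_1)
  qed
  moreover have "s + ([:l:] * (t * z) - (s + [:l:] * ([:y:] * s))) = [:l:] * (t * z - [:y:] * s)"
    by (simp add: smult_diff_right mult.commute)
  ultimately have "lam h' P1 = [:c:] * ([:l:] * (t * z - [:y:] * s))" by (simp only:)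
  moreover have "[:c:] * ([:l:] * (t * z - [:y:] * s)) = [:l * c:] * (t * z - [:y:] * s)"
    by (simp add: mult.commute)
  ultimately have "[:l * c:] dvd lam h' P1" by (metis dvd_triv_left)
  then show ?case by blast
qed simp

text \<open>If h solves P1(Q, h(Q)) = 0 modulo a1^p, then N - h(q1) is divisible by a1^p, and the
  quotient N1 together with q1 generates A.\<close>

lemma imp_iso:
  assumes one: "1 \<in> I1" shows "\<exists>\<phi>. alg_iso_onto cst2 \<phi> A"
proof -
  have an: "a1 ^ p \<noteq> 0" using a1_nz by simp
  have "\<exists>h. [:a1 ^ p:] dvd lam h P1"
    by (rule solve_P1[OF one an]) (rule prime_dvd_power)
  then obtain h s where hs: "lam h P1 = [:a1 ^ p:] * s" by (auto elim!: dvdE simp del: mult_pCons_left)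
  define H where "H = ev cst2 q1 h"
  have H_C1: "H \<in> C1" unfolding H_def by (rule ev_mem[OF rhom_cst2 subrng_C1 C1_gens(1,2)])
  obtain U where U: "U \<in> C1" "subst2 q1 N P1 - subst2 q1 H P1 = (N - H) * U"
    using subst2_diff_right[OF subrng_C1 C1_gens H_C1] by blast
  have NH: "N - H \<noteq> 0"
  proof
    assume "N - H = 0"
    then have "subst2 q1 N (X2 - ev cst2 X1 h) = 0" by (simp add: subst2_simps ev_cst2_subst2 H_def)
    then have "X2 - ev cst2 X1 h = 0" using indep_q1_N unfolding indep2_def by blast
    then have eq: "X2 = ev cst2 X1 h" by simp
    then have "subst2 X1 0 X2 = subst2 X1 0 (ev cst2 X1 h)" by (rule arg_cong)
    then have "0 = ev cst2 X1 h" by (simp add: ev_cst2_subst2)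
    then show False using eq by (simp add: X2_def)
  qed
  have PH: "subst2 q1 H P1 = cst2 (a1 ^ p) * ev cst2 q1 s"
    unfolding H_def subst2_lam hs rhom_mult[OF rhom_eval_at] by (simp add: ev_const[OF rhom_cst2])
  have NHU: "(N - H) * U = cst2 (a1 ^ p) * (r - ev cst2 q1 s)"
    unfolding U(2)[symmetric] subst2_P1 PH by (simp only: right_diff_distrib)
  have U_prime: "\<not> cst2 l dvd U" if l: "prime l" "l dvd a1 ^ p" for l
  proof
    assume dvd: "cst2 l dvd U"
    have la: "l dvd a1" using l by (rule prime_dvd_power)
    obtain E where "P1 - (monom 1 p - lift2 [:0, c0 ^ p:]) = cst2 l * E"
      using P1_mod[OF one l(1) la] by (rule dvdE)
    then have P1: "P1 = monom 1 p - lift2 [:0, c0 ^ p:] + cst2 l * E" by (simp add: algebra_simps)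
    obtain z where z: "subst2 q1 N E - subst2 q1 H E = (N - H) * z"
      using subst2_diff_right[OF subrng_UNIV, of q1 N H E] by auto
    have mon: "subst2 q1 N (monom 1 p) = subst2 q1 H (monom 1 p)"
      by (simp add: subst2_ev ev_monom[OF rhom_eval_at] rhom_simps[OF rhom_eval_at])
    have lin: "subst2 q1 k (lift2 [:0, c0 ^ p:]) = cst2 (c0 ^ p) * k" for k
      by (simp add: subst2_lift2 ev_pCons[OF rhom_cst2] cst2_simps mult.commute)
    have "(N - H) * U = subst2 q1 N P1 - subst2 q1 H P1" using U(2) by simp
    also have "\<dots> = cst2 l * (subst2 q1 N E - subst2 q1 H E) - cst2 (c0 ^ p) * (N - H)"
      unfolding P1 subst2_simps mon lin subst2_cst2 by (simp only: algebra_simps)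
    also have "\<dots> = (N - H) * (cst2 l * z - cst2 (c0 ^ p))" unfolding z by (simp only: algebra_simps)
    finally have "U = cst2 l * z - cst2 (c0 ^ p)" using NH mult_left_cancel by blast
    then have "cst2 (c0 ^ p) = cst2 l * z - U" by simp
    then have "cst2 l dvd cst2 (c0 ^ p)" using dvd by (metis dvd_diff dvd_triv_left)
    then have "l dvd c0 ^ p" by (simp only: cst2_dvd_cst2)
    then have "l dvd c0" using l(1) by (metis prime_dvd_power)
    then show False using c0_prime[OF one l(1) la] by blast
  qed
  have "cst2 (a1 ^ p) dvd (N - H) * U" unfolding NHU by simp
  then have "cst2 (a1 ^ p) dvd N - H"
    using cancel_const[where e = cst2 and c = "a1 ^ p" and v = U and w = "N - H"]
      rhom_cst2 prime_elem_cst2 an U_prime by blast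
  then obtain N1 where N1: "N - H = cst2 (a1 ^ p) * N1" by (rule dvdE)
  have cn: "cst2 (a1 ^ p) \<noteq> 0" using an by simp
  have "cst2 (a1 ^ p) * (N1 * U) = cst2 (a1 ^ p) * (r - ev cst2 q1 s)"
    using NHU unfolding N1 by (simp only: mult.assoc)
  then have "N1 * U = r - ev cst2 q1 s" using cn mult_left_cancel by blast
  then have r: "r = N1 * U + ev cst2 q1 s" by simp
  have C1_A: "C1 \<subseteq> A" using C1_C A_eq unfolding C_def by blast
  have "cst2 (a1 ^ p) * N1 \<in> A"
    unfolding N1[symmetric] using N_A H_C1 C1_A by (intro subrng_diff[OF subrng_A]) auto
  then have N1_A: "N1 \<in> A" using A_cancel an by blast
  let ?M = "range (subst2 q1 N1)"
  have M: "subrng ?M" by (rule subrng_range[OF rhom_subst2])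
  note Mg = range_subst2_mem[where u = q1 and v = N1]
  have evM: "ev cst2 q1 k \<in> ?M" for k by (rule ev_mem[OF rhom_cst2 M Mg(1,2)])
  have "N = H + cst2 (a1 ^ p) * N1" using N1 by (simp add: algebra_simps)
  also have "\<dots> \<in> ?M" unfolding H_def by (intro subrng_add[OF M] subrng_mult[OF M] evM Mg)
  finally have N_M: "N \<in> ?M" .
  have C1_M: "subst2 q1 N k \<in> ?M" for k by (rule subst2_mem[OF M Mg(1,2) N_M])
  have "U \<in> ?M" using U(1) C1_M by (auto simp: C1_def)
  then have r_M: "r \<in> ?M" unfolding r
    by (intro subrng_add[OF M] subrng_mult[OF M] evM Mg)
  have "A = ?M"
  proof (intro equalityI subsetI)
    fix b assume "b \<in> A"
    then obtain W where "b = ev (subst2 q1 N) r W" unfolding A_eq val_def by auto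
    then show "b \<in> ?M" using ev_mem[OF rhom_subst2 M C1_M r_M] by simp
  next
    fix b assume "b \<in> ?M"
    then obtain k where "b = subst2 q1 N1 k" by auto
    then show "b \<in> A" using subst2_mem[OF subrng_A cst2_A q1_A N1_A] by simp
  qed
  moreover have "inj (subst2 q1 N1)"
  proof (rule injI)
    have "indep2 N1 q1"
      by (rule indep2_scale[OF indep2_swap[OF indep_q1_N] an, where g = h]) (use N1 in \<open>simp add: H_def\<close>)
    then have "indep2 q1 N1" by (rule indep2_swap)
    moreover fix x y assume "subst2 q1 N1 x = subst2 q1 N1 y"
    then have "subst2 q1 N1 (x - y) = 0" by (simp add: subst2_simps)
    ultimately have "x - y = 0" unfolding indep2_def by blast
    then show "x = y" by simp
  qed
  ultimately have "alg_iso_onto cst2 (subst2 q1 N1) A"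
    unfolding alg_iso_onto_def bij_betw_def by (simp add: subst2_simps)
  then show ?thesis by blast
qed

end

section \<open>Derivations\<close>

definition derivation :: "('b::comm_ring_1 \<Rightarrow> 'b) \<Rightarrow> bool" where
  "derivation \<delta> \<longleftrightarrow> (\<forall>x y. \<delta> (x + y) = \<delta> x + \<delta> y) \<and> (\<forall>x y. \<delta> (x * y) = \<delta> x * y + x * \<delta> y)"

lemma derivation_add: "derivation \<delta> \<Longrightarrow> \<delta> (x + y) = \<delta> x + \<delta> y"
  and derivation_mult: "derivation \<delta> \<Longrightarrow> \<delta> (x * y) = \<delta> x * y + x * \<delta> y"
  by (simp_all add: derivation_def)

lemma derivation_0: assumes "derivation \<delta>" shows "\<delta> 0 = 0"
  using derivation_add[OF assms, of 0 0] by simp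

lemma derivation_1: assumes "derivation \<delta>" shows "\<delta> 1 = 0"
  using derivation_mult[OF assms, of 1 1] by simp

lemma derivation_uminus: assumes "derivation \<delta>" shows "\<delta> (- x) = - \<delta> x"
  using derivation_add[OF assms, of x "-x"] derivation_0[OF assms]
  by (metis add.right_inverse minus_unique)

lemma derivation_diff: assumes "derivation \<delta>" shows "\<delta> (x - y) = \<delta> x - \<delta> y"
  using derivation_add[OF assms, of x "-y"] derivation_uminus[OF assms] by simp

lemma derivation_sum: assumes "derivation \<delta>" shows "\<delta> (sum f I) = (\<Sum>i\<in>I. \<delta> (f i))"
  by (induction I rule: infinite_finite_induct) (simp_all add: derivation_0[OF assms] derivation_add[OF assms])

lemma derivation_power: assumes "derivation \<delta>" shows "\<delta> (x ^ n) = of_nat n * x ^ (n - 1) * \<delta> x"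
proof (induction n)
  case (Suc n)
  have "\<delta> (x ^ Suc n) = \<delta> x * x ^ n + x * (of_nat n * x ^ (n - 1) * \<delta> x)"
    by (simp add: derivation_mult[OF assms] Suc)
  also have "\<dots> = of_nat (Suc n) * x ^ (Suc n - 1) * \<delta> x"
    by (cases n) (simp_all add: algebra_simps)
  finally show ?case .
qed (simp add: derivation_1[OF assms])

lemma derivation_power_char:
  fixes \<delta> :: "'b::comm_ring_1 \<Rightarrow> 'b"
  assumes "derivation \<delta>" shows "\<delta> (x ^ CHAR('b)) = 0"
  by (simp add: derivation_power[OF assms])

lemma derivation_pderiv: "derivation (pderiv :: 'b::idom poly \<Rightarrow> _)"
  by (simp add: derivation_def pderiv_add pderiv_mult algebra_simps)

lemma derivation_map_poly:
  assumes "derivation \<delta>" shows "derivation (map_poly \<delta>)"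
proof -
  have c: "coeff (map_poly \<delta> x) n = \<delta> (coeff x n)" for x n
    by (simp add: coeff_map_poly derivation_0[OF assms])
  show ?thesis
    unfolding derivation_def
  proof (intro conjI allI poly_eqI)
    show "coeff (map_poly \<delta> (x + y)) n = coeff (map_poly \<delta> x + map_poly \<delta> y) n" for x y n
      by (simp add: c derivation_add[OF assms])
    show "coeff (map_poly \<delta> (x * y)) n = coeff (map_poly \<delta> x * y + x * map_poly \<delta> y) n" for x y n
      by (simp add: c coeff_mult derivation_sum[OF assms] derivation_mult[OF assms] sum.distrib)
  qed
qed

lemma map_poly_derivation_pCons:
  "derivation \<delta> \<Longrightarrow> map_poly \<delta> (pCons c W) = pCons (\<delta> c) (map_poly \<delta> W)"
  by (simp add: map_poly_pCons derivation_0)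

lemma of_nat_power_char:
  assumes "prime CHAR('b::comm_ring_1)"
  shows "(of_nat n :: 'b) ^ CHAR('b) = of_nat n"
  using prime_gt_0_nat[OF assms] by (induction n) (simp_all add: add_power_char[OF assms] zero_power)

lemma prod_diff_mem_ideal:
  fixes x y :: "nat \<Rightarrow> 'b::comm_ring_1"
  assumes J: "0 \<in> J" "\<And>x y. x \<in> J \<Longrightarrow> y \<in> J \<Longrightarrow> x + y \<in> J" "\<And>x y. x \<in> J \<Longrightarrow> y * x \<in> J"
    and "\<And>i. i \<in> I \<Longrightarrow> x i - y i \<in> J"
  shows "prod x I - prod y I \<in> J"
  using assms(4)
proof (induction I rule: infinite_finite_induct)
  case (insert i I)
  have "prod x (insert i I) - prod y (insert i I)
      = prod x I * (x i - y i) + y i * (prod x I - prod y I)"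
    using insert.hyps by (simp add: algebra_simps)
  then show ?case using insert J(2,3) by simp
qed (use J in auto)

lemma rank_mod_ideal:
  fixes c e :: "nat \<Rightarrow> nat \<Rightarrow> 'b::comm_ring_1"
  assumes J: "0 \<in> J" "\<And>x y. x \<in> J \<Longrightarrow> y \<in> J \<Longrightarrow> x + y \<in> J" "\<And>x y. x \<in> J \<Longrightarrow> y * x \<in> J"
    and eq: "\<And>i k. i \<le> n \<Longrightarrow> k \<le> n \<Longrightarrow> (\<Sum>l<n. e i l * c k l) - (if i = k then 1 else 0) \<in> J"
  shows "1 \<in> J"
proof -
  define P where "P = mat (Suc n) (Suc n) (\<lambda>(i, l). if l < n then e i l else 0)"
  define Q where "Q = mat (Suc n) (Suc n) (\<lambda>(l, k). if l < n then c k l else 0)"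
  have PQ: "P \<in> carrier_mat (Suc n) (Suc n)" "Q \<in> carrier_mat (Suc n) (Suc n)"
    by (simp_all add: P_def Q_def)
  have "det Q = 0"
    unfolding det_def'[OF PQ(2)]
  proof (rule sum.neutral, rule ballI)
    fix s assume "s \<in> {s. s permutes {0..<Suc n}}"
    then have "s n < Suc n" by (auto dest: permutes_in_image[of s _ n])
    then have "Q $$ (n, s n) = 0" by (simp add: Q_def)
    then have "\<exists>i\<in>{0..<Suc n}. Q $$ (i, s i) = 0" by (intro bexI[of _ n]) auto
    then have "(\<Prod>i = 0..<Suc n. Q $$ (i, s i)) = 0" by (intro prod_zero) auto
    then show "signof s * (\<Prod>i = 0..<Suc n. Q $$ (i, s i)) = 0" by simp
  qed
  then have det0: "det (P * Q) = 0" using det_mult[OF PQ] by simp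
  have PQm: "P * Q \<in> carrier_mat (Suc n) (Suc n)" using PQ by simp
  have entry: "(P * Q) $$ (i, k) - (1\<^sub>m (Suc n)) $$ (i, k) \<in> J" if ik: "i < Suc n" "k < Suc n" for i k
  proof -
    have "(P * Q) $$ (i, k) = (\<Sum>l = 0..<Suc n. (if l < n then e i l else 0) * (if l < n then c k l else 0))"
      using ik PQ by (simp add: P_def Q_def scalar_prod_def)
    also have "\<dots> = (\<Sum>l<n. e i l * c k l)" by (simp add: atLeast0LessThan)
    finally show ?thesis using eq[of i k] ik by simp
  qed
  have sums: "sum f S \<in> J" if "\<And>s. s \<in> S \<Longrightarrow> f s \<in> J" for f :: "(nat \<Rightarrow> nat) \<Rightarrow> 'b" and S
    using that by (induction S rule: infinite_finite_induct) (auto intro: J)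
  have "det (P * Q) - det (1\<^sub>m (Suc n)) \<in> J"
    unfolding det_def'[OF PQm] det_def'[OF one_carrier_mat] sum_subtractf[symmetric]
      right_diff_distrib[symmetric]
  proof (intro sums J(3) prod_diff_mem_ideal J(1,2))
    fix s i assume "s \<in> {s. s permutes {0..<Suc n}}" "i \<in> {0..<Suc n}"
    then have "s i < Suc n" "i < Suc n" by (auto dest: permutes_in_image[of s _ i])
    then show "(P * Q) $$ (i, s i) - 1\<^sub>m (Suc n) $$ (i, s i) \<in> J" by (intro entry)
  qed
  then have "- 1 \<in> J" using det0 by simp
  then show ?thesis using J(3)[of "- 1" "- 1"] by simp
qed

inductive_set ring_gen :: "'b::comm_ring_1 set \<Rightarrow> 'b set" for S where
  gen: "s \<in> S \<Longrightarrow> s \<in> ring_gen S"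
| add: "x \<in> ring_gen S \<Longrightarrow> y \<in> ring_gen S \<Longrightarrow> x + y \<in> ring_gen S"
| mult: "x \<in> ring_gen S \<Longrightarrow> y \<in> ring_gen S \<Longrightarrow> x * y \<in> ring_gen S"

context plane_split
begin

definition rel where "rel = [:- P1, cst2 (a1 ^ p):]"

lemma val_rel: "val rel = 0"
  by (simp add: rel_def val_pCons val_const val_simps(1) subst2_simps subst2_P1)

lemma not_dvd_P1: "prime l \<Longrightarrow> l dvd a1 \<Longrightarrow> \<not> cst2 l dvd P1"
proof
  assume l: "prime l" "l dvd a1" "cst2 l dvd P1"
  have "cst2 l dvd cst2 a1 * E0" using l(2) by (intro dvd_mult2) (simp add: cst2_dvd_cst2)
  then have "cst2 l dvd D0" using l(3) unfolding P1_def by (metis dvd_add_left_iff)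
  then have "[:[:l:]:] dvd D0" by (simp only: cst2_def)
  then have "[:l:] dvd coeff D0 p" by (simp only: const_poly_dvd_iff[of "[:l:]"])
  then have "[:l:] dvd 1" using degree_D0 by simp
  moreover have "prime_elem [:l:]" using l(1) by (intro lift_prime_elem_poly) simp
  ultimately show False using prime_elem_not_unit by blast
qed

lemma kernel: assumes "val W = 0" shows "\<exists>W'. W = rel * W'"
proof -
  have an: "a1 ^ p \<noteq> 0" using a1_nz by simp
  have dr: "degree rel = 1" "rel \<noteq> 0" "coeff rel 1 = cst2 (a1 ^ p)" using an by (simp_all add: rel_def)
  obtain Q R where QR: "pseudo_divmod W rel = (Q, R)" by (cases "pseudo_divmod W rel")
  from pseudo_divmod[OF dr(2) QR] obtain k where
    k: "Polynomial.smult (cst2 (a1 ^ p) ^ k) W = rel * Q + R" and "R = 0 \<or> degree R < 1"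
    unfolding dr(1,3) by blast
  then have "degree R = 0" by auto
  then obtain b where b: "R = [:b:]" by (rule degree_eq_zeroE)
  have "val (Polynomial.smult (cst2 (a1 ^ p) ^ k) W) = 0"
    using assms ev_smult[OF rhom_subst2, of q1 N r] by (simp add: val_def)
  then have "subst2 q1 N b = 0" unfolding k val_simps val_rel b val_const by simp
  then have "b = 0" using indep_q1_N unfolding indep2_def by blast
  define m where "m = (a1 ^ p) ^ k"
  have mn: "m \<noteq> 0" using an by (simp add: m_def)
  have ml: "l dvd a1" if "prime l" "l dvd m" for l
    using that unfolding m_def by (metis prime_dvd_power)
  have k': "[:cst2 m:] * W = rel * Q" using k b \<open>b = 0\<close> by (simp add: m_def cst2_simps)
  have e: "rhom (\<lambda>x. [:cst2 x:])" by (rule rhom_comp[OF rhom_const_poly rhom_cst2])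
  have "[:cst2 m:] dvd Q * rel" using k' by (metis dvd_triv_left mult.commute)
  moreover have "\<not> [:cst2 l:] dvd rel" if "prime l" "l dvd m" for l
  proof
    assume "[:cst2 l:] dvd rel"
    then have "cst2 l dvd coeff rel 0" by (simp only: const_poly_dvd_iff[of "cst2 l"])
    then have "cst2 l dvd P1" by (simp add: rel_def)
    then show False using not_dvd_P1[OF that(1) ml[OF that]] by blast
  qed
  ultimately have "[:cst2 m:] dvd Q"
    using cancel_const[where e = "\<lambda>x. [:cst2 x:]" and c = m and v = rel and w = Q]
      e lift_prime_elem_poly[OF prime_elem_cst2] mn by blast
  then obtain Q' where "Q = [:cst2 m:] * Q'" by (rule dvdE)
  then have "[:cst2 m:] * W = [:cst2 m:] * (rel * Q')" using k' by (simp only: mult_ac)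
  moreover have "[:cst2 m:] \<noteq> 0" using mn by simp
  ultimately have "W = rel * Q'" using mult_left_cancel by blast
  then show ?thesis by blast
qed

definition adm :: "('a poly poly poly \<Rightarrow> 'a poly poly poly) \<Rightarrow> bool" where
  "adm D \<longleftrightarrow> derivation D \<and> at0 (val (D rel)) \<in> I1"

lemma adm_kernel:
  assumes "adm D" "val W = 0" shows "at0 (val (D W)) \<in> I1"
proof -
  obtain W' where W: "W = rel * W'" using kernel[OF assms(2)] by blast
  have "at0 (val (D W)) = at0 (val W') * at0 (val (D rel))"
    using assms(1) unfolding adm_def W
    by (simp add: derivation_mult val_simps val_rel at0_simps mult.commute)
  then show ?thesis using assms(1) I1_mult unfolding adm_def by simp
qed

lemma adm_congr:
  assumes "adm D" "val W = val W'" shows "at0 (val (D W)) - at0 (val (D W')) \<in> I1"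
proof -
  have "val (W - W') = 0" using assms(2) by (simp add: val_simps)
  from adm_kernel[OF assms(1) this] show ?thesis
    using assms(1) by (simp add: adm_def derivation_diff val_simps at0_simps)
qed

lemma adm_pderiv: "adm pderiv"
proof -
  have "pderiv rel = [:cst2 (a1 ^ p):]" by (simp add: rel_def pderiv_pCons)
  then have "at0 (val (pderiv rel)) = [:a1:] * [:a1 ^ (p - 1):]"
    using p_pos by (simp add: val_const at0_cst2 power_eq_if)
  then show ?thesis unfolding adm_def using derivation_pderiv I1_a1 by metis
qed

lemma derivation_cst2_map:
  assumes "derivation \<delta>"
  shows "map_poly \<delta> (cst2 c) = [:\<delta> [:c:]:]"
  by (simp add: cst2_def map_poly_derivation_pCons[OF assms])

lemma at0_subst2_a1: "at0 (subst2 q1 N (cst2 a1 * b)) \<in> I1"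
  using I1_a1 by (simp add: subst2_simps at0_simps at0_cst2 del: mult_pCons_left)

lemma map_poly_rel:
  assumes "derivation \<delta>" "\<delta> (cst2 (a1 ^ p)) = 0"
  shows "map_poly \<delta> rel = [:- \<delta> P1:]"
  by (simp add: rel_def map_poly_derivation_pCons[OF assms(1)] derivation_uminus[OF assms(1)] assms(2))

lemma adm_map_polyI:
  assumes "derivation \<delta>" "\<delta> (cst2 (a1 ^ p)) = 0" "at0 (subst2 q1 N (\<delta> P1)) \<in> I1"
  shows "adm (map_poly \<delta>)"
  unfolding adm_def map_poly_rel[OF assms(1,2)]
  using derivation_map_poly[OF assms(1)] I1_uminus[OF assms(3)]
  by (simp add: val_const subst2_simps)

lemma adm_Q: "adm (map_poly pderiv)"
proof (rule adm_map_polyI[OF derivation_pderiv])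
  show "pderiv (cst2 (a1 ^ p)) = 0" by (simp add: cst2_def pderiv_pCons)
  have "pderiv (monom (1 :: 'a poly) p) = 0"
    by (simp add: pderiv_monom of_nat_eq_0_iff_char_dvd)
  then have "pderiv P1 = cst2 a1 * pderiv E0"
    by (simp add: P1_def D0_def pderiv_add pderiv_diff pderiv_mult pderiv_smult pderiv_pCons cst2_def)
  then show "at0 (subst2 q1 N (pderiv P1)) \<in> I1" using at0_subst2_a1 by simp
qed

lemma pderiv_th1p: "pcompose (pderiv th1p) (monom 1 p) = \<tau> ^ p"
proof -
  have "map_poly (\<lambda>c. c ^ p) \<tau> = pderiv th1p"
  proof (rule poly_eqI)
    fix n
    have "(of_nat (Suc n) :: 'a) ^ p = of_nat (Suc n)"
      using of_nat_power_char[where 'b = 'a, of "Suc n"] prime_p by (simp del: of_nat_Suc)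
    then show "coeff (map_poly (\<lambda>c. c ^ p) \<tau>) n = coeff (pderiv th1p) n"
      using p_pos by (simp add: coeff_map_poly \<tau>_def coeff_pderiv th1p_def power_mult_distrib del: of_nat_Suc)
  qed
  then show ?thesis
    using ev_power_char[OF rhom_const_poly prime_p, of "[:0, 1:]" \<tau>]
    by (simp add: pcompose_ev[symmetric] monom_altdef)
qed

lemma at0_ev_X2: "at0 (ev cst2 (X2 ^ p) b) = pcompose b (monom 1 p)"
  by (simp add: lift2_pcompose_monom[symmetric] at0_lift2)

lemma adm_N: "adm (map_poly (map_poly pderiv))"
proof (rule adm_map_polyI[OF derivation_map_poly[OF derivation_pderiv]])
  let ?d = "map_poly pderiv :: 'a poly poly \<Rightarrow> _"
  have d: "derivation ?d" by (rule derivation_map_poly[OF derivation_pderiv])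
  have dc: "?d (cst2 c) = 0" for c
    by (simp add: derivation_cst2_map[OF derivation_pderiv] pderiv_pCons)
  then show "?d (cst2 (a1 ^ p)) = 0" .
  have dm: "?d (monom 1 p) = 0" by (simp add: map_poly_monom)
  have dP: "?d P1 = cst2 a1 * ?d E0 - lift2 (pderiv th1p)"
    unfolding P1_def D0_def derivation_add[OF d] derivation_diff[OF d] derivation_mult[OF d] dc dm
    by (simp add: map_poly_derivation_pCons[OF derivation_pderiv] lift2_def)
  have "cst2 a1 dvd ev cst2 N (pderiv th1p) - ev cst2 (X2 ^ p) (pderiv th1p)"
    by (intro ev_dvd_diff rhom_cst2 cst2_dvd_trans[OF a1_dvd_a N_mod])
  then obtain z where "ev cst2 N (pderiv th1p) - ev cst2 (X2 ^ p) (pderiv th1p) = cst2 a1 * z"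
    by (rule dvdE)
  then have "at0 (ev cst2 N (pderiv th1p) - ev cst2 (X2 ^ p) (pderiv th1p)) = at0 (cst2 a1 * z)"
    by (rule arg_cong)
  then have "at0 (ev cst2 N (pderiv th1p)) = [:a1:] * at0 z + \<tau> * \<tau> ^ (p - 1)"
    using p_pos unfolding at0_simps at0_cst2 at0_ev_X2 pderiv_th1p
    by (simp only: diff_eq_eq) (simp add: power_eq_if)
  then have "at0 (ev cst2 N (pderiv th1p)) \<in> I1" by (rule I1I)
  then show "at0 (subst2 q1 N (?d P1)) \<in> I1"
    using at0_subst2_a1[of "?d E0"] unfolding dP subst2_simps(6) subst2_lift2
    by (simp add: I1_diff)
qed

lemma at0_E0: "at0 (subst2 q1 N E0) \<in> I1"
proof -
  define K where "K = cst2 a ^ (p - 2) * F ^ (p - 1)"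
  define z where "z = - (cst2 d * K * X2)"
  have "N = X2 ^ p + cst2 a1 * z"
    unfolding N_def u_power z_def K_def cst2_a by (simp add: algebra_simps)
  then obtain y where y: "ev cst2 N th1p = ev cst2 (X2 ^ p) th1p
      + cst2 a1 * z * ev cst2 (X2 ^ p) (pderiv th1p) + (cst2 a1 * z)\<^sup>2 * y"
    using ev_taylor[OF rhom_cst2 subrng_UNIV, of "X2 ^ p" "cst2 a1 * z" th1p] by auto
  let ?a = "[:a1:]"
  have th: "pcompose th1p (monom 1 p) = th1 ^ p"
    using ev_power_char[OF rhom_const_poly prime_p, of "[:0, 1:]" th1]
    by (simp add: pcompose_ev[symmetric] th1p_def monom_altdef)
  have evN: "at0 (ev cst2 N th1p) = th1 ^ p + ?a * at0 z * \<tau> ^ p + (?a * at0 z)\<^sup>2 * at0 y"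
    unfolding y at0_simps at0_cst2 at0_ev_X2 pderiv_th1p th ..
  have q: "at0 q1 ^ p = th1 ^ p + (?a * at0 m0) ^ p"
    unfolding at0_q1 using add_power_char[OF primeR1, of th1 "?a * at0 m0"] by simp
  have "at0 (cst2 a1 ^ p * r) = at0 (q1 ^ p - ev cst2 N th1p + cst2 a1 * subst2 q1 N E0)"
    by (simp only: r_eq)
  then have e: "0 = at0 q1 ^ p - at0 (ev cst2 N th1p) + ?a * at0 (subst2 q1 N E0)"
    unfolding at0_simps at0_cst2 at0_r by (simp only: mult_zero_right)
  have "t = y' - x" if "0 = x - y' + t" for x y' t :: "'a poly"
    using that[symmetric] unfolding add_eq_0_iff by simp
  note this[OF e]
  also have "at0 (ev cst2 N th1p) - at0 q1 ^ p
      = ?a * at0 z * \<tau> ^ p + (?a * at0 z)\<^sup>2 * at0 y - (?a * at0 m0) ^ p"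
    unfolding evN q by simp
  also have "\<dots> = ?a * (\<tau> * (at0 z * \<tau> ^ (p - 1)) + ?a * ((at0 z)\<^sup>2 * at0 y)
      - ?a * (?a ^ (p - 2) * at0 m0 ^ p))"
  proof -
    have "p = Suc (p - 1)" using p_pos by simp
    then have "\<tau> ^ p = \<tau> ^ Suc (p - 1)" by (rule arg_cong)
    then have 1: "\<tau> ^ p = \<tau> * \<tau> ^ (p - 1)" by (simp only: power_Suc)
    have "p = Suc (Suc (p - 2))" using p2 by simp
    then have "?a ^ p = ?a ^ Suc (Suc (p - 2))" by (rule arg_cong)
    then have 2: "?a ^ p = ?a * (?a * ?a ^ (p - 2))" by (simp only: power_Suc)
    have "b * x * (t * k) + (b * x)\<^sup>2 * y' - b * (b * h) * c = b * (t * (x * k) + b * (x\<^sup>2 * y') - b * (h * c))"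
      for b x t k y' h c :: "'a poly"
      by (simp add: algebra_simps power2_eq_square)
    then show ?thesis unfolding power_mult_distrib[of ?a "at0 m0" p] 1 2 by blast
  qed
  finally have "?a * at0 (subst2 q1 N E0) = ?a * (\<tau> * (at0 z * \<tau> ^ (p - 1)) + ?a * ((at0 z)\<^sup>2 * at0 y)
      - ?a * (?a ^ (p - 2) * at0 m0 ^ p))" .
  moreover have "?a \<noteq> 0" using a1_nz by simp
  ultimately have "at0 (subst2 q1 N E0) = \<tau> * (at0 z * \<tau> ^ (p - 1)) + ?a * ((at0 z)\<^sup>2 * at0 y)
      - ?a * (?a ^ (p - 2) * at0 m0 ^ p)"
    using mult_left_cancel by blast
  then show ?thesis by (simp only:) (intro I1_diff I1_add I1_tau I1_a1)
qed

lemma adm_R: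
  fixes \<delta> :: "'a \<Rightarrow> 'a"
  assumes \<delta>: "derivation \<delta>"
  shows "adm (map_poly (map_poly (map_poly \<delta>)))"
proof (rule adm_map_polyI[OF derivation_map_poly[OF derivation_map_poly[OF \<delta>]]])
  let ?d1 = "map_poly \<delta>"
  let ?d = "map_poly (map_poly \<delta>)"
  have d1: "derivation ?d1" by (rule derivation_map_poly[OF \<delta>])
  have d: "derivation ?d" by (rule derivation_map_poly[OF d1])
  have pw: "\<delta> (c ^ p) = 0" for c using derivation_power_char[OF \<delta>, of c] by simp
  have dc: "?d (cst2 c) = cst2 (\<delta> c)" for c
    unfolding derivation_cst2_map[OF d1]
    by (simp add: map_poly_derivation_pCons[OF \<delta>] derivation_0[OF \<delta>] cst2_def)
  show "?d (cst2 (a1 ^ p)) = 0" unfolding dc pw by simp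
  have dm: "?d (monom 1 p) = 0"
    using derivation_0[OF d1] derivation_1[OF d1] by (simp add: map_poly_monom)
  have "?d1 th1p = 0"
    by (rule poly_eqI) (use p_pos in \<open>simp add: coeff_map_poly derivation_0[OF \<delta>] th1p_def pw\<close>)
  then have "?d [:th1p:] = 0" by (simp add: map_poly_derivation_pCons[OF d1])
  then have dP: "?d P1 = cst2 (\<delta> a1) * E0 + cst2 a1 * ?d E0"
    unfolding P1_def D0_def derivation_add[OF d] derivation_diff[OF d] derivation_mult[OF d] dc dm
    by simp
  have "at0 (subst2 q1 N (cst2 (\<delta> a1) * E0)) \<in> I1"
    unfolding subst2_simps at0_simps by (rule I1_mult[OF at0_E0])
  then show "at0 (subst2 q1 N (?d P1)) \<in> I1"
    using at0_subst2_a1[of "?d E0"] unfolding dP subst2_simps(3) at0_simps(3) by (rule I1_add)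
qed

lemma chain_rule:
  fixes n :: nat and z :: "nat \<Rightarrow> 'a poly poly"
  assumes \<phi>: "rhom \<phi>" "\<And>b. \<phi> b \<in> A"
    and K: "\<And>c. c \<in> K \<Longrightarrow> \<phi> (cst2 c) = cst2 c"
    and Ds: "\<And>D. D \<in> Ds \<Longrightarrow> adm D" "\<And>D c. D \<in> Ds \<Longrightarrow> c \<in> K \<Longrightarrow> D [:cst2 c:] = 0"
    and Z: "\<And>l. l < n \<Longrightarrow> val (Z l) = \<phi> (z l)"
    and "b \<in> ring_gen (cst2 ` K \<union> z ` {..<n})"
  shows "\<exists>cf. \<forall>W. \<forall>D\<in>Ds. val W = \<phi> b \<longrightarrow>
    at0 (val (D W)) - (\<Sum>l<n. at0 (val (D (Z l))) * cf l) \<in> I1"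
  using assms(7)
proof (induction rule: ring_gen.induct)
  case (gen s)
  then consider c where "s = cst2 c" "c \<in> K" | l where "s = z l" "l < n" by auto
  then show ?case
  proof cases
    case 1
    show ?thesis
    proof (intro exI[of _ "\<lambda>_. 0"] allI ballI impI)
      fix W D assume D: "D \<in> Ds" and W: "val W = \<phi> s"
      have "val W = val [:cst2 c:]" using W 1 K by (simp add: val_const)
      from adm_congr[OF Ds(1)[OF D] this]
      show "at0 (val (D W)) - (\<Sum>l<n. at0 (val (D (Z l))) * 0) \<in> I1"
        using Ds(2)[OF D 1(2)] by (simp add: val_simps)
    qed
  next
    case 2
    show ?thesis
    proof (intro exI[of _ "\<lambda>k. if k = l then 1 else 0"] allI ballI impI)
      fix W D assume D: "D \<in> Ds" and W: "val W = \<phi> s"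
      have "val W = val (Z l)" using W 2 Z by simp
      from adm_congr[OF Ds(1)[OF D] this]
      show "at0 (val (D W)) - (\<Sum>k<n. at0 (val (D (Z k))) * (if k = l then 1 else 0)) \<in> I1"
        using 2 by (simp add: if_distrib sum.delta cong: if_cong)
    qed
  qed
next
  case (add x y)
  obtain f1 where f1: "\<And>W D. D \<in> Ds \<Longrightarrow> val W = \<phi> x \<Longrightarrow>
      at0 (val (D W)) - (\<Sum>l<n. at0 (val (D (Z l))) * f1 l) \<in> I1" using add.IH(1) by blast
  obtain f2 where f2: "\<And>W D. D \<in> Ds \<Longrightarrow> val W = \<phi> y \<Longrightarrow>
      at0 (val (D W)) - (\<Sum>l<n. at0 (val (D (Z l))) * f2 l) \<in> I1" using add.IH(2) by blast
  obtain W1 W2 where W12: "val W1 = \<phi> x" "val W2 = \<phi> y"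
    using \<phi>(2)[of x] \<phi>(2)[of y] unfolding A_eq by auto
  show ?case
  proof (intro exI[of _ "\<lambda>l. f1 l + f2 l"] allI ballI impI)
    fix W D assume D: "D \<in> Ds" and W: "val W = \<phi> (x + y)"
    have dD: "derivation D" using Ds(1)[OF D] by (simp add: adm_def)
    have "val W = val (W1 + W2)" using W W12 by (simp add: val_simps rhom_add[OF \<phi>(1)])
    from adm_congr[OF Ds(1)[OF D] this]
    have 1: "at0 (val (D W)) - (at0 (val (D W1)) + at0 (val (D W2))) \<in> I1"
      by (simp add: derivation_add[OF dD] val_simps at0_simps)
    have eq: "at0 (val (D W)) - (\<Sum>l<n. at0 (val (D (Z l))) * (f1 l + f2 l))
      = (at0 (val (D W)) - (at0 (val (D W1)) + at0 (val (D W2))))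
      + (at0 (val (D W1)) - (\<Sum>l<n. at0 (val (D (Z l))) * f1 l))
      + (at0 (val (D W2)) - (\<Sum>l<n. at0 (val (D (Z l))) * f2 l))"
      by (simp add: distrib_left sum.distrib)
    show "at0 (val (D W)) - (\<Sum>l<n. at0 (val (D (Z l))) * (f1 l + f2 l)) \<in> I1"
      unfolding eq by (rule I1_add[OF I1_add[OF 1 f1[OF D W12(1)]] f2[OF D W12(2)]])
  qed
next
  case (mult x y)
  obtain f1 where f1: "\<And>W D. D \<in> Ds \<Longrightarrow> val W = \<phi> x \<Longrightarrow>
      at0 (val (D W)) - (\<Sum>l<n. at0 (val (D (Z l))) * f1 l) \<in> I1" using mult.IH(1) by blast
  obtain f2 where f2: "\<And>W D. D \<in> Ds \<Longrightarrow> val W = \<phi> y \<Longrightarrow>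
      at0 (val (D W)) - (\<Sum>l<n. at0 (val (D (Z l))) * f2 l) \<in> I1" using mult.IH(2) by blast
  obtain W1 W2 where W12: "val W1 = \<phi> x" "val W2 = \<phi> y"
    using \<phi>(2)[of x] \<phi>(2)[of y] unfolding A_eq by auto
  let ?x = "at0 (\<phi> x)" and ?y = "at0 (\<phi> y)"
  show ?case
  proof (intro exI[of _ "\<lambda>l. f1 l * ?y + f2 l * ?x"] allI ballI impI)
    fix W D assume D: "D \<in> Ds" and W: "val W = \<phi> (x * y)"
    have dD: "derivation D" using Ds(1)[OF D] by (simp add: adm_def)
    have "val W = val (W1 * W2)" using W W12 by (simp add: val_simps rhom_mult[OF \<phi>(1)])
    from adm_congr[OF Ds(1)[OF D] this]
    have 1: "at0 (val (D W)) - (at0 (val (D W1)) * ?y + ?x * at0 (val (D W2))) \<in> I1"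
      by (simp add: derivation_mult[OF dD] val_simps at0_simps W12)
    have s: "(\<Sum>l<n. at0 (val (D (Z l))) * (f1 l * ?y + f2 l * ?x))
      = ?y * (\<Sum>l<n. at0 (val (D (Z l))) * f1 l) + ?x * (\<Sum>l<n. at0 (val (D (Z l))) * f2 l)"
      by (simp only: distrib_left sum.distrib sum_distrib_left) (simp only: mult_ac)
    have eq: "at0 (val (D W)) - (\<Sum>l<n. at0 (val (D (Z l))) * (f1 l * ?y + f2 l * ?x))
      = (at0 (val (D W)) - (at0 (val (D W1)) * ?y + ?x * at0 (val (D W2))))
      + ?y * (at0 (val (D W1)) - (\<Sum>l<n. at0 (val (D (Z l))) * f1 l))
      + ?x * (at0 (val (D W2)) - (\<Sum>l<n. at0 (val (D (Z l))) * f2 l))"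
      unfolding s by (simp only: algebra_simps)
    show "at0 (val (D W)) - (\<Sum>l<n. at0 (val (D (Z l))) * (f1 l * ?y + f2 l * ?x)) \<in> I1"
      unfolding eq by (rule I1_add[OF I1_add[OF 1 I1_mult[OF f1[OF D W12(1)]]] I1_mult[OF f2[OF D W12(2)]]])
  qed
qed

text \<open>The m + 3 coordinates of the presentation of A admit dual derivations modulo I1 at the point
  x1 = 0, while a polynomial ring in m + 2 variables over the scalars has only m + 2 of them.\<close>

lemma iso_imp:
  fixes m :: nat and \<rho> :: "nat \<Rightarrow> 'a" and \<delta> :: "nat \<Rightarrow> 'a \<Rightarrow> 'a"
  assumes \<phi>: "rhom \<phi>" "range \<phi> = A"
    and K: "\<And>c. c \<in> K \<Longrightarrow> \<phi> (cst2 c) = cst2 c"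
    and \<delta>: "\<And>j. j < m \<Longrightarrow> derivation (\<delta> j)" "\<And>j c. j < m \<Longrightarrow> c \<in> K \<Longrightarrow> \<delta> j c = 0"
      "\<And>i j. i < m \<Longrightarrow> j < m \<Longrightarrow> \<delta> j (\<rho> i) = (if i = j then 1 else 0)"
    and gen: "ring_gen (K \<union> \<rho> ` {..<m}) = UNIV"
  shows "1 \<in> I1"
proof -
  define z where "z l = (if l = 0 then X1 else if l = 1 then X2 else cst2 (\<rho> (l - 2)))" for l :: nat
  define co where "co k = (if k = 0 then [:0, 1:] else if k = 1 then [:X1:] else if k = 2 then [:X2:]
    else [:cst2 (\<rho> (k - 3)):])" for k :: nat
  define D where "D i = (if i = 0 then pderiv else if i = 1 then map_poly pderiv
    else if i = 2 then map_poly (map_poly pderiv)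
    else map_poly (map_poly (map_poly (\<delta> (i - 3)))))" for i :: nat
  define n where "n = m + 2"
  have \<phi>A: "\<phi> b \<in> A" for b using \<phi>(2) by blast
  define Z where "Z l = (SOME W. val W = \<phi> (z l))" for l
  have Z: "val (Z l) = \<phi> (z l)" for l
    unfolding Z_def by (rule someI_ex) (use \<phi>A[of "z l"] in \<open>auto simp: A_eq\<close>)
  have adm: "adm (D i)" if "i \<le> n" for i
    using that \<delta>(1)[of "i - 3"] adm_pderiv adm_Q adm_N adm_R[of "\<delta> (i - 3)"]
    by (auto simp: D_def n_def)
  have DK: "D i [:cst2 c:] = 0" if "i \<le> n" "c \<in> K" for i c
  proof (cases "i < 3")
    case True
    then have "i = 0 \<or> i = 1 \<or> i = 2" by auto
    then show ?thesis by (auto simp: D_def cst2_def pderiv_pCons map_poly_pCons)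
  next
    case False
    then have j: "i - 3 < m" using that by (simp add: n_def)
    have "\<delta> (i - 3) c = 0" "\<delta> (i - 3) 0 = 0"
      using \<delta>(2)[OF j that(2)] derivation_0[OF \<delta>(1)[OF j]] by simp_all
    then show ?thesis using False by (simp add: D_def cst2_def map_poly_pCons)
  qed
  have Dco: "D i (co k) = (if i = k then 1 else 0)" if ik: "i \<le> n" "k \<le> n" for i k
  proof -
    have "\<delta> (i - 3) 0 = 0" "\<delta> (i - 3) 1 = 0" if "i \<ge> 3"
      using that ik derivation_0[OF \<delta>(1)] derivation_1[OF \<delta>(1)] by (simp_all add: n_def)
    moreover have "\<delta> (i - 3) (\<rho> (k - 3)) = (if i = k then 1 else 0)" if "i \<ge> 3" "k \<ge> 3"
      using that ik \<delta>(3)[of "k - 3" "i - 3"] by (auto simp: n_def)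
    ultimately show ?thesis
      by (auto simp: D_def co_def X1_def X2_def cst2_def pderiv_pCons map_poly_pCons one_pCons)
  qed
  have genB: "b \<in> ring_gen (cst2 ` K \<union> z ` {..<n})" for b
  proof (induction b rule: bi_induct)
    case (cst c)
    have "c \<in> ring_gen (K \<union> \<rho> ` {..<m})" using gen by simp
    then show ?case
    proof (induction rule: ring_gen.induct)
      case (gen s)
      show ?case
      proof (rule ring_gen.gen)
        consider "s \<in> K" | j where "s = \<rho> j" "j < m" using gen by auto
        then show "cst2 s \<in> cst2 ` K \<union> z ` {..<n}"
        proof cases
          case 2
          then have "cst2 s = z (j + 2)" by (simp add: z_def)
          then show ?thesis using 2 by (auto simp: n_def)
        qed simp
      qed
    qed (auto simp: cst2_simps intro: ring_gen.add ring_gen.mult)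
  next
    case X1
    have "X1 = z 0" by (simp add: z_def)
    then show ?case by (intro ring_gen.gen UnI2) (auto simp: n_def)
  next
    case X2
    have "X2 = z 1" by (simp add: z_def)
    then show ?case by (intro ring_gen.gen UnI2) (auto simp: n_def)
  qed (auto intro: ring_gen.add ring_gen.mult)
  define s where "s k = (SOME s. \<phi> s = val (co k))" for k
  have s: "\<phi> (s k) = val (co k)" for k
  proof -
    have "val (co k) \<in> range \<phi>" unfolding \<phi>(2) A_eq by (rule rangeI)
    then have "\<exists>s. \<phi> s = val (co k)" by auto
    then show ?thesis unfolding s_def by (rule someI_ex)
  qed
  have "\<forall>k. \<exists>cf. \<forall>W. \<forall>E\<in>D ` {..n}. val W = \<phi> (s k) \<longrightarrow>
      at0 (val (E W)) - (\<Sum>l<n. at0 (val (E (Z l))) * cf l) \<in> I1"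
    by (rule allI, rule chain_rule[OF \<phi>(1) \<phi>A K _ _ Z genB]) (use adm DK in auto)
  from choice[OF this] obtain cf where cf: "\<And>k W E. E \<in> D ` {..n} \<Longrightarrow> val W = \<phi> (s k) \<Longrightarrow>
      at0 (val (E W)) - (\<Sum>l<n. at0 (val (E (Z l))) * cf k l) \<in> I1" by blast
  show ?thesis
  proof (rule rank_mod_ideal[OF I1_0 I1_add I1_mult])
    fix i k :: nat assume ik: "i \<le> n" "k \<le> n"
    have "at0 (val (D i (co k))) - (\<Sum>l<n. at0 (val (D i (Z l))) * cf k l) \<in> I1"
      by (rule cf) (use ik s in auto)
    moreover have "at0 (val (D i (co k))) = (if i = k then 1 else 0)"
      by (simp add: Dco[OF ik] val_simps at0_simps)
    ultimately show "(\<Sum>l<n. at0 (val (D i (Z l))) * cf k l) - (if i = k then 1 else 0) \<in> I1"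
      using I1_uminus by fastforce
  qed
qed

end

section \<open>Partial derivatives of multivariate polynomials\<close>

lemma poly_mapping_single_induct [case_names single add]:
  fixes x :: "'b \<Rightarrow>\<^sub>0 'c::comm_monoid_add"
  assumes "\<And>k c. P (Poly_Mapping.single k c)" "\<And>x y. P x \<Longrightarrow> P y \<Longrightarrow> P (x + y)"
  shows "P x"
proof -
  have x: "x = (\<Sum>k\<in>Poly_Mapping.keys x. Poly_Mapping.single k (Poly_Mapping.lookup x k))"
    by (rule poly_mapping_eqI)
      (auto simp: lookup_sum lookup_single when_def sum.delta' in_keys_iff)
  have "P (\<Sum>k\<in>S. Poly_Mapping.single k (Poly_Mapping.lookup x k))" if "finite S" for S
    using that
  proof (induction S)
    case empty
    show ?case using assms(1)[of undefined 0] by simp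
  qed (simp add: assms)
  then show ?thesis by (subst x) simp
qed

definition partial :: "nat \<Rightarrow> ((nat \<Rightarrow>\<^sub>0 nat) \<Rightarrow>\<^sub>0 'k::comm_ring_1) \<Rightarrow> ((nat \<Rightarrow>\<^sub>0 nat) \<Rightarrow>\<^sub>0 'k)" where
  "partial j x = Abs_poly_mapping (\<lambda>\<mu>. of_nat (Poly_Mapping.lookup \<mu> j + 1)
    * Poly_Mapping.lookup x (\<mu> + Poly_Mapping.single j 1))"

lemma lookup_partial: "Poly_Mapping.lookup (partial j x) \<mu>
  = of_nat (Poly_Mapping.lookup \<mu> j + 1) * Poly_Mapping.lookup x (\<mu> + Poly_Mapping.single j 1)"
proof -
  have "finite {\<mu>. Poly_Mapping.lookup x (\<mu> + Poly_Mapping.single j 1) \<noteq> 0}"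
    using finite_vimageI[OF finite_lookup[of x], of "\<lambda>\<mu>. \<mu> + Poly_Mapping.single j 1"]
    by (simp add: vimage_def inj_def)
  then have "finite {\<mu>. of_nat (Poly_Mapping.lookup \<mu> j + 1)
      * Poly_Mapping.lookup x (\<mu> + Poly_Mapping.single j 1) \<noteq> 0}"
    by (rule rev_finite_subset) auto
  then show ?thesis unfolding partial_def by (simp add: Abs_poly_mapping_inverse)
qed

lemma partial_add: "partial j (x + y) = partial j x + partial j y"
  by (rule poly_mapping_eqI) (simp add: lookup_partial lookup_add algebra_simps)

lemma minus_plus_single:
  fixes \<mu> :: "nat \<Rightarrow>\<^sub>0 nat"
  assumes "Poly_Mapping.lookup \<mu> j > 0"
  shows "\<mu> - Poly_Mapping.single j 1 + Poly_Mapping.single j 1 = \<mu>"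
  using assms by (intro poly_mapping_eqI) (auto simp: lookup_add lookup_minus lookup_single when_def)

lemma partial_single:
  "partial j (Poly_Mapping.single \<mu> c)
    = Poly_Mapping.single (\<mu> - Poly_Mapping.single j 1) (of_nat (Poly_Mapping.lookup \<mu> j) * c)"
proof (rule poly_mapping_eqI)
  fix \<nu> :: "nat \<Rightarrow>\<^sub>0 nat"
  let ?e = "Poly_Mapping.single j (1::nat)"
  show "Poly_Mapping.lookup (partial j (Poly_Mapping.single \<mu> c)) \<nu>
    = Poly_Mapping.lookup (Poly_Mapping.single (\<mu> - ?e) (of_nat (Poly_Mapping.lookup \<mu> j) * c)) \<nu>"
  proof (cases "\<mu> = \<nu> + ?e")
    case True
    then show ?thesis by (simp add: lookup_partial lookup_add)
  next
    case False
    have "Poly_Mapping.lookup \<mu> j = 0" if "\<mu> - ?e = \<nu>"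
      using minus_plus_single[of \<mu> j] that False by auto
    then show ?thesis using False by (auto simp: lookup_partial lookup_single when_def)
  qed
qed

lemma partial_mult_single:
  "partial j (Poly_Mapping.single \<mu> c * Poly_Mapping.single \<nu> e)
    = partial j (Poly_Mapping.single \<mu> c) * Poly_Mapping.single \<nu> e
      + Poly_Mapping.single \<mu> c * partial j (Poly_Mapping.single \<nu> e)"
proof -
  let ?e = "Poly_Mapping.single j (1::nat)"
  have 1: "Poly_Mapping.single (\<mu> - ?e + \<nu>) (of_nat (Poly_Mapping.lookup \<mu> j) * c * e)
      = Poly_Mapping.single (\<mu> + \<nu> - ?e) (of_nat (Poly_Mapping.lookup \<mu> j) * c * e)"
  proof (cases "Poly_Mapping.lookup \<mu> j = 0")
    case False
    then have "\<mu> - ?e + \<nu> = \<mu> + \<nu> - ?e"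
      by (intro poly_mapping_eqI) (auto simp: lookup_add lookup_minus lookup_single when_def)
    then show ?thesis by simp
  qed simp
  have 2: "Poly_Mapping.single (\<mu> + (\<nu> - ?e)) (c * (of_nat (Poly_Mapping.lookup \<nu> j) * e))
      = Poly_Mapping.single (\<mu> + \<nu> - ?e) (c * (of_nat (Poly_Mapping.lookup \<nu> j) * e))"
  proof (cases "Poly_Mapping.lookup \<nu> j = 0")
    case False
    then have "\<mu> + (\<nu> - ?e) = \<mu> + \<nu> - ?e"
      by (intro poly_mapping_eqI) (auto simp: lookup_add lookup_minus lookup_single when_def)
    then show ?thesis by simp
  qed simp
  show ?thesis
    unfolding mult_single partial_single 1 2 single_add[symmetric]
    by (simp add: lookup_add algebra_simps)
qed

lemma partial_mult: "partial j (x * y) = partial j x * y + x * partial j y"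
proof (induction x rule: poly_mapping_single_induct)
  case (single \<mu> c)
  show ?case
    by (induction y rule: poly_mapping_single_induct)
      (simp_all add: partial_mult_single partial_add algebra_simps)
qed (simp add: partial_add algebra_simps)

lemma keys_add_nat:
  fixes \<mu> \<nu> :: "nat \<Rightarrow>\<^sub>0 nat"
  shows "Poly_Mapping.keys (\<mu> + \<nu>) = Poly_Mapping.keys \<mu> \<union> Poly_Mapping.keys \<nu>"
  by (auto simp: in_keys_iff lookup_add)

lemma kpolys_add: "x \<in> kpolys m \<Longrightarrow> y \<in> kpolys m \<Longrightarrow> x + y \<in> kpolys m"
  using Poly_Mapping.keys_add[of x y] unfolding kpolys_def by blast

lemma kpolys_mult: "x \<in> kpolys m \<Longrightarrow> y \<in> kpolys m \<Longrightarrow> x * y \<in> kpolys m"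
  unfolding kpolys_def
proof (intro CollectI ballI)
  fix \<mu>
  assume xy: "x \<in> {p. \<forall>\<mu>\<in>Poly_Mapping.keys p. Poly_Mapping.keys \<mu> \<subseteq> {..<m}}"
    "y \<in> {p. \<forall>\<mu>\<in>Poly_Mapping.keys p. Poly_Mapping.keys \<mu> \<subseteq> {..<m}}"
  assume "\<mu> \<in> Poly_Mapping.keys (x * y)"
  then obtain \<alpha> \<beta> where "\<mu> = \<alpha> + \<beta>" "\<alpha> \<in> Poly_Mapping.keys x" "\<beta> \<in> Poly_Mapping.keys y"
    using keys_mult[of x y] by blast
  then show "Poly_Mapping.keys \<mu> \<subseteq> {..<m}" using xy by (simp add: keys_add_nat)
qed

lemma kpolys_partial: "x \<in> kpolys m \<Longrightarrow> partial j x \<in> kpolys m"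
  unfolding kpolys_def
proof (intro CollectI ballI)
  fix \<mu>
  assume x: "x \<in> {p. \<forall>\<mu>\<in>Poly_Mapping.keys p. Poly_Mapping.keys \<mu> \<subseteq> {..<m}}"
  assume "\<mu> \<in> Poly_Mapping.keys (partial j x)"
  then have "\<mu> + Poly_Mapping.single j 1 \<in> Poly_Mapping.keys x"
    unfolding in_keys_iff lookup_partial by auto
  then have "Poly_Mapping.keys (\<mu> + Poly_Mapping.single j 1) \<subseteq> {..<m}" using x by blast
  then show "Poly_Mapping.keys \<mu> \<subseteq> {..<m}" by (simp add: keys_add_nat)
qed

lemma kpolys_single: "Poly_Mapping.keys \<mu> \<subseteq> {..<m} \<Longrightarrow> Poly_Mapping.single \<mu> c \<in> kpolys m"
  unfolding kpolys_def by simp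

lemma kpoly_derivations:
  fixes \<Phi> :: "((nat \<Rightarrow>\<^sub>0 nat) \<Rightarrow>\<^sub>0 'k::field) \<Rightarrow> 'b::comm_ring_1"
  assumes iso: "poly_ring_iso m \<Phi>"
  defines "K \<equiv> range (\<lambda>c. \<Phi> (Poly_Mapping.single 0 c))"
    and "\<rho> \<equiv> (\<lambda>j. \<Phi> (Poly_Mapping.single (Poly_Mapping.single j 1) 1))"
    and "\<delta> \<equiv> (\<lambda>j x. \<Phi> (partial j (inv_into (kpolys m) \<Phi> x)))"
  shows "derivation (\<delta> j)" "c \<in> K \<Longrightarrow> \<delta> j c = 0"
    "i < m \<Longrightarrow> \<delta> j (\<rho> i) = (if i = j then 1 else 0)"
    "ring_gen (K \<union> \<rho> ` {..<m}) = UNIV"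
proof -
  let ?\<Psi> = "inv_into (kpolys m) \<Phi>"
  have inj: "inj_on \<Phi> (kpolys m)" and im: "\<Phi> ` kpolys m = UNIV"
    using iso unfolding poly_ring_iso_def bij_betw_def by blast+
  have add: "\<Phi> (x + y) = \<Phi> x + \<Phi> y" and mult: "\<Phi> (x * y) = \<Phi> x * \<Phi> y"
    if "x \<in> kpolys m" "y \<in> kpolys m" for x y
    using iso that unfolding poly_ring_iso_def by blast+
  have one: "\<Phi> 1 = 1" using iso unfolding poly_ring_iso_def by blast
  have shift_val: "0 \<in> kpolys m" by (simp add: kpolys_def)
  have zero: "\<Phi> 0 = 0" using add[OF shift_val shift_val] by simp
  have \<Psi>: "?\<Psi> x \<in> kpolys m" "\<Phi> (?\<Psi> x) = x" for x
    using im by (auto intro: inv_into_into f_inv_into_f)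
  have \<Psi>\<Phi>: "?\<Psi> (\<Phi> y) = y" if "y \<in> kpolys m" for y
    using inv_into_f_f[OF inj that] .
  have \<Psi>_add: "?\<Psi> (x + y) = ?\<Psi> x + ?\<Psi> y" for x y
    using \<Psi>\<Phi>[OF kpolys_add[OF \<Psi>(1) \<Psi>(1)], of x y] add[OF \<Psi>(1) \<Psi>(1), of x y] \<Psi>(2) by simp
  have \<Psi>_mult: "?\<Psi> (x * y) = ?\<Psi> x * ?\<Psi> y" for x y
    using \<Psi>\<Phi>[OF kpolys_mult[OF \<Psi>(1) \<Psi>(1)], of x y] mult[OF \<Psi>(1) \<Psi>(1), of x y] \<Psi>(2) by simp
  show "derivation (\<delta> j)"
    unfolding derivation_def \<delta>_def \<Psi>_add \<Psi>_mult partial_add partial_mult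
    by (simp add: add mult kpolys_mult kpolys_partial \<Psi>)
  have v: "Poly_Mapping.single (Poly_Mapping.single i 1) c \<in> kpolys m" if "i < m" for i and c :: 'k
    using that by (intro kpolys_single) simp
  have k0: "Poly_Mapping.single 0 c \<in> kpolys m" for c :: 'k by (intro kpolys_single) simp
  show "\<delta> j c = 0" if "c \<in> K"
    using that by (auto simp: K_def \<delta>_def \<Psi>\<Phi>[OF k0] partial_single zero)
  show "\<delta> j (\<rho> i) = (if i = j then 1 else 0)" if "i < m"
    unfolding \<rho>_def \<delta>_def \<Psi>\<Phi>[OF v[OF that]] partial_single
    using one zero by (auto simp: lookup_single when_def)
  let ?R = "ring_gen (K \<union> \<rho> ` {..<m})"
  have K_R: "\<Phi> (Poly_Mapping.single 0 c) \<in> ?R" for c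
    by (rule ring_gen.gen) (simp add: K_def)
  have mono: "Poly_Mapping.keys \<mu> \<subseteq> {..<m} \<longrightarrow> (\<forall>c. \<Phi> (Poly_Mapping.single \<mu> c) \<in> ?R)" for \<mu>
  proof (induction \<mu> rule: poly_mapping_single_induct)
    case (single j n)
    show ?case
    proof (induction n)
      case 0
      show ?case using K_R by simp
    next
      case (Suc n)
      show ?case
      proof (intro impI allI)
        fix c :: 'k
        assume "Poly_Mapping.keys (Poly_Mapping.single j (Suc n)) \<subseteq> {..<m}"
        then have j: "j < m" by simp
        have "Poly_Mapping.single (Poly_Mapping.single j (Suc n)) c
          = Poly_Mapping.single (Poly_Mapping.single j n) c * Poly_Mapping.single (Poly_Mapping.single j 1) 1"
          by (simp add: mult_single single_add[symmetric])
        moreover have "Poly_Mapping.single (Poly_Mapping.single j n) c \<in> kpolys m"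
          using j by (intro kpolys_single) simp
        ultimately have "\<Phi> (Poly_Mapping.single (Poly_Mapping.single j (Suc n)) c)
          = \<Phi> (Poly_Mapping.single (Poly_Mapping.single j n) c) * \<rho> j"
          using mult v[OF j] by (simp add: \<rho>_def)
        moreover have "\<Phi> (Poly_Mapping.single (Poly_Mapping.single j n) c) \<in> ?R"
          using Suc j by simp
        moreover have "\<rho> j \<in> ?R" using j by (intro ring_gen.gen) simp
        ultimately show "\<Phi> (Poly_Mapping.single (Poly_Mapping.single j (Suc n)) c) \<in> ?R"
          by (simp add: ring_gen.mult)
      qed
    qed
  next
    case (add x y)
    show ?case
    proof (intro impI allI)
      fix c :: 'k
      assume "Poly_Mapping.keys (x + y) \<subseteq> {..<m}"
      then have k: "Poly_Mapping.keys x \<subseteq> {..<m}" "Poly_Mapping.keys y \<subseteq> {..<m}"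
        by (simp_all add: keys_add_nat)
      have "Poly_Mapping.single (x + y) c = Poly_Mapping.single x c * Poly_Mapping.single y 1"
        by (simp add: mult_single)
      then have "\<Phi> (Poly_Mapping.single (x + y) c)
        = \<Phi> (Poly_Mapping.single x c) * \<Phi> (Poly_Mapping.single y 1)"
        using mult[OF kpolys_single[OF k(1)] kpolys_single[OF k(2)]] by simp
      then show "\<Phi> (Poly_Mapping.single (x + y) c) \<in> ?R" using add k by (simp add: ring_gen.mult)
    qed
  qed
  have "b \<in> ?R" for b
  proof -
    let ?x = "?\<Psi> b"
    have "(\<Sum>k\<in>S. Poly_Mapping.single k (Poly_Mapping.lookup ?x k)) \<in> kpolys m
      \<and> \<Phi> (\<Sum>k\<in>S. Poly_Mapping.single k (Poly_Mapping.lookup ?x k)) \<in> ?R"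
      if "finite S" "S \<subseteq> Poly_Mapping.keys ?x" for S
      using that
    proof (induction S)
      case empty
      show ?case using shift_val zero K_R[of 0] by simp
    next
      case (insert k S)
      have k: "Poly_Mapping.keys k \<subseteq> {..<m}"
        using insert.prems \<Psi>(1)[of b] unfolding kpolys_def by blast
      then have ks: "Poly_Mapping.single k (Poly_Mapping.lookup ?x k) \<in> kpolys m"
        by (rule kpolys_single)
      have "\<Phi> (Poly_Mapping.single k (Poly_Mapping.lookup ?x k)) \<in> ?R" using mono k by blast
      then show ?case using insert ks by (simp add: kpolys_add add ring_gen.add)
    qed
    from this[OF finite_keys subset_refl]
    have "\<Phi> (\<Sum>k\<in>Poly_Mapping.keys ?x. Poly_Mapping.single k (Poly_Mapping.lookup ?x k)) \<in> ?R" ..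
    moreover have "(\<Sum>k\<in>Poly_Mapping.keys ?x. Poly_Mapping.single k (Poly_Mapping.lookup ?x k)) = ?x"
      by (rule poly_mapping_eqI)
        (auto simp: lookup_sum lookup_single when_def sum.delta' in_keys_iff)
    ultimately show "b \<in> ?R" using \<Psi>(2) by simp
  qed
  then show "?R = UNIV" by blast
qed

lemma alg_iso_onto_rhom:
  assumes "alg_iso_onto e \<phi> A"
  shows "rhom \<phi>" "range \<phi> = A" "\<phi> (e c) = e c"
  using assms unfolding alg_iso_onto_def rhom_def bij_betw_def by blast+

theorem theorem1p2:
  fixes a :: "'a::{factorial_semiring, idom}"
    and \<theta> :: "'a poly" and f :: "'a poly" and G :: "'a poly poly"
  assumes charR: "CHAR('a) > 0"
    and a_nz: "a \<noteq> 0"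
    and theta_nz: "\<theta> \<noteq> 0" and theta_x2: "coeff \<theta> 0 = 0"
    and F_nz: "eval_at f (cst2 a * X1 + lift2 \<theta>) \<noteq> 0"
    and G_def: "cst2 a * G = lift2 \<theta> - eval_at \<theta> (X2 + cst2 a * eval_at f (cst2 a * X1 + lift2 \<theta>))"
  shows "let F = eval_at f (cst2 a * X1 + lift2 \<theta>);
             \<psi> = subst2 (X1 + G) (X2 + cst2 a * F);
             A = inv_ring \<psi>;
             Ia = (\<exists>g. {cst2 a * u + lift2 (pderiv \<theta>) * v | u v. True} = {g * w | w. True});
             Ib = principal_in A (plinth \<psi>);
             Ic = (\<exists>\<phi>. alg_iso_onto cst2 \<phi> A)
         in (\<exists>S. finite S \<and> card S \<le> 3 \<and> S \<subseteq> A \<and> alg_gen S = A)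
          \<and> (Ia \<longleftrightarrow> Ib) \<and> (Ib \<longleftrightarrow> Ic)
          \<and> (\<forall>(m::nat) (\<Phi> :: ((nat \<Rightarrow>\<^sub>0 nat) \<Rightarrow>\<^sub>0 'k::field) \<Rightarrow> 'a).
               CHAR('k) > 0 \<and> poly_ring_iso m \<Phi> \<longrightarrow>
               (Ic \<longleftrightarrow> (\<exists>\<phi>. alg_iso_onto (\<lambda>c. cst2 (\<Phi> (Poly_Mapping.single 0 c))) \<phi> A)))"
proof -
  have prime: "prime CHAR('a)" by (rule prime_CHAR_semidom[OF charR])
  from split_common_divisor[OF a_nz, of "pderiv \<theta>"]
  obtain d a1 t where split: "a = d * a1" "pderiv \<theta> = Polynomial.smult d t"
    "\<forall>l. prime l \<longrightarrow> l dvd a1 \<longrightarrow> \<not> [:l:] dvd t"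
    by (elim exE conjE)
  from separate_char_powers[OF prime split(2)]
  obtain g th1 where th: "\<theta> = pcompose g (monom 1 CHAR('a)) + Polynomial.smult d th1"
    "\<forall>i. CHAR('a) dvd i \<longrightarrow> coeff th1 i = 0"
    by (elim exE conjE)
  have "Polynomial.smult d t = Polynomial.smult d (pderiv th1)"
    unfolding split(2)[symmetric]
    by (subst th(1)) (simp add: pderiv_add pderiv_smult pderiv_pcompose_char[OF charR])
  then have "Polynomial.smult d (t - pderiv th1) = 0" by (simp add: smult_diff_right)
  moreover have "d \<noteq> 0" using split(1) a_nz by auto
  ultimately have t: "t = pderiv th1" by simp
  obtain p where p: "CHAR('a) = p" by blast
  interpret plane_split a \<theta> f G p d a1 th1 g
  proof unfold_locales
    show "eval_at f (cst2 a * X1 + lift2 \<theta>) \<noteq> 0" by (rule F_nz)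
    show "cst2 a * G = lift2 \<theta> - eval_at \<theta> (X2 + cst2 a * eval_at f (cst2 a * X1 + lift2 \<theta>))"
      by (rule G_def)
    show "CHAR('a) = p" by (rule p)
    show "prime p" using prime by (simp only: p)
    show "a \<noteq> 0" by (rule a_nz)
    show "a = d * a1" by (rule split(1))
    show "\<theta> = pcompose g (monom 1 p) + Polynomial.smult d th1" using th(1) unfolding p .
    show "coeff th1 i = 0" if "p dvd i" for i using th(2) that unfolding p by blast
    show "\<not> [:l:] dvd pderiv th1" if "prime l" "l dvd a1" for l
      using split(3) that unfolding t by blast
  qed
  have i: "\<exists>S. finite S \<and> card S \<le> 3 \<and> S \<subseteq> A \<and> alg_gen S = A"
  proof (intro exI[of _ "{q1, N, r}"] conjI)
    show "card {q1, N, r} \<le> 3" by (simp add: card_insert_if)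
    show "{q1, N, r} \<subseteq> A" using q1_A N_A r_A by simp
    show "alg_gen {q1, N, r} = A" by (rule alg_gen_A)
  qed simp
  have ab: "(\<exists>h. {cst2 a * u + lift2 (pderiv \<theta>) * v | u v. True} = {h * w | w. True})
      \<longleftrightarrow> principal_in A (plinth \<psi>)"
    unfolding ideal_principal_iff using plinth_principal_imp imp_plinth_principal by blast
  have c1: "1 \<in> I1" if "alg_iso_onto cst2 \<phi> A" for \<phi>
  proof (rule iso_imp[OF alg_iso_onto_rhom[OF that], where K = UNIV and m = 0 and \<rho> = "\<lambda>_. 0"
        and \<delta> = "\<lambda>_ _. 0"])
    show "ring_gen (UNIV \<union> (\<lambda>_. 0) ` {..<0::nat}) = (UNIV :: 'a set)"
      by (intro equalityI subset_UNIV subsetI ring_gen.gen UnI1)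
  qed simp_all
  have bc: "principal_in A (plinth \<psi>) \<longleftrightarrow> (\<exists>\<phi>. alg_iso_onto cst2 \<phi> A)"
    using c1 imp_iso plinth_principal_imp imp_plinth_principal by blast
  have cd: "(\<exists>\<phi>. alg_iso_onto cst2 \<phi> A) \<longleftrightarrow>
      (\<exists>\<phi>. alg_iso_onto (\<lambda>c. cst2 (\<Phi> (Poly_Mapping.single 0 c))) \<phi> A)"
    if iso: "poly_ring_iso m \<Phi>" for m and \<Phi> :: "((nat \<Rightarrow>\<^sub>0 nat) \<Rightarrow>\<^sub>0 'k) \<Rightarrow> 'a"
  proof
    assume "\<exists>\<phi>. alg_iso_onto cst2 \<phi> A"
    then show "\<exists>\<phi>. alg_iso_onto (\<lambda>c. cst2 (\<Phi> (Poly_Mapping.single 0 c))) \<phi> A"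
      unfolding alg_iso_onto_def by blast
  next
    assume "\<exists>\<phi>. alg_iso_onto (\<lambda>c. cst2 (\<Phi> (Poly_Mapping.single 0 c))) \<phi> A"
    then obtain \<phi> where \<phi>: "alg_iso_onto (\<lambda>c. cst2 (\<Phi> (Poly_Mapping.single 0 c))) \<phi> A" ..
    have "1 \<in> I1"
    proof (rule iso_imp[OF alg_iso_onto_rhom(1,2)[OF \<phi>] _ kpoly_derivations(1-4)[OF iso]])
      show "\<phi> (cst2 c) = cst2 c" if "c \<in> range (\<lambda>c. \<Phi> (Poly_Mapping.single 0 c))" for c
        using that alg_iso_onto_rhom(3)[OF \<phi>] by auto
    qed
    then show "\<exists>\<phi>. alg_iso_onto cst2 \<phi> A" by (rule imp_iso)
  qed
  show ?thesis
    unfolding Let_def F_def[symmetric] \<psi>_def[symmetric] A_def[symmetric]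
    using i ab bc cd by blast
qed

end
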